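(* Let $T=(\pi,\lambda)$ be a hyperbolically self-similar IET of $d\ge2$ intervals on $[0,1)$ and let $M$ be its positive self-similarity matrix. Let $f\in\operatorname{Aff}(T,\omega)$, where $\omega$ is of central-stable type, and let $h$ be the conjugacy of $f$ and $T$ ($h\circ f=T\circ h$). Then $$\mathfrak H(h^{-1})=\frac{\xi^f}{\rho_T}\qquad\text{and}\qquad 0<\frac{\xi^f}{\rho_T}<\dim_H(\nu_\omega),$$ where $\rho_T$ is the logarithm of the Perron–Frobenius eigenvalue of $M$, $\xi^f$ is defined in the context, and $\nu_\omega$ is the unique $\phi_\omega$-conformal measure for $T$.
   Context: **AIETs.** Let $\mathcal A$ be a finite alphabet with $d\ge 2$ letters. A permutation is a pair $\pi=(\pi_t,\pi_b)$ of bijections $\mathcal A\to\{1,\dots,d\}$, always assumed irreducible: $\pi_t^{-1}\{1,\dots,k\}\ne\pi_b^{-1}\{1,\dots,k\}$ for $1\le k<d$. An affine interval exchange transformation (AIET) $f=(\pi,\lambda,\omega)$, with $\lambda\in\mathbb R_{>0}^{\mathcal A}$ and log-slope vector $\omega\in\mathbb R^{\mathcal A}$, is a bijection of $I=[0,\sum_\alpha\lambda_\alpha)$ which maps each interval of the partition of $I$ into left-closed right-open intervals $I_\alpha=I_\alpha(f)$ of lengths $\lambda_\alpha$ (ordered from left to right according to $\pi_t$) affinely with slope $e^{\omega_\alpha}$, the images $f(I_\alpha)$ being ordered from left to right according to $\pi_b$. An IET $T=(\pi,\lambda)$ is an AIET with $\omega=0$. **Rauzy–Veech induction.** Put $\alpha(\varepsilon)=\pi_\varepsilon^{-1}(d)$,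 $\varepsilon\in\{t,b\}$. If $|I_{\alpha(t)}|>|f(I_{\alpha(b)})|$ (top type, winner $\alpha(t)$), set $I^{(1)}=I\setminus f(I_{\alpha(b)})$, $I^{(1)}_{\alpha(t)}=I_{\alpha(t)}\setminus f(I_{\alpha(b)})$ and $I^{(1)}_\alpha=I_\alpha$ for the other letters. If $|I_{\alpha(t)}|<|f(I_{\alpha(b)})|$ (bottom type, winner $\alpha(b)$), set $I^{(1)}=I\setminus I_{\alpha(t)}$, $I^{(1)}_{\alpha(t)}=f^{-1}(I_{\alpha(t)})$, $I^{(1)}_{\alpha(b)}=I_{\alpha(b)}\setminus f^{-1}(I_{\alpha(t)})$ and $I^{(1)}_\alpha=I_\alpha$ for the other letters. The first return map of $f$ to $I^{(1)}$ is an AIET exchanging the $I^{(1)}_\alpha$. If this can be iterated forever (no equality of lengths occurs), $f$ is infinitely renormalizable; one gets intervals $I^{(n)}$, $I^{(n)}_\alpha=I^{(n)}_\alpha(f)$, permutations $\pi^{(n)}$ and return times $q^{(n)}_\alpha$ such that the first return map of $f$ to $I^{(n)}$ equals $f^{q^{(n)}_\alpha}$ on $I^{(n)}_\alpha$. The combinatorial rotation number $\gamma(f)$ is the infinite sequence of pairs ($\pi^{(n)}$, type of step $n$), $n\ge0$; it is $\infty$-complete if every letter is a winner infinitely often. **Hyperbolic self-similarity.** An IET $T=(\pi,\lambda)$ on $[0,1)$ is self-similar if $\gamma(T)$ is $\infty$-complete and periodic. For a period $N$, the self-similarity matrix is $M=M(T)$, $M_{\alpha\beta}=\#\{0\le k<q^{(N)}_\alpha: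 T^kI^{(N)}_\alpha\subset I_\beta\}$; then $\lambda M=e^{\rho_T}\lambda$. Let $\Omega_\pi$ be the matrix with $(\Omega_\pi)_{\alpha\beta}=1$ if $\pi_b(\alpha)>\pi_b(\beta),\pi_t(\alpha)<\pi_t(\beta)$; $-1$ if $\pi_b(\alpha)<\pi_b(\beta),\pi_t(\alpha)>\pi_t(\beta)$; $0$ otherwise; put $\kappa-1=\dim\ker\Omega_\pi$ and $2g=d-(\kappa-1)$. $T$ is hyperbolically self-similar if it is self-similar and $M$ has $g$ simple real eigenvalues of modulus $>1$ and $g$ simple real eigenvalues of modulus $<1$, all with pairwise distinct moduli, and eigenvalue $1$ with $\kappa-1$ independent fixed vectors; so $\mathbb R^{\mathcal A}$ has a basis of right eigenvectors of $M$: $g$ expanding, $g$ contracting, $\kappa-1$ fixed. Convention: $N$ is replaced by a multiple so that all entries and all eigenvalues of $M$ are positive. **Types.** A vector $\omega$ with $\langle\omega,\lambda\rangle=0$ is of central-stable type if in its decomposition in the eigenbasis of $M$ at least one fixed but no expanding eigenvector occurs; then $\omega=\omega_c+\omega_s$ with $M\omega_c=\omega_c\ne0$ and $\omega_s$ a combination of contracting eigenvectors. **Aff and conformal measures.** $\operatorname{Aff}(T,\omega)$ is the set of AIETs $f$ on $[0,1)$ with log-slope vector $\omega$ and $\gamma(f)=\gamma(T)$; for $\omega$ of central-stable type such $f$ is (known fact) conjugated to $T$ by an increasing homeomorphism $h$ of $[0,1)$ (extended to $[0,1]$ by $h(1)=1$). $\phi_v:[0,1)\to\mathbb R$ equals $v_\alpha$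 on $I_\alpha(T)$; a Borel probability $\nu$ is $\phi_v$-conformal for $T$ if $T_*\nu\sim\nu$ and $\frac{d(T^{-1})_*\nu}{d\nu}=e^{\phi_v}$. For $v$ of central-stable type it exists, is unique and is denoted $\nu_v$. **The number $\xi^f$.** Let $\nu=\nu_{\omega_c}$, let $\Sigma=\{(\alpha,i):\alpha\in\mathcal A,\ 0\le i<q^{(N)}_\alpha\}$, and for $(\alpha,i)\in\Sigma$ let $\beta(\alpha,i)$ be the letter with $T^iI^{(N)}_\alpha\subset I_{\beta(\alpha,i)}$ (intervals of $T$). For $n\ge1$, $$\xi_n=\frac1n\min\Big\{-\sum_{j=1}^n\log\frac{\nu\big(T^{i_j}I^{(N)}_{\alpha_j}\big)}{\nu\big(I_{\alpha_{j-1}}\big)}\ :\ (\alpha_j,i_j)\in\Sigma\ (0\le j\le n),\ \beta(\alpha_j,i_j)=\alpha_{j-1}\ (1\le j\le n)\Big\},$$ and $\xi^f:=\lim_{n\to\infty}\xi_n=\sup_{n\ge1}\xi_n$ (the limit exists by superadditivity of $n\xi_n$). **Hölder exponent.** $\mathfrak H(u)=\sup\{a>0:\exists C>0\ \forall x,y\in[0,1]\ |u(y)-u(x)|\le C|y-x|^a\}$. **Dimension.** For a Borel probability $\mu$ on $\mathbb R$, $\dim_H(\mu)=\inf\{\dim_H(E): E\text{ Borel},\ \mu(E)=1\}$. *)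

theory Defs
  imports "HOL-Analysis.Analysis" "HOL-Computational_Algebra.Polynomial"
begin

section \<open>Affine interval exchange transformations\<close>

text \<open>The alphabet is the finite type \<open>'a\<close>, so \<open>d = CARD('a)\<close>. The record holds the data
  \<open>(\<pi>\<^sub>t, \<pi>\<^sub>b, \<lambda>, \<omega>)\<close>, which the map together with its labelled intervals determines.\<close>

record ('a::finite) aiet =
  ptop :: "'a \<Rightarrow> nat"
  pbot :: "'a \<Rightarrow> nat"
  len :: "real ^ 'a"
  slope :: "real ^ 'a"

definition irreducible_perm :: "('a::finite \<Rightarrow> nat) \<Rightarrow> ('a \<Rightarrow> nat) \<Rightarrow> bool" where
  "irreducible_perm p q \<longleftrightarrow>
     bij_betw p UNIV {1..CARD('a)} \<and> bij_betw q UNIV {1..CARD('a)} \<and>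
     (\<forall>k. 1 \<le> k \<and> k < CARD('a) \<longrightarrow> p -` {1..k} \<noteq> q -` {1..k})"

definition dom_ivl :: "'a::finite aiet \<Rightarrow> real set" where
  "dom_ivl f = {0..<(\<Sum>\<alpha>\<in>UNIV. len f $ \<alpha>)}"

definition image_len :: "'a::finite aiet \<Rightarrow> 'a \<Rightarrow> real" where
  "image_len f \<alpha> = exp (slope f $ \<alpha>) * len f $ \<alpha>"

definition top_left :: "'a::finite aiet \<Rightarrow> 'a \<Rightarrow> real" where
  "top_left f \<alpha> = (\<Sum>\<beta> | ptop f \<beta> < ptop f \<alpha>. len f $ \<beta>)"

definition bot_left :: "'a::finite aiet \<Rightarrow> 'a \<Rightarrow> real" where
  "bot_left f \<alpha> = (\<Sum>\<beta> | pbot f \<beta> < pbot f \<alpha>. image_len f \<beta>)"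

definition ivl :: "'a::finite aiet \<Rightarrow> 'a \<Rightarrow> real set" where
  "ivl f \<alpha> = {top_left f \<alpha>..<top_left f \<alpha> + len f $ \<alpha>}"

definition letter_at :: "'a::finite aiet \<Rightarrow> real \<Rightarrow> 'a" where
  "letter_at f x = (THE \<alpha>. x \<in> ivl f \<alpha>)"

text \<open>Extended by the identity outside \<open>dom_ivl f\<close>, so that it is a bijection of \<open>\<real>\<close>.\<close>

definition amap :: "'a::finite aiet \<Rightarrow> real \<Rightarrow> real" where
  "amap f x =
     (if x \<in> dom_ivl f
      then let \<alpha> = letter_at f x
           in bot_left f \<alpha> + exp (slope f $ \<alpha>) * (x - top_left f \<alpha>)
      else x)"

text \<open>The last conjunct expresses that the images fill the domain, i.e. that the map is a
  bijection of \<open>dom_ivl f\<close>.\<close>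

definition is_aiet :: "'a::finite aiet \<Rightarrow> bool" where
  "is_aiet f \<longleftrightarrow>
     irreducible_perm (ptop f) (pbot f) \<and> (\<forall>\<alpha>. len f $ \<alpha> > 0) \<and>
     (\<Sum>\<alpha>\<in>UNIV. image_len f \<alpha>) = (\<Sum>\<alpha>\<in>UNIV. len f $ \<alpha>)"

definition is_iet :: "'a::finite aiet \<Rightarrow> bool" where
  "is_iet T \<longleftrightarrow> is_aiet T \<and> slope T = 0"

section \<open>Rauzy--Veech induction\<close>

definition return_time :: "(real \<Rightarrow> real) \<Rightarrow> real set \<Rightarrow> real \<Rightarrow> nat" where
  "return_time g J x = (LEAST r. 1 \<le> r \<and> (g ^^ r) x \<in> J)"

definition first_return :: "(real \<Rightarrow> real) \<Rightarrow> real set \<Rightarrow> real \<Rightarrow> real" where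
  "first_return g J x = (g ^^ return_time g J x) x"

datatype rv_type = Top | Bottom

definition last_top :: "'a::finite aiet \<Rightarrow> 'a" where
  "last_top f = (THE \<alpha>. ptop f \<alpha> = CARD('a))"

definition last_bot :: "'a::finite aiet \<Rightarrow> 'a" where
  "last_bot f = (THE \<alpha>. pbot f \<alpha> = CARD('a))"

definition rv_defined :: "'a::finite aiet \<Rightarrow> bool" where
  "rv_defined f \<longleftrightarrow> len f $ last_top f \<noteq> image_len f (last_bot f)"

definition rv_type_of :: "'a::finite aiet \<Rightarrow> rv_type" where
  "rv_type_of f = (if len f $ last_top f > image_len f (last_bot f) then Top else Bottom)"

definition winner :: "'a::finite aiet \<Rightarrow> 'a" where
  "winner f = (case rv_type_of f of Top \<Rightarrow> last_top f | Bottom \<Rightarrow> last_bot f)"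

definition induced_dom :: "'a::finite aiet \<Rightarrow> real set" where
  "induced_dom f =
     (case rv_type_of f of
        Top \<Rightarrow> dom_ivl f - amap f ` ivl f (last_bot f)
      | Bottom \<Rightarrow> dom_ivl f - ivl f (last_top f))"

definition induced_ivl :: "'a::finite aiet \<Rightarrow> 'a \<Rightarrow> real set" where
  "induced_ivl f \<alpha> =
     (case rv_type_of f of
        Top \<Rightarrow>
          if \<alpha> = last_top f then ivl f \<alpha> - amap f ` ivl f (last_bot f) else ivl f \<alpha>
      | Bottom \<Rightarrow>
          if \<alpha> = last_top f then amap f -` ivl f (last_top f)
          else if \<alpha> = last_bot f then ivl f \<alpha> - amap f -` ivl f (last_top f)
          else ivl f \<alpha>)"

text \<open>The AIET exchanging the induced intervals which is the first return map of \<open>f\<close>.\<close>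

definition rv_step :: "'a::finite aiet \<Rightarrow> 'a aiet" where
  "rv_step f =
     (THE g. is_aiet g \<and> dom_ivl g = induced_dom f \<and> (\<forall>\<alpha>. ivl g \<alpha> = induced_ivl f \<alpha>) \<and>
             (\<forall>x\<in>induced_dom f. amap g x = first_return (amap f) (induced_dom f) x))"

definition rv :: "'a::finite aiet \<Rightarrow> nat \<Rightarrow> 'a aiet" where
  "rv f n = (rv_step ^^ n) f"

definition infinitely_renormalizable :: "'a::finite aiet \<Rightarrow> bool" where
  "infinitely_renormalizable f \<longleftrightarrow> (\<forall>n. rv_defined (rv f n))"

definition rotation_number ::
    "'a::finite aiet \<Rightarrow> nat \<Rightarrow> (('a \<Rightarrow> nat) \<times> ('a \<Rightarrow> nat)) \<times> rv_type" where
  "rotation_number f n = ((ptop (rv f n), pbot (rv f n)), rv_type_of (rv f n))"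

definition infinity_complete :: "'a::finite aiet \<Rightarrow> bool" where
  "infinity_complete f \<longleftrightarrow> (\<forall>\<alpha>. \<exists>\<^sub>\<infinity>n. winner (rv f n) = \<alpha>)"

definition rv_return_time :: "'a::finite aiet \<Rightarrow> nat \<Rightarrow> 'a \<Rightarrow> nat" where
  "rv_return_time f n \<alpha> =
     (THE q. \<forall>x\<in>ivl (rv f n) \<alpha>. return_time (amap f) (dom_ivl (rv f n)) x = q)"

section \<open>Hyperbolic self-similarity\<close>

definition is_period :: "'a::finite aiet \<Rightarrow> nat \<Rightarrow> bool" where
  "is_period T N \<longleftrightarrow> 1 \<le> N \<and> (\<forall>n. rotation_number T (n + N) = rotation_number T n)"

definition self_similar :: "'a::finite aiet \<Rightarrow> bool" where
  "self_similar T \<longleftrightarrow>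
     is_iet T \<and> dom_ivl T = {0..<1} \<and> infinitely_renormalizable T \<and>
     infinity_complete T \<and> (\<exists>N. is_period T N)"

definition ss_matrix :: "'a::finite aiet \<Rightarrow> nat \<Rightarrow> real ^ 'a ^ 'a" where
  "ss_matrix T N =
     (\<chi> \<alpha> \<beta>. real (card {k. k < rv_return_time T N \<alpha> \<and>
                              (amap T ^^ k) ` ivl (rv T N) \<alpha> \<subseteq> ivl T \<beta>}))"

definition Omega :: "'a::finite aiet \<Rightarrow> real ^ 'a ^ 'a" where
  "Omega T =
     (\<chi> \<alpha> \<beta>. if pbot T \<alpha> > pbot T \<beta> \<and> ptop T \<alpha> < ptop T \<beta> then 1
              else if pbot T \<alpha> < pbot T \<beta> \<and> ptop T \<alpha> > ptop T \<beta> then - 1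
              else 0)"

text \<open>This number is \<open>\<kappa> - 1\<close>.\<close>

definition kernel_dim :: "'a::finite aiet \<Rightarrow> nat" where
  "kernel_dim T = dim {v. Omega T *v v = 0}"

text \<open>The difference is the rank of an antisymmetric matrix, hence even.\<close>

definition genus :: "'a::finite aiet \<Rightarrow> nat" where
  "genus T = (CARD('a) - kernel_dim T) div 2"

definition charpoly :: "real ^ 'a ^ 'a \<Rightarrow> real poly" where
  "charpoly A = det (\<chi> i j. (if i = j then [:0, 1:] else 0) - [:A $ i $ j:])"

definition simple_eigenvalue :: "real ^ 'a ^ 'a \<Rightarrow> real \<Rightarrow> bool" where
  "simple_eigenvalue A c \<longleftrightarrow> order c (charpoly A) = 1"

definition complex_eigenvalues :: "real ^ 'a ^ 'a \<Rightarrow> complex set" where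
  "complex_eigenvalues A =
     {c. \<exists>v :: complex ^ 'a. v \<noteq> 0 \<and> (\<chi> i j. complex_of_real (A $ i $ j)) *v v = c *s v}"

definition hyperbolic_matrix :: "'a::finite aiet \<Rightarrow> real ^ 'a ^ 'a \<Rightarrow> bool" where
  "hyperbolic_matrix T A \<longleftrightarrow>
     card {c. simple_eigenvalue A c \<and> \<bar>c\<bar> > 1} = genus T \<and>
     card {c. simple_eigenvalue A c \<and> \<bar>c\<bar> < 1} = genus T \<and>
     inj_on abs {c. simple_eigenvalue A c \<and> \<bar>c\<bar> \<noteq> 1} \<and>
     dim {v. A *v v = v} = kernel_dim T"

definition hyperbolically_self_similar :: "'a::finite aiet \<Rightarrow> bool" where
  "hyperbolically_self_similar T \<longleftrightarrow>
     self_similar T \<and> (\<exists>N. is_period T N \<and> hyperbolic_matrix T (ss_matrix T N))"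

text \<open>The periods allowed by the convention that all entries and all eigenvalues of the
  self-similarity matrix are positive.\<close>

definition positive_period :: "'a::finite aiet \<Rightarrow> nat \<Rightarrow> bool" where
  "positive_period T N \<longleftrightarrow>
     is_period T N \<and> hyperbolic_matrix T (ss_matrix T N) \<and>
     (\<forall>\<alpha> \<beta>. ss_matrix T N $ \<alpha> $ \<beta> > 0) \<and>
     (\<forall>c\<in>complex_eigenvalues (ss_matrix T N). c \<in> \<real> \<and> Re c > 0)"

text \<open>The Perron--Frobenius eigenvalue of a positive matrix is its spectral radius.\<close>

definition pf_eigenvalue :: "real ^ 'a ^ 'a \<Rightarrow> real" where
  "pf_eigenvalue A = Max (cmod ` complex_eigenvalues A)"

definition rho :: "'a::finite aiet \<Rightarrow> nat \<Rightarrow> real" where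
  "rho T N = ln (pf_eigenvalue (ss_matrix T N))"

definition contracting_space :: "real ^ 'a ^ 'a \<Rightarrow> (real ^ 'a) set" where
  "contracting_space A = span {v. \<exists>c. \<bar>c\<bar> < 1 \<and> A *v v = c *\<^sub>R v}"

definition central_stable_type :: "'a::finite aiet \<Rightarrow> nat \<Rightarrow> real ^ 'a \<Rightarrow> bool" where
  "central_stable_type T N \<omega> \<longleftrightarrow>
     \<omega> \<bullet> len T = 0 \<and>
     (\<exists>\<omega>\<^sub>c \<omega>\<^sub>s. \<omega> = \<omega>\<^sub>c + \<omega>\<^sub>s \<and> ss_matrix T N *v \<omega>\<^sub>c = \<omega>\<^sub>c \<and> \<omega>\<^sub>c \<noteq> 0 \<and>
              \<omega>\<^sub>s \<in> contracting_space (ss_matrix T N))"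

definition central_part :: "'a::finite aiet \<Rightarrow> nat \<Rightarrow> real ^ 'a \<Rightarrow> real ^ 'a" where
  "central_part T N \<omega> =
     (THE \<omega>\<^sub>c. ss_matrix T N *v \<omega>\<^sub>c = \<omega>\<^sub>c \<and> \<omega> - \<omega>\<^sub>c \<in> contracting_space (ss_matrix T N))"

definition Aff :: "'a::finite aiet \<Rightarrow> real ^ 'a \<Rightarrow> 'a aiet set" where
  "Aff T \<omega> =
     {f. is_aiet f \<and> dom_ivl f = {0..<1} \<and> slope f = \<omega> \<and>
         infinitely_renormalizable f \<and> rotation_number f = rotation_number T}"

definition conjugacy :: "'a::finite aiet \<Rightarrow> 'a aiet \<Rightarrow> (real \<Rightarrow> real) \<Rightarrow> bool" where
  "conjugacy f T h \<longleftrightarrow>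
     (\<exists>k. homeomorphism {0..<1} {0..<1} h k) \<and> strict_mono_on {0..<1} h \<and> h 1 = 1 \<and>
     (\<forall>x\<in>{0..<1}. h (amap f x) = amap T (h x))"

section \<open>Conformal measures and the number \<open>\<xi>\<close>\<close>

definition phi :: "'a::finite aiet \<Rightarrow> real ^ 'a \<Rightarrow> real \<Rightarrow> real" where
  "phi T v x = (if x \<in> dom_ivl T then v $ letter_at T x else 0)"

text \<open>Measures on \<open>[0,1)\<close> are taken as Borel measures on \<open>\<real>\<close> giving \<open>[0,1)\<close> full mass.\<close>

definition conformal_measure :: "'a::finite aiet \<Rightarrow> real ^ 'a \<Rightarrow> real measure \<Rightarrow> bool" where
  "conformal_measure T v \<nu> \<longleftrightarrow>
     sets \<nu> = sets borel \<and> emeasure \<nu> UNIV = 1 \<and> emeasure \<nu> {0..<1} = 1 \<and>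
     absolutely_continuous \<nu> (distr \<nu> borel (amap T)) \<and>
     absolutely_continuous (distr \<nu> borel (amap T)) \<nu> \<and>
     distr \<nu> borel (inv (amap T)) = density \<nu> (\<lambda>x. ennreal (exp (phi T v x)))"

definition tower_index :: "'a::finite aiet \<Rightarrow> nat \<Rightarrow> ('a \<times> nat) set" where
  "tower_index T N = {(\<alpha>, i). i < rv_return_time T N \<alpha>}"

definition tower_floor :: "'a::finite aiet \<Rightarrow> nat \<Rightarrow> 'a \<times> nat \<Rightarrow> real set" where
  "tower_floor T N = (\<lambda>(\<alpha>, i). (amap T ^^ i) ` ivl (rv T N) \<alpha>)"

definition floor_letter :: "'a::finite aiet \<Rightarrow> nat \<Rightarrow> 'a \<times> nat \<Rightarrow> 'a" where
  "floor_letter T N s = (THE \<beta>. tower_floor T N s \<subseteq> ivl T \<beta>)"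

definition xi_seq :: "'a::finite aiet \<Rightarrow> nat \<Rightarrow> real measure \<Rightarrow> nat \<Rightarrow> real" where
  "xi_seq T N \<nu> n =
     1 / real n *
     Min {- (\<Sum>j=1..n. ln (measure \<nu> (tower_floor T N (s j)) /
                            measure \<nu> (ivl T (fst (s (j - 1)))))) | s.
          (\<forall>j\<le>n. s j \<in> tower_index T N) \<and>
          (\<forall>j\<in>{1..n}. floor_letter T N (s j) = fst (s (j - 1)))}"

definition xi :: "'a::finite aiet \<Rightarrow> nat \<Rightarrow> real measure \<Rightarrow> real" where
  "xi T N \<nu> = lim (xi_seq T N \<nu>)"

section \<open>Hoelder exponent and Hausdorff dimension\<close>

definition holder_exponent :: "(real \<Rightarrow> real) \<Rightarrow> ereal" where
  "holder_exponent u =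
     Sup (ereal ` {a. a > 0 \<and>
            (\<exists>C>0. \<forall>x\<in>{0..1}. \<forall>y\<in>{0..1}. \<bar>u y - u x\<bar> \<le> C * \<bar>y - x\<bar> powr a)})"

definition hausdorff_premeasure :: "real \<Rightarrow> real \<Rightarrow> real set \<Rightarrow> ennreal" where
  "hausdorff_premeasure s \<delta> E =
     Inf {\<Sum>i. ennreal (diameter (U i) powr s) | U :: nat \<Rightarrow> real set.
          E \<subseteq> (\<Union>i. U i) \<and> (\<forall>i. bounded (U i) \<and> diameter (U i) \<le> \<delta>)}"

definition hausdorff_measure :: "real \<Rightarrow> real set \<Rightarrow> ennreal" where
  "hausdorff_measure s E = (SUP \<delta>\<in>{0<..}. hausdorff_premeasure s \<delta> E)"

text \<open>Restricting to \<open>s > 0\<close> does not change the infimum and avoids the value of \<open>0 powr 0\<close>.\<close>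

definition hausdorff_dim :: "real set \<Rightarrow> ereal" where
  "hausdorff_dim E = Inf (ereal ` {s. s > 0 \<and> hausdorff_measure s E = 0})"

definition measure_hausdorff_dim :: "real measure \<Rightarrow> ereal" where
  "measure_hausdorff_dim \<mu> = Inf (hausdorff_dim ` {E \<in> sets borel. emeasure \<mu> E = 1})"

end

theory Submission
  imports Defs
begin

text \<open>By self-similarity the first return map of \<open>T\<close> to \<open>I\<^sup>(\<^sup>N\<^sup>)\<close> is \<open>T\<close> rescaled by \<open>r = e\<^sup>\<rho>\<close>, so the tower floors of
  level \<open>n\<close> are the cylinders of a graph-directed iterated function system with contraction \<open>1/r\<close>. As
  \<open>M \<omega>\<^sub>c = \<omega>\<^sub>c\<close>, the measure \<open>\<nu>\<^sub>c\<close> is Markov in this coding: its cylinders have mass \<open>e\<close> to minus the weight of a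
  path, up to a constant, and \<open>\<xi>\<close> is the minimal mean weight of a path. The contracting part of \<open>\<omega>\<close> only
  changes masses of cylinders by a bounded factor, so this also describes every \<open>\<phi>\<^sub>\<omega>\<close>-conformal measure; one of them is the
  image of Lebesgue measure under \<open>h\<close>, whose mass on \<open>[x,y)\<close> is \<open>h\<^sup>-\<^sup>1 y - h\<^sup>-\<^sup>1 x\<close>. An interval of length about
  \<open>r\<^sup>-\<^sup>n\<close> is covered by two cylinders of level \<open>n\<close>, and the heaviest cylinder has mass about \<open>e\<close> to the
  \<open>- n \<xi>\<close>; this gives the exponent \<open>\<xi>/\<rho>\<close>. For the dimension, the sum of the squared masses is exponentially
  smaller than \<open>e\<close> to the \<open>- n \<xi>\<close>, unless all cycles have the same mean weight; in that case \<open>\<omega>\<^sub>c\<close> would be a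
  coboundary of a step function, which the absence of connections forces to be constant, so \<open>\<omega>\<^sub>c = 0\<close>.\<close>

section \<open>Intervals ordered by a permutation\<close>

text \<open>One lemma on positive matrices, \<open>backward_orbit_eigenvector\<close>, supplies both
  scaling constants. The length vectors of the renormalizations of \<open>T\<close>, and the
  interval masses of the rescalings of the central measure \<open>m\<close>, are infinite backward
  orbits of a fixed positive matrix, and such orbits are geometric sequences. This gives
  \<open>r\<close> for lengths and \<open>R\<close> for masses. For masses the matrix is the same at
  all levels because the central part is fixed by \<open>M\<close>; for \<omega> itself it changes
  with the level, hence the comparison of measures. Path weights are controlled up to constants
  independent of the level: as \<open>M\<close> is positive, any two letters are joined by one edge,
  and optimal paths can be glued at a cost of at most \<open>wmax\<close>. The definition of the
  conjugacy says nothing about letters. That \<open>h\<close> carries the intervals of the AIET to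
  those of \<open>T\<close> has to be derived; it comes from the orbit of the common left endpoint
  0, whose itinerary is determined by the rotation number.\<close>

definition lft :: "('a::finite \<Rightarrow> nat) \<Rightarrow> ('a \<Rightarrow> real) \<Rightarrow> 'a \<Rightarrow> real" where
  "lft p l a = (\<Sum>b | p b < p a. l b)"

lemma lft_step:
  assumes "\<And>a. 0 \<le> l a" "p a < p b"
  shows "lft p l a + l a \<le> lft p l b"
proof -
  have "lft p l a + l a = sum l (insert a {c. p c < p a})"
    by (simp add: lft_def)
  also have "\<dots> \<le> sum l {c. p c < p b}"
    by (rule sum_mono2) (use assms in auto)
  finally show ?thesis by (simp add: lft_def)
qed

lemma lft_nonneg: "(\<And>a. 0 \<le> l a) \<Longrightarrow> 0 \<le> lft p l a"
  by (simp add: lft_def sum_nonneg)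

lemma lft_le_sum:
  assumes "\<And>a. 0 \<le> l a"
  shows "lft p l a + l a \<le> sum l UNIV"
proof -
  have "lft p l a + l a = sum l (insert a {c. p c < p a})"
    by (simp add: lft_def)
  also have "\<dots> \<le> sum l UNIV"
    by (rule sum_mono2) (use assms in auto)
  finally show ?thesis .
qed

lemma lft_last:
  fixes p :: "'a::finite \<Rightarrow> nat"
  assumes p: "bij_betw p UNIV {1..CARD('a)}" and "p a = CARD('a)"
  shows "lft p l a + l a = sum l UNIV"
proof -
  have "UNIV = insert a {c. p c < p a}"
  proof -
    have "p c < p a \<or> c = a" for c
    proof (cases "c = a")
      case False
      then have "p c \<noteq> p a" using p by (auto simp: bij_betw_def inj_def)
      moreover have "p c \<in> {1..CARD('a)}" using p by (auto simp: bij_betw_def)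
      ultimately show ?thesis using assms(2) by auto
    qed auto
    then show ?thesis by auto
  qed
  then have "sum l UNIV = sum l (insert a {c. p c < p a})" by metis
  then show ?thesis by (simp add: lft_def)
qed

lemma lft_first:
  fixes p :: "'a::finite \<Rightarrow> nat"
  assumes p: "bij_betw p UNIV {1..CARD('a)}" and "p a = 1"
  shows "lft p l a = 0"
proof -
  have "{c. p c < p a} = {}"
  proof -
    have "p c \<ge> 1" for c using bij_betwE[OF p] by auto
    then show ?thesis using assms(2) by (auto simp: not_less Suc_le_eq)
  qed
  then show ?thesis unfolding lft_def by simp
qed

lemma lft_Suc:
  assumes "inj p" "p b = Suc (p a)"
  shows "lft p l b = lft p l a + l a"
proof -
  have "{c. p c < p b} = insert a {c. p c < p a}"
    using assms by (auto simp: less_Suc_eq inj_def)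
  then show ?thesis by (simp add: lft_def)
qed

lemma lft_cover:
  fixes p :: "'a::finite \<Rightarrow> nat"
  assumes p: "bij_betw p UNIV {1..CARD('a)}" and l: "\<And>a. 0 < l a"
    and x: "0 \<le> x" "x < sum l UNIV"
  shows "\<exists>a. lft p l a \<le> x \<and> x < lft p l a + l a"
proof -
  have "1 \<in> range p" using p by (auto simp: bij_betw_def Suc_le_eq)
  then obtain a0 where a0: "p a0 = 1" by auto
  define S where "S = {a. lft p l a \<le> x}"
  have "S \<noteq> {}" using lft_first[OF p a0, of l] x by (auto simp: S_def intro!: exI[of _ a0])
  then have "Max (p ` S) \<in> p ` S" by (intro Max_in) auto
  then obtain a where a: "a \<in> S" "p a = Max (p ` S)" by auto
  have mx: "p b \<le> p a" if "b \<in> S" for b using a that by auto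
  have "x < lft p l a + l a"
  proof (cases "p a = CARD('a)")
    case True
    then show ?thesis using lft_last[OF p True, of l] x by simp
  next
    case False
    then have "Suc (p a) \<in> range p" using p
      by (auto simp: bij_betw_def) (metis Suc_leI atLeastAtMost_iff le_neq_implies_less le_SucI rangeI Suc_le_mono le0 One_nat_def)
    then obtain b where b: "p b = Suc (p a)" by auto
    then have "b \<notin> S" using mx by force
    then show ?thesis using lft_Suc[OF _ b, of l] p by (auto simp: S_def bij_betw_def)
  qed
  then show ?thesis using a by (auto simp: S_def)
qed

lemma lft_unique:
  fixes p :: "'a::finite \<Rightarrow> nat"
  assumes p: "inj p" and l: "\<And>a. 0 < l a"
    and "lft p l a \<le> x" "x < lft p l a + l a" "lft p l b \<le> x" "x < lft p l b + l b"
  shows "a = b"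
proof -
  have "\<not> p a < p b" "\<not> p b < p a"
    using lft_step[of l p a b] lft_step[of l p b a] assms less_imp_le[OF l] by fastforce+
  then show ?thesis using p by (auto simp: inj_def)
qed

lemma lft_less_iff:
  fixes p :: "'a::finite \<Rightarrow> nat"
  assumes p: "inj p" and l: "\<And>a. 0 < l a"
  shows "lft p l a < lft p l b \<longleftrightarrow> p a < p b"
proof -
  have s: "p a < p b \<Longrightarrow> lft p l a < lft p l b" for a b
    using lft_step[of l p a b] l[of a] less_imp_le[OF l] by force
  show ?thesis using s[of a b] s[of b a] p by (metis injD linorder_neqE_nat not_less_iff_gr_or_eq)
qed

lemma perm_card:
  fixes p :: "'a::finite \<Rightarrow> nat"
  assumes p: "bij_betw p UNIV {1..CARD('a)}"
  shows "p a = card {b. p b \<le> p a}"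
proof -
  have "p ` {b. p b \<le> p a} = {1..p a}"
  proof
    show "{1..p a} \<subseteq> p ` {b. p b \<le> p a}"
    proof
      fix k assume k: "k \<in> {1..p a}"
      have "p a \<le> CARD('a)" using p by (auto simp: bij_betw_def)
      then have "k \<in> range p" using p k by (auto simp: bij_betw_def)
      then show "k \<in> p ` {b. p b \<le> p a}" using k by auto
    qed
  next
    show "p ` {b. p b \<le> p a} \<subseteq> {1..p a}" using bij_betwE[OF p] by auto
  qed
  then have "card {1..p a} = card {b. p b \<le> p a}"
    using card_image[of p "{b. p b \<le> p a}"] p by (metis bij_betw_imp_inj_on inj_on_subset subset_UNIV)
  then show ?thesis by simp
qed

text \<open>Positive lengths make left ends increase strictly with rank, and a rank is the number of
  letters of at most that rank. This recovers the permutations of an AIET from its intervals and its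
  map.\<close>

lemma perm_eq_of_lft_eq:
  fixes p q :: "'a::finite \<Rightarrow> nat"
  assumes p: "bij_betw p UNIV {1..CARD('a)}" and q: "bij_betw q UNIV {1..CARD('a)}"
    and l: "\<And>a. 0 < l a" and eq: "\<And>a. lft p l a = lft q l a"
  shows "p = q"
proof
  fix a
  have "p c < p b \<longleftrightarrow> q c < q b" for b c
    using lft_less_iff[of p l c b] lft_less_iff[of q l c b] p q l eq by (auto simp: bij_betw_def)
  then have "{b. p b \<le> p a} = {b. q b \<le> q a}" by (auto simp: not_less[symmetric])
  then show "p a = q a" using perm_card[OF p] perm_card[OF q] by metis
qed

section \<open>Moving the last letter of a row to the place behind a given letter\<close>

definition ins :: "('a::finite \<Rightarrow> nat) \<Rightarrow> 'a \<Rightarrow> 'a \<Rightarrow> 'a \<Rightarrow> nat" where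
  "ins q w l = (\<lambda>a. if a = l then Suc (q w) else if q a \<le> q w then q a else Suc (q a))"

lemma less_last:
  fixes q :: "'a::finite \<Rightarrow> nat"
  assumes q: "bij_betw q UNIV {1..CARD('a)}" and l: "q l = CARD('a)" and "a \<noteq> l"
  shows "q a < q l"
proof -
  have "q a \<noteq> q l" using q assms(3) by (auto simp: bij_betw_def inj_def)
  moreover have "q a \<in> {1..CARD('a)}" using q by (auto simp: bij_betw_def)
  ultimately show ?thesis using l by auto
qed

lemma bij_ins:
  fixes q :: "'a::finite \<Rightarrow> nat"
  assumes q: "bij_betw q UNIV {1..CARD('a)}" and l: "q l = CARD('a)" and w: "w \<noteq> l"
  shows "bij_betw (ins q w l) UNIV {1..CARD('a)}"
proof -
  have lt: "q a < q l" if "a \<noteq> l" for a using less_last[OF q l that] .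
  have inj: "inj (ins q w l)"
  proof (rule injI)
    fix a b assume e: "ins q w l a = ins q w l b"
    have qi: "q a = q b \<Longrightarrow> a = b" for a b using q by (auto simp: bij_betw_def inj_def)
    show "a = b"
      using e qi[of a b] qi[of a w] qi[of b w] by (auto simp: ins_def split: if_splits)
  qed
  moreover have "range (ins q w l) \<subseteq> {1..CARD('a)}"
  proof -
    have r: "q a \<in> {1..CARD('a)}" for a using q by (auto simp: bij_betw_def)
    have "ins q w l a \<in> {1..CARD('a)}" for a
      using r[of a] lt[of a] lt[of w] w l by (auto simp: ins_def)
    then show ?thesis by auto
  qed
  ultimately show ?thesis
    unfolding bij_betw_def by (simp add: card_image card_subset_eq)
qed

text \<open>The hypothesis \<open>m' w + m' l = m w\<close> says that the old block of
  \<open>w\<close> is cut into the new blocks of \<open>w\<close> and \<open>l\<close>, in this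
  order. As \<open>l\<close> was last, it contributed to no left end, so the other letters stay
  where they were.\<close>

lemma lft_ins:
  fixes q :: "'a::finite \<Rightarrow> nat"
  assumes q: "bij_betw q UNIV {1..CARD('a)}" and l: "q l = CARD('a)" and w: "w \<noteq> l"
    and eq: "\<And>a. a \<noteq> w \<Longrightarrow> a \<noteq> l \<Longrightarrow> m' a = m a" and s: "m' w + m' l = m w"
  shows "a \<noteq> l \<Longrightarrow> lft (ins q w l) m' a = lft q m a"
    and "lft (ins q w l) m' l = lft q m w + m' w"
proof -
  have lt: "q a < q l" if "a \<noteq> l" for a using less_last[OF q l that] .
  have qi: "q a = q b \<Longrightarrow> a = b" for a b using q by (auto simp: bij_betw_def inj_def)
  show 2: "lft (ins q w l) m' l = lft q m w + m' w"
  proof -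
    have "{c. ins q w l c < ins q w l l} = insert w {c. q c < q w}"
      using lt w less_asym[OF lt[of w]] by (auto simp: ins_def le_less dest: qi)
    then have "lft (ins q w l) m' l = sum m' {c. q c < q w} + m' w"
      by (simp add: lft_def)
    also have "sum m' {c. q c < q w} = sum m {c. q c < q w}"
      by (rule sum.cong) (use lt[of w] w in \<open>auto intro!: eq\<close>)
    finally show ?thesis by (simp add: lft_def)
  qed
  assume a: "a \<noteq> l"
  show "lft (ins q w l) m' a = lft q m a"
  proof (cases "q a \<le> q w")
    case True
    have "{c. ins q w l c < ins q w l a} = {c. q c < q a}"
      using lt[of w] w True a by (auto simp: ins_def)
    moreover have "sum m' {c. q c < q a} = sum m {c. q c < q a}"
      by (rule sum.cong) (use lt[of w] w True in \<open>auto intro!: eq\<close>)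
    ultimately show ?thesis by (simp add: lft_def)
  next
    case False
    let ?S = "{c. q c < q a} - {w}"
    have A: "{c. q c < q a} = insert w ?S" "w \<notin> ?S" using False by auto
    have "{c. ins q w l c < ins q w l a} = insert l (insert w ?S)"
      using lt[of a] w False a by (auto simp: ins_def)
    moreover have "sum m' (insert l (insert w ?S)) = m' l + sum m' (insert w ?S)"
      using w less_asym[OF lt[OF a]] by (intro sum.insert) auto
    moreover have "sum m' (insert w ?S) = m' w + sum m' ?S"
      by (intro sum.insert) auto
    ultimately have "lft (ins q w l) m' a = m' l + m' w + sum m' ?S"
      by (simp add: lft_def)
    also have "sum m' ?S = sum m ?S"
      by (rule sum.cong) (use lt[OF a] in \<open>auto intro!: eq\<close>)
    also have "m' l + m' w + sum m ?S = sum m (insert w ?S)"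
      using s by (subst sum.insert) auto
    finally show ?thesis using A(1) by (simp add: lft_def)
  qed
qed

lemma lft_cong_last:
  fixes p :: "'a::finite \<Rightarrow> nat"
  assumes p: "bij_betw p UNIV {1..CARD('a)}" and w: "p w = CARD('a)"
    and eq: "\<And>a. a \<noteq> w \<Longrightarrow> m' a = m a"
  shows "lft p m' a = lft p m a"
proof -
  have "\<not> p w < p a" using less_last[OF p w, of a] by (cases "a = w") auto
  then show ?thesis unfolding lft_def by (intro sum.cong) (use eq in \<open>auto, metis\<close>)
qed

lemma irreducible_sym: "irreducible_perm p q \<Longrightarrow> irreducible_perm q p"
  unfolding irreducible_perm_def by metis

text \<open>The first \<open>k\<close> letters of the new row are those of the old one while
  \<open>k \<le> q w\<close>; beyond that they include \<open>w\<close>, which is last in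
  \<open>p\<close>.\<close>

lemma irreducible_ins:
  fixes p q :: "'a::finite \<Rightarrow> nat"
  assumes i: "irreducible_perm p q" and l: "q l = CARD('a)" and w: "p w = CARD('a)" "w \<noteq> l"
  shows "irreducible_perm p (ins q w l)"
proof -
  have q: "bij_betw q UNIV {1..CARD('a)}" and p: "bij_betw p UNIV {1..CARD('a)}"
    using i by (auto simp: irreducible_perm_def)
  have "p -` {1..k} \<noteq> ins q w l -` {1..k}" if k: "1 \<le> k" "k < CARD('a)" for k
  proof (cases "k \<le> q w")
    case True
    have r: "q a \<in> {1..CARD('a)}" for a using q by (auto simp: bij_betw_def)
    have "ins q w l -` {1..k} = q -` {1..k}"
      using True k l r by (auto simp: ins_def split: if_splits)
    then show ?thesis using i k by (auto simp: irreducible_perm_def)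
  next
    case False
    have "1 \<le> q w" using q by (auto simp: bij_betw_def)
    then have "w \<in> ins q w l -` {1..k}" using False w by (auto simp: ins_def)
    moreover have "w \<notin> p -` {1..k}" using w k by auto
    ultimately show ?thesis by blast
  qed
  then show ?thesis using p bij_ins[OF q l w(2)] by (simp add: irreducible_perm_def)
qed

text \<open>A letter that is last in both rows would leave the same set of letters in the remaining
  places.\<close>

lemma last_neq:
  fixes p q :: "'a::finite \<Rightarrow> nat"
  assumes i: "irreducible_perm p q" and d: "2 \<le> CARD('a)" and l: "q l = CARD('a)" and w: "p w = CARD('a)"
  shows "w \<noteq> l"
proof
  assume e: "w = l"
  have *: "r -` {1..CARD('a) - 1} = - {l}" if "bij_betw r UNIV {1..CARD('a)}" "r l = CARD('a)" for r
  proof -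
    have "r a \<in> {1..CARD('a)}" for a using that by (auto simp: bij_betw_def)
    then show ?thesis using less_last[OF that] that(2) d by (fastforce)
  qed
  have "p -` {1..CARD('a) - 1} = q -` {1..CARD('a) - 1}"
    using *[of p] *[of q] i l w e by (auto simp: irreducible_perm_def)
  moreover have "1 \<le> CARD('a) - 1" "CARD('a) - 1 < CARD('a)" using d by auto
  ultimately show False using i by (auto simp: irreducible_perm_def)
qed

section \<open>The Rauzy--Veech step\<close>

definition img :: "'a::finite aiet \<Rightarrow> 'a \<Rightarrow> real set" where
  "img f a = {bot_left f a..<bot_left f a + image_len f a}"

abbreviation tot :: "'a::finite aiet \<Rightarrow> real" where
  "tot f \<equiv> \<Sum>\<alpha>\<in>UNIV. len f $ \<alpha>"

lemma top_left_lft: "top_left f = lft (ptop f) (\<lambda>b. len f $ b)"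
  by (auto simp: top_left_def lft_def)

lemma bot_left_lft: "bot_left f = lft (pbot f) (image_len f)"
  by (auto simp: bot_left_def lft_def)

section \<open>Intervals, images and bijectivity of an AIET\<close>

context
  fixes f :: "'a::finite aiet"
  assumes f: "is_aiet f"
begin

lemma bij_ptop: "bij_betw (ptop f) UNIV {1..CARD('a)}"
  and bij_pbot: "bij_betw (pbot f) UNIV {1..CARD('a)}"
  using f by (auto simp: is_aiet_def irreducible_perm_def)

lemma inj_ptop: "inj (ptop f)" and inj_pbot: "inj (pbot f)"
  using bij_ptop bij_pbot by (auto simp: bij_betw_def)

lemma len_pos: "0 < len f $ a" using f by (auto simp: is_aiet_def)

lemma image_len_pos: "0 < image_len f a" using len_pos by (simp add: image_len_def)

lemma tot_image: "sum (image_len f) UNIV = tot f"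
  using f by (simp add: is_aiet_def)

lemma top_left_nonneg: "0 \<le> top_left f a"
  by (simp add: top_left_lft lft_nonneg len_pos less_imp_le)

lemma bot_left_nonneg: "0 \<le> bot_left f a"
  by (simp add: bot_left_lft lft_nonneg image_len_pos less_imp_le)

lemma top_right_le: "top_left f a + len f $ a \<le> tot f"
  using lft_le_sum[of "\<lambda>b. len f $ b" "ptop f" a] by (simp add: top_left_lft len_pos less_imp_le)

lemma bot_right_le: "bot_left f a + image_len f a \<le> tot f"
  using lft_le_sum[of "image_len f" "pbot f" a]
  by (simp add: bot_left_lft image_len_pos less_imp_le tot_image)

lemma ivl_cover: "x \<in> dom_ivl f \<Longrightarrow> \<exists>a. x \<in> ivl f a"
  using lft_cover[OF bij_ptop, of "\<lambda>b. len f $ b" x] len_pos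
  by (auto simp: dom_ivl_def ivl_def top_left_lft)

lemma img_cover: "x \<in> dom_ivl f \<Longrightarrow> \<exists>a. x \<in> img f a"
  using lft_cover[OF bij_pbot, of "image_len f" x] image_len_pos
  by (auto simp: dom_ivl_def img_def bot_left_lft tot_image)

lemma ivl_unique: "x \<in> ivl f a \<Longrightarrow> x \<in> ivl f b \<Longrightarrow> a = b"
  using lft_unique[OF inj_ptop, of "\<lambda>b. len f $ b" a x b] len_pos
  by (auto simp: ivl_def top_left_lft)

lemma img_unique: "x \<in> img f a \<Longrightarrow> x \<in> img f b \<Longrightarrow> a = b"
  using lft_unique[OF inj_pbot, of "image_len f" a x b] image_len_pos
  by (auto simp: img_def bot_left_lft)

lemma ivl_subset_dom: "ivl f a \<subseteq> dom_ivl f"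
  using top_left_nonneg[of a] top_right_le[of a] by (auto simp: ivl_def dom_ivl_def)

lemma img_subset_dom: "img f a \<subseteq> dom_ivl f"
  using bot_left_nonneg[of a] bot_right_le[of a] by (auto simp: img_def dom_ivl_def)

lemma letter_at_ivl: "x \<in> ivl f a \<Longrightarrow> letter_at f x = a"
  unfolding letter_at_def using ivl_unique by (intro the_equality) auto

lemma amap_ivl:
  "x \<in> ivl f a \<Longrightarrow> amap f x = bot_left f a + exp (slope f $ a) * (x - top_left f a)"
  using ivl_subset_dom[of a] by (auto simp: amap_def letter_at_ivl Let_def)

lemma amap_outside: "x \<notin> dom_ivl f \<Longrightarrow> amap f x = x"
  by (simp add: amap_def)

lemma amap_img: "x \<in> ivl f a \<Longrightarrow> amap f x \<in> img f a"
  by (auto simp: amap_ivl img_def) (auto simp: ivl_def image_len_def)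

lemma img_amap:
  assumes "y \<in> img f a"
  shows "\<exists>x\<in>ivl f a. amap f x = y"
proof -
  let ?x = "top_left f a + exp (- slope f $ a) * (y - bot_left f a)"
  have "exp (- slope f $ a) * (y - bot_left f a) < exp (- slope f $ a) * (image_len f a)"
    using assms by (intro mult_strict_left_mono) (auto simp: img_def)
  also have "\<dots> = len f $ a" by (simp add: image_len_def exp_minus)
  finally have "?x \<in> ivl f a" using assms by (auto simp: ivl_def img_def)
  moreover have "amap f ?x = y"
    using amap_ivl[OF \<open>?x \<in> ivl f a\<close>] by (simp add: exp_minus mult.assoc[symmetric])
  ultimately show ?thesis by blast
qed

lemma amap_image_ivl: "amap f ` ivl f a = img f a"
  using amap_img img_amap by blast

lemma amap_dom: "x \<in> dom_ivl f \<Longrightarrow> amap f x \<in> dom_ivl f"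
  using ivl_cover amap_img img_subset_dom by blast

lemma amap_ivl_inj: "x \<in> ivl f a \<Longrightarrow> y \<in> ivl f a \<Longrightarrow> amap f x = amap f y \<Longrightarrow> x = y"
  by (simp add: amap_ivl)

lemma amap_ivl_diff:
  "x \<in> ivl f a \<Longrightarrow> y \<in> ivl f a \<Longrightarrow> amap f y - amap f x = exp (slope f $ a) * (y - x)"
  by (simp add: amap_ivl algebra_simps)

lemma bij_amap: "bij (amap f)"
proof (rule bijI)
  show "inj (amap f)"
  proof (rule injI)
    fix x y assume e: "amap f x = amap f y"
    show "x = y"
    proof (cases "x \<in> dom_ivl f")
      case True
      then obtain a where a: "x \<in> ivl f a" using ivl_cover by auto
      have "y \<in> dom_ivl f" using e True amap_dom amap_outside by metis
      then obtain b where b: "y \<in> ivl f b" using ivl_cover by auto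
      have "a = b" using amap_img[OF a] amap_img[OF b] e img_unique by metis
      then show ?thesis using amap_ivl_inj a b e by auto
    next
      case False
      then show ?thesis using e amap_dom amap_outside by metis
    qed
  qed
  show "surj (amap f)"
  proof -
    have "\<exists>x. y = amap f x" for y
      using img_cover[of y] img_amap amap_outside[of y] by metis
    then show ?thesis by (auto simp: surj_def)
  qed
qed

lemma inj_amap: "inj (amap f)" using bij_amap by (simp add: bij_def)

lemma amap_in_img_iff: "amap f x \<in> img f a \<longleftrightarrow> x \<in> ivl f a"
  using img_amap amap_img inj_amap by (metis injD)

lemma ptop_last_top: "ptop f (last_top f) = CARD('a)"
  and pbot_last_bot: "pbot f (last_bot f) = CARD('a)"
proof -
  have *: "r (THE a. r a = CARD('a)) = CARD('a)" if "bij_betw r UNIV {1..CARD('a)}" for r :: "'a \<Rightarrow> nat"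
  proof (rule theI')
    have "CARD('a) \<in> range r" using that by (simp add: bij_betw_def Suc_le_eq)
    then obtain a where "r a = CARD('a)" by (metis rangeE)
    then show "\<exists>!a. r a = CARD('a)" using that unfolding bij_betw_def inj_def by metis
  qed
  show "ptop f (last_top f) = CARD('a)" "pbot f (last_bot f) = CARD('a)"
    unfolding last_top_def last_bot_def using *[OF bij_ptop] *[OF bij_pbot] by auto
qed

lemma last_top_right: "top_left f (last_top f) + len f $ last_top f = tot f"
  using lft_last[OF bij_ptop ptop_last_top] by (simp add: top_left_lft)

lemma last_bot_right: "bot_left f (last_bot f) + image_len f (last_bot f) = tot f"
  using lft_last[OF bij_pbot pbot_last_bot] tot_image by (simp add: bot_left_lft)

lemma top_left_le_last: "top_left f a \<le> top_left f (last_top f)"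
proof (cases "a = last_top f")
  case False
  then have "ptop f a < ptop f (last_top f)" using less_last[OF bij_ptop ptop_last_top] by blast
  from lft_step[of "\<lambda>b. len f $ b", OF less_imp_le[OF len_pos] this] show ?thesis
    using len_pos[of a] by (simp add: top_left_lft)
qed simp

lemma bot_left_le_last: "bot_left f a \<le> bot_left f (last_bot f)"
proof (cases "a = last_bot f")
  case False
  then have "pbot f a < pbot f (last_bot f)" using less_last[OF bij_pbot pbot_last_bot] by blast
  from lft_step[of "image_len f", OF less_imp_le[OF image_len_pos] this] show ?thesis
    using image_len_pos[of a] by (simp add: bot_left_lft)
qed simp

lemma last_top_neq_last_bot: "2 \<le> CARD('a) \<Longrightarrow> last_top f \<noteq> last_bot f"
  using last_neq ptop_last_top pbot_last_bot f by (metis is_aiet_def)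

end

text \<open>This makes the definite description in \<open>rv_step\<close> unique. Intervals give
  lengths and top row, their images give the bottom row, and quotients of lengths give the
  slopes.\<close>

lemma aiet_eqI:
  fixes f g :: "'a::finite aiet"
  assumes f: "is_aiet f" and g: "is_aiet g" and i: "\<And>a. ivl f a = ivl g a" and m: "\<And>x. x \<in> dom_ivl f \<Longrightarrow> amap f x = amap g x"
  shows "f = g"
proof -
  have tl: "top_left f a = top_left g a" and ln: "len f $ a = len g $ a" for a
    using i[of a] len_pos[OF f, of a] len_pos[OF g, of a] by (auto simp: ivl_def Ico_eq_Ico)
  have len: "len f = len g" using ln by (simp add: vec_eq_iff)
  have pt: "ptop f = ptop g"
    by (rule perm_eq_of_lft_eq[OF bij_ptop[OF f] bij_ptop[OF g], of "\<lambda>b. len f $ b"])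
      (use tl len len_pos[OF f] in \<open>auto simp: top_left_lft\<close>)
  have img: "img f a = img g a" for a
  proof -
    have "amap f ` ivl f a = amap g ` ivl g a"
      unfolding i using m i ivl_subset_dom[OF f] by (intro image_cong) (auto simp: subset_iff)
    then show ?thesis using amap_image_ivl f g by metis
  qed
  have bl: "bot_left f a = bot_left g a" and il: "image_len f a = image_len g a" for a
    using img[of a] image_len_pos[OF f, of a] image_len_pos[OF g, of a] by (auto simp: img_def Ico_eq_Ico)
  have il': "image_len f = image_len g" using il by auto
  have pb: "pbot f = pbot g"
    by (rule perm_eq_of_lft_eq[OF bij_pbot[OF f] bij_pbot[OF g], of "image_len f"])
      (use bl il' image_len_pos[OF f] in \<open>auto simp: bot_left_lft\<close>)
  have "slope f $ a = slope g $ a" for a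
    using il[of a] ln[of a] len_pos[OF f, of a] by (simp add: image_len_def)
  then have "slope f = slope g" by (simp add: vec_eq_iff)
  with len pt pb show ?thesis by simp
qed

lemma vec_nth_vec_lambda: "($) (vec_lambda k) = k"
  by auto

definition loser :: "'a::finite aiet \<Rightarrow> 'a" where
  "loser f = (case rv_type_of f of Top \<Rightarrow> last_bot f | Bottom \<Rightarrow> last_top f)"

text \<open>An explicit candidate for \<open>rv_step\<close>. The loser receives the log-slope of a
  composition because its points return after two steps. In the bottom case its interval is the part
  of \<open>ivl f (last_bot f)\<close> mapped onto \<open>ivl f (last_top f)\<close>, which accounts
  for the factor \<open>exp (- slope f $ last_bot f)\<close>.\<close>

definition rauzy :: "'a::finite aiet \<Rightarrow> 'a aiet" where
  "rauzy f =
    (case rv_type_of f of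
       Top \<Rightarrow>
        \<lparr>ptop = ptop f, pbot = ins (pbot f) (last_top f) (last_bot f),
         len = (\<chi> a. if a = last_top f then len f $ a - image_len f (last_bot f) else len f $ a),
         slope = (\<chi> a. if a = last_bot f then slope f $ last_bot f + slope f $ last_top f else slope f $ a)\<rparr>
     | Bottom \<Rightarrow>
        \<lparr>ptop = ins (ptop f) (last_bot f) (last_top f), pbot = pbot f,
         len = (\<chi> a. if a = last_top f then exp (- slope f $ last_bot f) * len f $ last_top f
                     else if a = last_bot f then len f $ a - exp (- slope f $ last_bot f) * len f $ last_top f
                     else len f $ a),
         slope = (\<chi> a. if a = last_top f then slope f $ last_bot f + slope f $ last_top f else slope f $ a)\<rparr>)"

locale rauzy_step =
  fixes f :: "'a::finite aiet"
  assumes f: "is_aiet f" and d: "2 \<le> CARD('a)" and def: "rv_defined f"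
begin

abbreviation "t \<equiv> last_top f"
abbreviation "b \<equiv> last_bot f"
abbreviation "g \<equiv> rauzy f"

lemma tb: "t \<noteq> b" using last_top_neq_last_bot[OF f d] .

lemma top_case: "rv_type_of f = Top \<Longrightarrow> image_len f b < len f $ t"
  by (auto simp: rv_type_of_def split: if_splits)

lemma bottom_case: "rv_type_of f = Bottom \<Longrightarrow> len f $ t < image_len f b"
  using def by (auto simp: rv_type_of_def rv_defined_def split: if_splits)

text \<open>Only the bottom row is rearranged: the image of \<open>t\<close> is cut, and its right
  part becomes the image of \<open>b\<close> under the square of \<open>f\<close>. The top row keeps
  its left ends since only its last interval is shortened.\<close>

lemma top_data:
  assumes T: "rv_type_of f = Top"
  shows "\<And>a. image_len g a = (if a = t then image_len f t - exp (slope f $ t) * image_len f b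
                  else if a = b then exp (slope f $ t) * image_len f b else image_len f a)"
    and "\<And>a. top_left g a = top_left f a"
    and "\<And>a. a \<noteq> b \<Longrightarrow> bot_left g a = bot_left f a"
    and "bot_left g b = bot_left f t + image_len g t"
    and "tot g = tot f - image_len f b"
    and "sum (image_len g) UNIV = tot g"
    and "is_aiet g"
proof -
  note tb[simp] tb[symmetric, simp]
  show il: "image_len g a = (if a = t then image_len f t - exp (slope f $ t) * image_len f b
                  else if a = b then exp (slope f $ t) * image_len f b else image_len f a)" for a
    using T tb tb[symmetric] by (simp add: rauzy_def image_len_def algebra_simps exp_add)
  show "top_left g a = top_left f a" for a
    unfolding top_left_lft using T
    by (auto simp: rauzy_def intro!: lft_cong_last[OF bij_ptop[OF f] ptop_last_top[OF f]])
  show "bot_left g a = bot_left f a" if "a \<noteq> b" for a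
    unfolding bot_left_lft using T that il
    by (auto simp: rauzy_def intro!: lft_ins[OF bij_pbot[OF f] pbot_last_bot[OF f]])
  show "bot_left g b = bot_left f t + image_len g t"
    unfolding bot_left_lft using T il
    using lft_ins(2)[OF bij_pbot[OF f] pbot_last_bot[OF f] tb, of "image_len g" "image_len f"]
    by (simp add: rauzy_def)
  have "tot g = (\<Sum>a\<in>UNIV. len f $ a - (if a = t then image_len f b else 0))"
    using T by (intro sum.cong) (auto simp: rauzy_def)
  then show tg: "tot g = tot f - image_len f b" by (simp add: sum_subtractf)
  let ?y = "exp (slope f $ t) * image_len f b"
  have "sum (image_len g) UNIV = (\<Sum>a\<in>UNIV. image_len f a - (if a = t then ?y else 0) + (if a = b then ?y - image_len f b else 0))"
    by (intro sum.cong) (auto simp: il)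
  then have "sum (image_len g) UNIV = sum (image_len f) UNIV - image_len f b"
    by (simp add: sum.distrib sum_subtractf)
  then show s: "sum (image_len g) UNIV = tot g"
    using tg tot_image[OF f] by simp
  show "is_aiet g"
    unfolding is_aiet_def
  proof (intro conjI allI)
    show "irreducible_perm (ptop g) (pbot g)"
      using T irreducible_ins[of "ptop f" "pbot f" b t] pbot_last_bot[OF f] ptop_last_top[OF f] f
      by (auto simp: rauzy_def is_aiet_def)
    show "0 < len g $ a" for a
      using T top_case len_pos[OF f, of a] by (auto simp: rauzy_def)
  qed (use s in simp)
qed

text \<open>Dual to \<open>top_data\<close>: the domain interval of \<open>b\<close> is cut and its
  right part is given to \<open>t\<close>, while the bottom row is shortened at its end.\<close>

lemma bottom_data:
  assumes T: "rv_type_of f = Bottom"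
  shows "\<And>a. image_len g a = (if a = b then image_len f b - len f $ t
                  else image_len f a)"
    and "\<And>a. bot_left g a = bot_left f a"
    and "\<And>a. a \<noteq> t \<Longrightarrow> top_left g a = top_left f a"
    and "top_left g t = top_left f b + len g $ b"
    and "tot g = tot f - len f $ t"
    and "sum (image_len g) UNIV = tot g"
    and "is_aiet g"
proof -
  note tb[simp] tb[symmetric, simp]
  show il: "image_len g a = (if a = b then image_len f b - len f $ t else image_len f a)" for a
    using T by (auto simp: rauzy_def image_len_def algebra_simps exp_add exp_minus)
  show "bot_left g a = bot_left f a" for a
    unfolding bot_left_lft using T il
    by (auto simp: rauzy_def intro!: lft_cong_last[OF bij_pbot[OF f] pbot_last_bot[OF f]])
  show "top_left g a = top_left f a" if "a \<noteq> t" for a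
    unfolding top_left_lft using T that
    by (auto simp: rauzy_def intro!: lft_ins[OF bij_ptop[OF f] ptop_last_top[OF f]])
  show "top_left g t = top_left f b + len g $ b"
    unfolding top_left_lft using T
    using lft_ins(2)[OF bij_ptop[OF f] ptop_last_top[OF f] tb[symmetric], of "\<lambda>a. len g $ a" "\<lambda>a. len f $ a"]
    by (simp add: rauzy_def vec_nth_vec_lambda)
  let ?y = "exp (- slope f $ b) * len f $ t"
  have "tot g = (\<Sum>a\<in>UNIV. len f $ a - (if a = b then ?y else 0) + (if a = t then ?y - len f $ t else 0))"
    using T by (intro sum.cong) (auto simp: rauzy_def)
  then show tg: "tot g = tot f - len f $ t" by (simp add: sum.distrib sum_subtractf)
  have "sum (image_len g) UNIV = (\<Sum>a\<in>UNIV. image_len f a - (if a = b then len f $ t else 0))"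
    by (intro sum.cong) (auto simp: il)
  then have "sum (image_len g) UNIV = sum (image_len f) UNIV - len f $ t"
    by (simp add: sum_subtractf)
  then show s: "sum (image_len g) UNIV = tot g"
    using tg tot_image[OF f] by simp
  have lt: "exp (- slope f $ b) * len f $ t < len f $ b"
    using bottom_case[OF T] by (simp add: image_len_def exp_minus field_simps)
  show "is_aiet g"
    unfolding is_aiet_def
  proof (intro conjI allI)
    show "irreducible_perm (ptop g) (pbot g)"
      using T irreducible_ins[of "pbot f" "ptop f" t b] ptop_last_top[OF f] pbot_last_bot[OF f] f
      by (auto simp: rauzy_def is_aiet_def intro: irreducible_sym)
    show "0 < len g $ a" for a
      using T lt len_pos[OF f, of a] len_pos[OF f, of t] by (auto simp: rauzy_def)
  qed (use s in simp)
qed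

lemma aiet_rauzy: "is_aiet g"
  using top_data(7) bottom_data(7) by (cases "rv_type_of f") auto

lemma dom_rauzy: "dom_ivl g = induced_dom f"
proof (cases "rv_type_of f")
  case Top
  have "amap f ` ivl f b = {tot f - image_len f b..<tot f}"
    using amap_image_ivl[OF f, of b] last_bot_right[OF f] by (auto simp: img_def)
  then show ?thesis using Top top_data(5)[OF Top] image_len_pos[OF f, of b] by (auto simp: induced_dom_def dom_ivl_def)
next
  case Bottom
  have "ivl f t = {tot f - len f $ t..<tot f}"
    using last_top_right[OF f] by (auto simp: ivl_def)
  then show ?thesis using Bottom bottom_data(5)[OF Bottom] len_pos[OF f, of t]
    by (auto simp: induced_dom_def dom_ivl_def)
qed

lemma img_b: "img f b = {tot f - image_len f b..<tot f}"
  using last_bot_right[OF f] by (auto simp: img_def)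

lemma ivl_t: "ivl f t = {tot f - len f $ t..<tot f}"
  using last_top_right[OF f] by (auto simp: ivl_def)

lemma dom_top: "rv_type_of f = Top \<Longrightarrow> dom_ivl g = {0..<tot f - image_len f b}"
  and dom_bottom: "rv_type_of f = Bottom \<Longrightarrow> dom_ivl g = {0..<tot f - len f $ t}"
  using top_data(5) bottom_data(5) by (auto simp: dom_ivl_def)

lemma loser_ivl_bottom:
  assumes T: "rv_type_of f = Bottom"
  shows "ivl g t = {top_left f b + len f $ b - exp (- slope f $ b) * len f $ t..<top_left f b + len f $ b}"
    "ivl g b = {top_left f b..<top_left f b + len f $ b - exp (- slope f $ b) * len f $ t}"
  using bottom_data(3,4)[OF T] T tb tb[symmetric] by (auto simp: ivl_def rauzy_def)

text \<open>In the bottom case \<open>ivl f t\<close> lies in \<open>img f b\<close>, so its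
  preimage can be computed with the affine branch over \<open>b\<close>.\<close>

lemma amap_in_t_bottom:
  assumes T: "rv_type_of f = Bottom"
  shows "amap f x \<in> ivl f t \<longleftrightarrow> x \<in> ivl g t"
proof
  have sub: "ivl f t \<subseteq> img f b" using bottom_case[OF T] by (auto simp: img_b ivl_t)
  have lt: "exp (- slope f $ b) * len f $ t < len f $ b"
    using bottom_case[OF T] by (simp add: image_len_def exp_minus field_simps)
  have key: "amap f x \<ge> tot f - len f $ t \<longleftrightarrow> x \<ge> top_left f b + len f $ b - exp (- slope f $ b) * len f $ t"
    if x: "x \<in> ivl f b" for x
  proof -
    have "amap f x - (tot f - len f $ t) = exp (slope f $ b) * (x - (top_left f b + len f $ b - exp (- slope f $ b) * len f $ t))"
      using amap_ivl[OF f x] last_bot_right[OF f] by (simp add: image_len_def exp_minus algebra_simps)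
    then have "tot f - len f $ t \<le> amap f x \<longleftrightarrow>
        0 \<le> exp (slope f $ b) * (x - (top_left f b + len f $ b - exp (- slope f $ b) * len f $ t))"
      by linarith
    then show ?thesis by (simp add: zero_le_mult_iff)
  qed
  {
    assume a: "amap f x \<in> ivl f t"
    then have x: "x \<in> ivl f b" using sub amap_in_img_iff[OF f] by auto
    then show "x \<in> ivl g t" using key[OF x] a x unfolding ivl_t loser_ivl_bottom[OF T] by (simp add: ivl_def)
  }
  assume a: "x \<in> ivl g t"
  then have x: "x \<in> ivl f b" using lt by (auto simp: ivl_def[of f] loser_ivl_bottom[OF T])
  then show "amap f x \<in> ivl f t" using key[OF x] a amap_img[OF f x]
    by (auto simp: ivl_t loser_ivl_bottom[OF T] img_b)
qed

lemma ivl_rauzy: "ivl g a = induced_ivl f a"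
proof (cases "rv_type_of f")
  case Top
  have "ivl g t = ivl f t - img f b"
    using Top top_data(2)[OF Top] last_top_right[OF f] top_case[OF Top] image_len_pos[OF f, of b]
    by (auto simp: img_b ivl_def rauzy_def)
  moreover have "a \<noteq> t \<Longrightarrow> ivl g a = ivl f a"
    using Top top_data(2)[OF Top] by (auto simp: ivl_def rauzy_def)
  ultimately show ?thesis using Top by (auto simp: induced_ivl_def amap_image_ivl[OF f])
next
  case Bottom
  have 1: "amap f -` ivl f t = ivl g t" using amap_in_t_bottom[OF Bottom] by auto
  have pos: "0 < exp (- slope f $ b) * len f $ t" using len_pos[OF f] by simp
  have "ivl g b = ivl f b - ivl g t" using pos
    by (auto simp: loser_ivl_bottom[OF Bottom] ivl_def[of f])
  moreover have "a \<noteq> t \<Longrightarrow> a \<noteq> b \<Longrightarrow> ivl g a = ivl f a"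
    using Bottom bottom_data(3)[OF Bottom] by (auto simp: ivl_def rauzy_def)
  ultimately show ?thesis using Bottom 1 tb by (auto simp: induced_ivl_def)
qed

lemma ivl_nonloser:
  assumes x: "x \<in> ivl g a" and a: "a \<noteq> loser f"
  shows "x \<in> ivl f a" "amap f x \<in> dom_ivl g" "amap g x = amap f x"
proof -
  show x': "x \<in> ivl f a"
    using x a tb tb[symmetric] unfolding ivl_rauzy
    by (auto simp: induced_ivl_def loser_def split: rv_type.splits if_splits)
  have D: "amap f x \<in> dom_ivl f" using amap_dom[OF f] x' ivl_subset_dom[OF f] by blast
  show "amap f x \<in> dom_ivl g"
  proof (cases "rv_type_of f")
    case Top
    have "amap f x \<notin> img f b" using a Top x' amap_in_img_iff[OF f] ivl_unique[OF f] by (auto simp: loser_def)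
    then show ?thesis using D by (auto simp: dom_top[OF Top] img_b dom_ivl_def[of f])
  next
    case Bottom
    have "amap f x \<notin> ivl f t"
      using a Bottom x amap_in_t_bottom[OF Bottom] ivl_unique[OF aiet_rauzy] by (auto simp: loser_def)
    then show ?thesis using D by (auto simp: dom_bottom[OF Bottom] ivl_t dom_ivl_def[of f])
  qed
  show "amap g x = amap f x"
  proof (cases "rv_type_of f")
    case Top
    then have "a \<noteq> b" using a by (simp add: loser_def)
    then show ?thesis unfolding amap_ivl[OF f x'] amap_ivl[OF aiet_rauzy x]
      using Top top_data(2,3)[OF Top] by (simp add: rauzy_def)
  next
    case Bottom
    then have "a \<noteq> t" using a by (simp add: loser_def)
    then show ?thesis unfolding amap_ivl[OF f x'] amap_ivl[OF aiet_rauzy x]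
      using Bottom bottom_data(2,3)[OF Bottom] by (simp add: rauzy_def)
  qed
qed

lemma ivl_loser:
  assumes x: "x \<in> ivl g (loser f)"
  shows "x \<in> ivl f b" "amap f x \<in> ivl f t" "amap f x \<notin> dom_ivl g"
    "amap f (amap f x) \<in> dom_ivl g" "amap g x = amap f (amap f x)"
proof -
  have x1: "x \<in> ivl f b \<and> amap f x \<in> ivl f t"
  proof (cases "rv_type_of f")
    case Top
    then have "x \<in> ivl f b"
      using x tb tb[symmetric] unfolding ivl_rauzy by (auto simp: induced_ivl_def loser_def)
    then show ?thesis using amap_img[OF f, of x b] top_case[OF Top] by (auto simp: ivl_t img_b)
  next
    case Bottom
    then have it: "amap f x \<in> ivl f t" using x amap_in_t_bottom[OF Bottom] by (simp add: loser_def)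
    then have "amap f x \<in> img f b" using bottom_case[OF Bottom] by (auto simp: ivl_t img_b)
    then show ?thesis using it amap_in_img_iff[OF f] by blast
  qed
  then show xb: "x \<in> ivl f b" and it: "amap f x \<in> ivl f t" by auto
  have D: "amap f (amap f x) \<in> dom_ivl f" using it ivl_subset_dom[OF f] amap_dom[OF f] by blast
  have nb: "amap f (amap f x) \<notin> img f b" using it tb amap_in_img_iff[OF f] ivl_unique[OF f] by blast
  have e: "amap f x - top_left f t = len f $ t - image_len f b + exp (slope f $ b) * (x - top_left f b)"
    using amap_ivl[OF f xb] last_top_right[OF f] last_bot_right[OF f] by simp
  have "amap f x \<notin> dom_ivl g \<and> amap f (amap f x) \<in> dom_ivl g \<and> amap g x = amap f (amap f x)"
  proof (cases "rv_type_of f")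
    case Top
    have n: "amap f x \<notin> dom_ivl g" using amap_img[OF f xb] by (auto simp: img_b dom_top[OF Top])
    have D': "amap f (amap f x) \<in> dom_ivl g" using D nb by (auto simp: dom_top[OF Top] img_b dom_ivl_def[of f])
    have xg: "x \<in> ivl g b" using x Top by (simp add: loser_def)
    have "amap g x = bot_left f t + (image_len f t - exp (slope f $ t) * image_len f b)
        + exp (slope f $ b + slope f $ t) * (x - top_left f b)"
      unfolding amap_ivl[OF aiet_rauzy xg] top_data(2,4)[OF Top] top_data(1)[OF Top]
      using Top by (simp add: rauzy_def)
    then have "amap g x = amap f (amap f x)" unfolding amap_ivl[OF f it] e
      by (simp add: image_len_def algebra_simps exp_add)
    then show ?thesis using n D' by blast
  next
    case Bottom
    have n: "amap f x \<notin> dom_ivl g" using it by (auto simp: ivl_t dom_bottom[OF Bottom])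
    have "amap f (amap f x) \<notin> ivl f t" using nb bottom_case[OF Bottom] by (auto simp: ivl_t img_b)
    then have D': "amap f (amap f x) \<in> dom_ivl g"
      using D by (auto simp: dom_bottom[OF Bottom] ivl_t dom_ivl_def[of f])
    have xg: "x \<in> ivl g t" using x Bottom by (simp add: loser_def)
    have "amap g x = bot_left f t + exp (slope f $ b + slope f $ t) *
       (x - (top_left f b + (len f $ b - exp (- slope f $ b) * len f $ t)))"
      unfolding amap_ivl[OF aiet_rauzy xg] bottom_data(2,4)[OF Bottom]
      using Bottom tb tb[symmetric] by (simp add: rauzy_def)
    then have "amap g x = amap f (amap f x)" unfolding amap_ivl[OF f it] e
      by (simp add: image_len_def algebra_simps exp_add exp_minus)
    then show ?thesis using n D' by blast
  qed
  then show "amap f x \<notin> dom_ivl g" "amap f (amap f x) \<in> dom_ivl g" "amap g x = amap f (amap f x)"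
    by auto
qed

lemma amap_rauzy:
  assumes x: "x \<in> induced_dom f"
  shows "amap g x = first_return (amap f) (induced_dom f) x"
proof -
  obtain a where a: "x \<in> ivl g a" using x ivl_cover[OF aiet_rauzy] by (auto simp: dom_rauzy)
  show ?thesis
  proof (cases "a = loser f")
    case False
    have "return_time (amap f) (induced_dom f) x = 1"
      unfolding return_time_def using ivl_nonloser[OF a False]
      by (intro Least_equality) (auto simp: dom_rauzy)
    then show ?thesis using ivl_nonloser[OF a False] by (simp add: first_return_def)
  next
    case True
    note l = ivl_loser[OF a[unfolded True]]
    have "return_time (amap f) (induced_dom f) x = 2"
      unfolding return_time_def
    proof (rule Least_equality)
      show "1 \<le> (2::nat) \<and> (amap f ^^ 2) x \<in> induced_dom f" using l by (simp add: dom_rauzy numeral_2_eq_2)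
      fix r assume r: "1 \<le> r \<and> (amap f ^^ r) x \<in> induced_dom f"
      then have "r \<noteq> 1" using l by (auto simp: dom_rauzy)
      then show "2 \<le> r" using r by auto
    qed
    then show ?thesis using l by (simp add: first_return_def numeral_2_eq_2)
  qed
qed

lemma rv_step_eq: "rv_step f = g"
  unfolding rv_step_def
proof (rule the_equality)
  show "is_aiet g \<and> dom_ivl g = induced_dom f \<and> (\<forall>\<alpha>. ivl g \<alpha> = induced_ivl f \<alpha>) \<and>
        (\<forall>x\<in>induced_dom f. amap g x = first_return (amap f) (induced_dom f) x)"
    using aiet_rauzy dom_rauzy ivl_rauzy amap_rauzy by blast
next
  fix k assume k: "is_aiet k \<and> dom_ivl k = induced_dom f \<and> (\<forall>\<alpha>. ivl k \<alpha> = induced_ivl f \<alpha>) \<and>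
        (\<forall>x\<in>induced_dom f. amap k x = first_return (amap f) (induced_dom f) x)"
  show "k = g"
    by (rule aiet_eqI) (use k aiet_rauzy dom_rauzy ivl_rauzy amap_rauzy in auto)
qed

lemma dom_rauzy_subset: "dom_ivl g \<subseteq> dom_ivl f"
  by (auto simp: dom_rauzy induced_dom_def split: rv_type.splits)

text \<open>The piece cut off is the image of the new interval of the loser, so nothing of the old
  domain is lost to the new towers.\<close>

lemma cover_rauzy:
  assumes x: "x \<in> dom_ivl f"
  shows "x \<in> dom_ivl g \<or> (\<exists>y\<in>ivl g (loser f). x = amap f y)"
proof (cases "rv_type_of f")
  case Top
  show ?thesis
  proof (cases "x \<in> img f b")
    case True
    then obtain y where y: "y \<in> ivl f b" "amap f y = x" using img_amap[OF f] by blast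
    then have "y \<in> ivl g (loser f)" using Top tb unfolding ivl_rauzy
      by (auto simp: loser_def induced_ivl_def)
    then show ?thesis using y by blast
  qed (use x in \<open>auto simp: dom_top[OF Top] img_b dom_ivl_def[of f]\<close>)
next
  case Bottom
  show ?thesis
  proof (cases "x \<in> ivl f t")
    case True
    then have "x \<in> img f b" using bottom_case[OF Bottom] by (auto simp: ivl_t img_b)
    then obtain y where y: "y \<in> ivl f b" "amap f y = x" using img_amap[OF f] by blast
    then have "y \<in> ivl g (loser f)" using Bottom True amap_in_t_bottom[OF Bottom, of y] by (auto simp: loser_def)
    then show ?thesis using y by blast
  qed (use x in \<open>auto simp: dom_bottom[OF Bottom] ivl_t dom_ivl_def[of f]\<close>)
qed

text \<open>The new right endpoint is the larger of the last top and the last bottom break, which differ.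
  Hence a common break is never cut off.\<close>

lemma common_break:
  assumes e: "top_left f a = bot_left f c"
  shows "\<exists>a' c'. top_left g a' = top_left f a \<and> bot_left g c' = top_left f a"
proof (cases "rv_type_of f")
  case Top
  have "c \<noteq> b"
    using top_left_le_last[OF f, of a] last_top_right[OF f] last_bot_right[OF f] top_case[OF Top] e by auto
  then show ?thesis using top_data(2,3)[OF Top] e by metis
next
  case Bottom
  have "a \<noteq> t"
    using bot_left_le_last[OF f, of c] last_top_right[OF f] last_bot_right[OF f] bottom_case[OF Bottom] e by auto
  then show ?thesis using bottom_data(2,3)[OF Bottom] e by metis
qed

lemma slope_rauzy_0: "slope f = 0 \<Longrightarrow> slope g = 0"
  by (auto simp: rauzy_def vec_eq_iff split: rv_type.splits)

lemma len_rauzy: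
  assumes "slope f = 0"
  shows "len f $ a = len g $ a + (if a = winner f then len g $ loser f else 0)"
  using assms tb tb[symmetric] by (auto simp: rauzy_def winner_def loser_def image_len_def split: rv_type.splits)

end

section \<open>Towers\<close>

text \<open>The itinerary of \<open>ivl (rv f n) a\<close> until its return to \<open>dom_ivl (rv f n)\<close>. In both types the points
  of the losing letter first cross the interval that is last at the bottom and then the one that is last on top.\<close>

primrec word :: "'a::finite aiet \<Rightarrow> nat \<Rightarrow> 'a \<Rightarrow> 'a list" where
  "word f 0 a = [a]"
| "word f (Suc n) a =
     (if a = loser (rv f n) then word f n (last_bot (rv f n)) @ word f n (last_top (rv f n))
      else word f n a)"

lemma word_nonempty: "word f n a \<noteq> []"
  by (induction n arbitrary: a) auto

lemma rv_Suc: "rv f (Suc n) = rv_step (rv f n)"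
  by (simp add: rv_def)

lemma rv_add: "rv (rv f m) n = rv f (m + n)"
  by (simp add: rv_def funpow_add add.commute[of m n])

lemma rv_0: "rv f 0 = f"
  by (simp add: rv_def)

lemma rotation_number_rv: "rotation_number (rv f m) n = rotation_number f (m + n)"
  by (simp add: rotation_number_def rv_add)

text \<open>Words use only permutations and types. Hence they repeat with the period of a
  self-similar \<open>T\<close> and agree for all maps with the same rotation number.\<close>

lemma word_cong:
  assumes "\<And>m. m < n \<Longrightarrow> rotation_number f m = rotation_number g m"
  shows "word f n = word g n"
  using assms
proof (induction n)
  case 0
  then show ?case by auto
next
  case (Suc n)
  have "word f n = word g n" using Suc by auto
  moreover have "rotation_number f n = rotation_number g n" using Suc by auto
  then have "last_bot (rv f n) = last_bot (rv g n)" "last_top (rv f n) = last_top (rv g n)"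
    "loser (rv f n) = loser (rv g n)"
    by (auto simp: rotation_number_def last_top_def last_bot_def loser_def split: rv_type.splits)
  ultimately show ?case by auto
qed

locale renorm =
  fixes f :: "'a::finite aiet"
  assumes f: "is_aiet f" and d: "2 \<le> CARD('a)" and inf: "infinitely_renormalizable f"
begin

lemma aiet_rv: "is_aiet (rv f n)"
proof (induction n)
  case 0
  then show ?case using f by (simp add: rv_def)
next
  case (Suc n)
  interpret rauzy_step "rv f n"
    using Suc d inf by unfold_locales (auto simp: infinitely_renormalizable_def)
  show ?case using aiet_rauzy by (simp add: rv_Suc rv_step_eq)
qed

lemma step: "rauzy_step (rv f n)"
  using aiet_rv d inf by unfold_locales (auto simp: infinitely_renormalizable_def)

lemma rv_Suc_rauzy: "rv f (Suc n) = rauzy (rv f n)"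
  using rauzy_step.rv_step_eq[OF step] by (simp add: rv_Suc)

lemma renorm_rv: "renorm (rv f n)"
  using aiet_rv d inf by unfold_locales (auto simp: infinitely_renormalizable_def rv_add)

lemma tower:
  assumes "x \<in> ivl (rv f n) a"
  shows "i < length (word f n a) \<Longrightarrow> (amap f ^^ i) x \<in> ivl f (word f n a ! i)"
    and "0 < i \<Longrightarrow> i < length (word f n a) \<Longrightarrow> (amap f ^^ i) x \<notin> dom_ivl (rv f n)"
    and "(amap f ^^ length (word f n a)) x = amap (rv f n) x"
proof -
  let ?P = "\<lambda>n a x. (\<forall>i<length (word f n a). (amap f ^^ i) x \<in> ivl f (word f n a ! i)) \<and>
    (\<forall>i<length (word f n a). 0 < i \<longrightarrow> (amap f ^^ i) x \<notin> dom_ivl (rv f n)) \<and>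
    (amap f ^^ length (word f n a)) x = amap (rv f n) x"
  have "?P n a x" using assms
  proof (induction n arbitrary: a x)
    case 0
    then show ?case by (simp add: rv_def)
  next
    case (Suc n)
    interpret R: rauzy_step "rv f n" by (rule step)
    have x: "x \<in> ivl (rauzy (rv f n)) a" using Suc.prems by (simp add: rv_Suc_rauzy)
    have sub: "dom_ivl (rauzy (rv f n)) \<subseteq> dom_ivl (rv f n)" by (rule R.dom_rauzy_subset)
    show ?case
    proof (cases "a = loser (rv f n)")
      case False
      note n = R.ivl_nonloser[OF x False]
      have "?P n a x" using Suc.IH[OF n(1)] .
      then show ?thesis using False sub n by (auto simp: rv_Suc_rauzy)
    next
      case True
      note l = R.ivl_loser[OF x[unfolded True]]
      let ?b = "last_bot (rv f n)" and ?t = "last_top (rv f n)"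
      define y where "y = amap (rv f n) x"
      have 1: "?P n ?b x" using Suc.IH[OF l(1)] .
      have 2: "?P n ?t y" using Suc.IH[OF l(2)] by (simp add: y_def)
      \<comment> \<open>The height at which the orbit passes from the old tower over
        \<open>?b\<close> to the one over \<open>?t\<close>. At this height it is in the old base,
        but in the piece just cut off.\<close>
      define L where "L = length (word f n ?b)"
      have y: "y = (amap f ^^ L) x" using 1 by (simp add: L_def y_def)
      have W: "word f (Suc n) a = word f n ?b @ word f n ?t" using True by simp
      have it: "(amap f ^^ i) x = (amap f ^^ (i - L)) y" if "L \<le> i" for i
        using that unfolding y by (metis comp_apply funpow_add le_add_diff_inverse2)
      have A: "(amap f ^^ i) x \<in> ivl f (word f (Suc n) a ! i)" if "i < length (word f (Suc n) a)" for i
      proof (cases "i < L")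
        case True
        then show ?thesis using 1 unfolding W L_def by (simp add: nth_append)
      next
        case False
        then show ?thesis using 2 it[of i] that unfolding W L_def by (simp add: nth_append)
      qed
      moreover have "(amap f ^^ i) x \<notin> dom_ivl (rv f (Suc n))" if i: "i < length (word f (Suc n) a)" "0 < i" for i
      proof (cases "i < L")
        case True
        then show ?thesis using 1 i sub unfolding L_def rv_Suc_rauzy by blast
      next
        case False
        show ?thesis
        proof (cases "i = L")
          case True
          then show ?thesis using l y by (simp add: rv_Suc_rauzy y_def)
        next
          case F: False
          then have "i - L < length (word f n ?t)" "0 < i - L" using i(1) False W by (auto simp: L_def)
          then show ?thesis using 2 it[of i] False sub unfolding rv_Suc_rauzy by auto
        qed
      qed
      moreover have "(amap f ^^ length (word f (Suc n) a)) x = amap (rv f (Suc n)) x"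
        using it[of "length (word f (Suc n) a)"] 2 l unfolding W by (simp add: L_def rv_Suc_rauzy y_def)
      ultimately show ?thesis by blast
    qed
  qed
  then show "i < length (word f n a) \<Longrightarrow> (amap f ^^ i) x \<in> ivl f (word f n a ! i)"
    and "0 < i \<Longrightarrow> i < length (word f n a) \<Longrightarrow> (amap f ^^ i) x \<notin> dom_ivl (rv f n)"
    and "(amap f ^^ length (word f n a)) x = amap (rv f n) x"
    by blast+
qed

text \<open>A base point that is cut off is the image under \<open>rv f n\<close> of a point of the
  new losing interval, so the old tower over it continues the tower over that point.\<close>

lemma tower_cover:
  assumes "y \<in> dom_ivl f"
  shows "\<exists>a. \<exists>x\<in>ivl (rv f n) a. \<exists>i<length (word f n a). y = (amap f ^^ i) x"
proof (induction n)
  case 0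
  then show ?case using ivl_cover[OF f assms] by (auto simp: rv_def)
next
  case (Suc n)
  interpret R: rauzy_step "rv f n" by (rule step)
  from Suc obtain a x i where x: "x \<in> ivl (rv f n) a" "i < length (word f n a)" "y = (amap f ^^ i) x"
    by blast
  have "x \<in> dom_ivl (rv f n)" using x ivl_subset_dom[OF aiet_rv] by blast
  from R.cover_rauzy[OF this] show ?case
  proof
    assume "x \<in> dom_ivl (rauzy (rv f n))"
    then obtain c where c: "x \<in> ivl (rauzy (rv f n)) c" using ivl_cover[OF R.aiet_rauzy] by blast
    show ?thesis
    proof (cases "c = loser (rv f n)")
      case False
      then have "c = a" using R.ivl_nonloser(1)[OF c] x(1) ivl_unique[OF aiet_rv] by blast
      then show ?thesis using x c False by (auto simp: rv_Suc_rauzy intro!: exI[of _ c] bexI[of _ x])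
    next
      case True
      then have "a = last_bot (rv f n)" using R.ivl_loser(1) c x(1) ivl_unique[OF aiet_rv] by blast
      then have "i < length (word f (Suc n) c)" using x(2) True by simp
      then show ?thesis using x c by (auto simp: rv_Suc_rauzy simp del: word.simps)
    qed
  next
    assume "\<exists>z\<in>ivl (rauzy (rv f n)) (loser (rv f n)). x = amap (rv f n) z"
    then obtain z where z: "z \<in> ivl (rauzy (rv f n)) (loser (rv f n))" "x = amap (rv f n) z" by blast
    note l = R.ivl_loser[OF z(1)]
    have at: "a = last_top (rv f n)" using l(2) z(2) x(1) ivl_unique[OF aiet_rv] by blast
    let ?L = "length (word f n (last_bot (rv f n)))"
    have "y = (amap f ^^ (i + ?L)) z"
      using tower(3)[OF l(1)] z x by (simp add: funpow_add)
    moreover have "i + ?L < length (word f (Suc n) (loser (rv f n)))" using x at by simp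
    ultimately show ?thesis using z(1) by (auto simp: rv_Suc_rauzy simp del: word.simps)
  qed
qed

lemma inj_pow: "inj (amap f ^^ i)"
  using inj_amap[OF f] by (metis inj_fn)

text \<open>If \<open>i < j\<close>, injectivity would place \<open>x\<close> on an intermediate
  floor of the tower over \<open>y\<close>, but those floors lie outside the base.\<close>

lemma tower_unique:
  assumes x: "x \<in> ivl (rv f n) a" "i < length (word f n a)"
    and y: "y \<in> ivl (rv f n) c" "j < length (word f n c)"
    and e: "(amap f ^^ i) x = (amap f ^^ j) y"
  shows "x = y \<and> i = j \<and> a = c"
proof -
  have *: "\<not> i < j" if "x \<in> ivl (rv f n) a" "y \<in> ivl (rv f n) c" "j < length (word f n c)"
    "(amap f ^^ i) x = (amap f ^^ j) y" for x y a c i j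
  proof
    assume ij: "i < j"
    have "(amap f ^^ j) y = (amap f ^^ i) ((amap f ^^ (j - i)) y)"
      using ij by (metis comp_apply funpow_add le_add_diff_inverse less_imp_le)
    then have "x = (amap f ^^ (j - i)) y" using that(4) inj_pow[of i] by (metis injD)
    moreover have "(amap f ^^ (j - i)) y \<notin> dom_ivl (rv f n)" using tower(2)[OF that(2), of "j - i"] that(3) ij by auto
    ultimately show False using that(1) ivl_subset_dom[OF aiet_rv] by blast
  qed
  have "i = j" using *[OF x(1) y(1) y(2) e] *[OF y(1) x(1) x(2) e[symmetric]] by simp
  moreover from this have "x = y" using e inj_pow[of i] by (metis injD)
  moreover from this have "a = c" using x y ivl_unique[OF aiet_rv] by blast
  ultimately show ?thesis by blast
qed

lemma return_time_eq:
  assumes x: "x \<in> ivl (rv f n) a"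
  shows "return_time (amap f) (dom_ivl (rv f n)) x = length (word f n a)"
  unfolding return_time_def
proof (rule Least_equality)
  have "amap (rv f n) x \<in> dom_ivl (rv f n)"
    using x ivl_subset_dom[OF aiet_rv] amap_dom[OF aiet_rv] by blast
  then show "1 \<le> length (word f n a) \<and> (amap f ^^ length (word f n a)) x \<in> dom_ivl (rv f n)"
    using tower(3)[OF x] word_nonempty[of f n a] by (simp add: Suc_le_eq)
next
  fix r assume "1 \<le> r \<and> (amap f ^^ r) x \<in> dom_ivl (rv f n)"
  then show "length (word f n a) \<le> r" using tower(2)[OF x, of r] by (cases "r < length (word f n a)") (auto simp: Suc_le_eq)
qed

lemma ivl_rv_nonempty: "top_left (rv f n) a \<in> ivl (rv f n) a"
  using len_pos[OF aiet_rv] by (simp add: ivl_def)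

lemma rv_return_time_eq: "rv_return_time f n a = length (word f n a)"
  unfolding rv_return_time_def
  using return_time_eq ivl_rv_nonempty by (intro the_equality) (blast, metis)

lemma floor_subset_iff:
  assumes "k < length (word f n a)"
  shows "(amap f ^^ k) ` ivl (rv f n) a \<subseteq> ivl f c \<longleftrightarrow> word f n a ! k = c"
  using tower(1)[of _ n a k, OF _ assms] ivl_rv_nonempty[of n a] ivl_unique[OF f] by blast

lemma ss_matrix_eq: "ss_matrix f n $ a $ c = real (count_list (word f n a) c)"
proof -
  have "{k. k < length (word f n a) \<and> (amap f ^^ k) ` ivl (rv f n) a \<subseteq> ivl f c} =
      {k. k < length (word f n a) \<and> word f n a ! k = c}"
    using floor_subset_iff by blast
  moreover have "card {k. k < length (word f n a) \<and> word f n a ! k = c} = count_list (word f n a) c"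
    by (simp add: count_list_eq_length_filter length_filter_conv_card eq_commute)
  ultimately show ?thesis by (simp add: ss_matrix_def rv_return_time_eq)
qed

lemma floor_letter_eq: "k < length (word f n a) \<Longrightarrow> floor_letter f n (a, k) = word f n a ! k"
  unfolding floor_letter_def tower_floor_def
  using floor_subset_iff by (intro the_equality) auto

lemma tower_index_eq: "tower_index f n = {(a, i). i < length (word f n a)}"
  by (simp add: tower_index_def rv_return_time_eq)

lemma common_break_rv:
  assumes "top_left f a = bot_left f c"
  shows "\<exists>a' c'. top_left (rv f n) a' = top_left f a \<and> bot_left (rv f n) c' = top_left f a"
proof (induction n)
  case 0
  then show ?case using assms by (auto simp: rv_def)
next
  case (Suc n)
  interpret R: rauzy_step "rv f n" by (rule step)
  show ?case using Suc R.common_break by (metis rv_Suc_rauzy)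
qed

lemma slope_rv_0: "slope f = 0 \<Longrightarrow> slope (rv f n) = 0"
proof (induction n)
  case (Suc n)
  then show ?case using rauzy_step.slope_rauzy_0[OF step] by (simp add: rv_Suc_rauzy)
qed (simp add: rv_def)

text \<open>Each step subtracts the length of the loser from that of the winner, and the word of the
  loser gains the letters of the word of the winner; the two changes cancel in the sum.\<close>

lemma len_rv:
  assumes s: "slope f = 0"
  shows "len f $ c = (\<Sum>a\<in>UNIV. len (rv f n) $ a * real (count_list (word f n a) c))"
proof (induction n)
  case 0
  have "count_list [a] c = (if a = c then 1 else 0)" for a by simp
  then show ?case by (simp add: rv_def if_distrib sum.delta cong: if_cong)
next
  case (Suc n)
  interpret R: rauzy_step "rv f n" by (rule step)
  let ?g = "rauzy (rv f n)" and ?l = "loser (rv f n)" and ?w = "winner (rv f n)"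
  let ?W = "\<lambda>a. real (count_list (word f n a) c)"
  have cl: "real (count_list (word f (Suc n) a) c) = ?W a + (if a = ?l then ?W ?w else 0)" for a
    by (auto simp: loser_def winner_def split: rv_type.splits)
  have "len f $ c = (\<Sum>a\<in>UNIV. len (rv f n) $ a * ?W a)" by (rule Suc)
  also have "\<dots> = (\<Sum>a\<in>UNIV. len ?g $ a * ?W a + (if a = ?w then len ?g $ ?l * ?W ?w else 0))"
    using R.len_rauzy slope_rv_0[OF s] by (intro sum.cong) (auto simp: algebra_simps)
  also have "\<dots> = (\<Sum>a\<in>UNIV. len ?g $ a * ?W a) + len ?g $ ?l * ?W ?w"
    by (simp add: sum.distrib)
  also have "\<dots> = (\<Sum>a\<in>UNIV. len ?g $ a * ?W a + (if a = ?l then len ?g $ ?l * ?W ?w else 0))"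
    by (simp add: sum.distrib)
  also have "\<dots> = (\<Sum>a\<in>UNIV. len ?g $ a * real (count_list (word f (Suc n) a) c))"
    unfolding cl by (intro sum.cong) (auto simp: algebra_simps)
  finally show ?case by (simp only: rv_Suc_rauzy)
qed

end

section \<open>Positive matrices\<close>

text \<open>A positive matrix contracts the oscillation of the ratio of two consecutive terms by a fixed
  factor. The terms exist for all \<open>k\<close> and the oscillation is bounded, so it vanishes.\<close>

lemma backward_orbit_eigenvector:
  fixes A :: "'a::finite \<Rightarrow> 'a \<Rightarrow> real" and x :: "nat \<Rightarrow> 'a \<Rightarrow> real"
  assumes A: "\<And>a b. 0 < A a b" and x: "\<And>k a. 0 < x k a"
    and rec: "\<And>k b. x k b = (\<Sum>a\<in>UNIV. x (Suc k) a * A a b)"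
  shows "\<exists>R>0. \<forall>k a. x k a = R * x (Suc k) a"
proof -
  define Amin where "Amin = Min (range (\<lambda>(a,b). A a b))"
  define Amax where "Amax = Max (range (\<lambda>(a,b). A a b))"
  have "Amin \<in> range (\<lambda>(a,b). A a b)" unfolding Amin_def by (rule Min_in) auto
  then have Amin0: "0 < Amin" using A by auto
  have Amin: "Amin \<le> A a b" for a b unfolding Amin_def by (rule Min_le) (auto intro!: image_eqI[of _ _ "(a,b)"])
  have Amax: "A a b \<le> Amax" for a b unfolding Amax_def by (rule Max_ge) (auto intro!: image_eqI[of _ _ "(a,b)"])
  have Amax0: "0 < Amax" using Amax[of undefined undefined] A[of undefined undefined] by linarith
  define C where "C = Amax / Amin"
  have C1: "1 \<le> C" using Amin[of undefined undefined] Amax[of undefined undefined] Amin0 by (simp add: C_def)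
  have cmp: "x k a \<le> C * x k b" for k a b
  proof -
    let ?X = "\<Sum>c\<in>UNIV. x (Suc k) c"
    have "x k a \<le> (\<Sum>c\<in>UNIV. x (Suc k) c * Amax)"
      unfolding rec[of k a] by (intro sum_mono mult_left_mono Amax less_imp_le x)
    also have "\<dots> = C * (\<Sum>c\<in>UNIV. x (Suc k) c * Amin)"
      using Amin0 by (simp add: C_def sum_distrib_right[symmetric])
    also have "\<dots> \<le> C * x k b"
      unfolding rec[of k b] using C1 by (intro mult_left_mono sum_mono Amin less_imp_le x) auto
    finally show ?thesis .
  qed
  define n where "n = real CARD('a)"
  have n1: "1 \<le> n" by (simp add: n_def Suc_le_eq)
  have up: "x k b \<le> n * C * Amax * x (Suc k) a" for k a b
  proof -
    have "x k b \<le> (\<Sum>c\<in>(UNIV::'a set). C * x (Suc k) a * Amax)"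
      unfolding rec[of k b] using C1 by (intro sum_mono mult_mono Amax cmp) (auto intro!: mult_nonneg_nonneg less_imp_le[OF x] less_imp_le[OF A])
    then show ?thesis by (simp add: n_def mult_ac)
  qed
  define lo where "lo k = Min (range (\<lambda>a. x k a / x (Suc k) a))" for k
  define hi where "hi k = Max (range (\<lambda>a. x k a / x (Suc k) a))" for k
  have lo: "lo k * x (Suc k) a \<le> x k a" for k a
  proof -
    have "lo k \<le> x k a / x (Suc k) a" unfolding lo_def by (rule Min_le) auto
    then show ?thesis using x[of "Suc k" a] by (simp add: field_simps)
  qed
  have hi: "x k a \<le> hi k * x (Suc k) a" for k a
  proof -
    have "x k a / x (Suc k) a \<le> hi k" unfolding hi_def by (rule Max_ge) auto
    then show ?thesis using x[of "Suc k" a] by (simp add: field_simps)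
  qed
  have lo_in: "\<exists>a. x k a = lo k * x (Suc k) a" for k
  proof -
    have "lo k \<in> range (\<lambda>a. x k a / x (Suc k) a)" unfolding lo_def by (rule Min_in) auto
    then obtain a where "lo k = x k a / x (Suc k) a" by auto
    then show ?thesis using x[of "Suc k" a] by (intro exI[of _ a]) auto
  qed
  have hi_in: "\<exists>a. x k a = hi k * x (Suc k) a" for k
  proof -
    have "hi k \<in> range (\<lambda>a. x k a / x (Suc k) a)" unfolding hi_def by (rule Max_in) auto
    then obtain a where "hi k = x k a / x (Suc k) a" by auto
    then show ?thesis using x[of "Suc k" a] by (intro exI[of _ a]) auto
  qed
  \<comment> \<open>The index attaining \<open>hi (Suc k)\<close> enters every coordinate with
    weight at least \<open>Amin\<close>. By \<open>up\<close> this raises the minimal ratio by at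
    least the fraction \<kappa> of the oscillation in passing from \<open>Suc k\<close> to
    \<open>k\<close>.\<close>
  define \<kappa> where "\<kappa> = Amin / (n * C * Amax)"
  have nCA: "0 < n * C * Amax" using n1 C1 Amax0 by simp
  have \<kappa>0: "0 < \<kappa>" using Amin0 nCA by (simp add: \<kappa>_def)
  have hi_lo: "lo k \<le> hi k" for k
  proof -
    obtain a where "x k a = lo k * x (Suc k) a" using lo_in by blast
    then have "lo k * x (Suc k) a \<le> hi k * x (Suc k) a" using hi[of k a] by simp
    then show ?thesis using x[of "Suc k" a] by simp
  qed
  have contr: "hi k - lo k \<le> (1 - \<kappa>) * (hi (Suc k) - lo (Suc k))" for k
  proof -
    let ?l = "lo (Suc k)" and ?h = "hi (Suc k)"
    obtain a where a: "x (Suc k) a = ?h * x (Suc (Suc k)) a" using hi_in by blast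
    have "(?l + \<kappa> * (?h - ?l)) * x (Suc k) b \<le> x k b" for b
    proof -
      have "\<kappa> * (?h - ?l) * x (Suc k) b \<le> \<kappa> * (?h - ?l) * (n * C * Amax * x (Suc (Suc k)) a)"
        using up[of "Suc k" b a] \<kappa>0 hi_lo[of "Suc k"] by (intro mult_left_mono) auto
      also have "\<dots> = (?h - ?l) * x (Suc (Suc k)) a * Amin"
        using n1 C1 Amax0 by (auto simp: \<kappa>_def)
      also have "\<dots> \<le> (?h - ?l) * x (Suc (Suc k)) a * A a b"
        using hi_lo[of "Suc k"] x[of "Suc (Suc k)" a] by (intro mult_left_mono Amin) auto
      also have "\<dots> = (x (Suc k) a - ?l * x (Suc (Suc k)) a) * A a b"
        using a by (simp add: algebra_simps)
      also have "\<dots> \<le> (\<Sum>c\<in>UNIV. (x (Suc k) c - ?l * x (Suc (Suc k)) c) * A c b)"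
        using lo[of "Suc k"] A by (intro member_le_sum mult_nonneg_nonneg) (auto simp: less_imp_le)
      also have "\<dots> = x k b - ?l * x (Suc k) b"
        by (simp add: rec[of k b] rec[of "Suc k" b] sum_subtractf left_diff_distrib sum_distrib_left mult.assoc)
      finally show ?thesis by (simp add: algebra_simps)
    qed
    moreover obtain b where "x k b = lo k * x (Suc k) b" using lo_in by blast
    ultimately have 1: "?l + \<kappa> * (?h - ?l) \<le> lo k" using x[of "Suc k" b] by (metis mult_le_cancel_right_pos)
    have "x k b \<le> ?h * x (Suc k) b" for b
    proof -
      have "x k b \<le> (\<Sum>c\<in>UNIV. ?h * x (Suc (Suc k)) c * A c b)"
        unfolding rec[of k b] by (intro sum_mono mult_right_mono hi less_imp_le A)
      then show ?thesis by (simp add: rec[of "Suc k" b] sum_distrib_left mult.assoc)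
    qed
    moreover obtain b' where "x k b' = hi k * x (Suc k) b'" using hi_in by blast
    ultimately have "hi k \<le> ?h" using x[of "Suc k" b'] by (metis mult_le_cancel_right_pos)
    then show ?thesis using 1 by (simp add: algebra_simps)
  qed
  have bdd: "hi k - lo k \<le> n * C * Amax" for k
  proof -
    obtain a where "x k a = hi k * x (Suc k) a" using hi_in by blast
    then have "hi k \<le> n * C * Amax" using up[of k a a] x[of "Suc k" a] by simp
    moreover obtain b where b: "x k b = lo k * x (Suc k) b" using lo_in by blast
    then have "0 < lo k" using x[of k b] x[of "Suc k" b] by (simp add: zero_less_mult_iff)
    ultimately show ?thesis by simp
  qed
  have \<kappa>1: "0 \<le> 1 - \<kappa>"
  proof -
    have "Amin \<le> 1 * (1 * Amax)" using Amin[of undefined undefined] Amax[of undefined undefined] by simp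
    also have "\<dots> \<le> n * (C * Amax)" using n1 C1 Amax0 by (intro mult_mono) auto
    finally show ?thesis using nCA by (simp add: \<kappa>_def mult.assoc)
  qed
  have iter: "hi k - lo k \<le> (1 - \<kappa>) ^ m * (n * C * Amax)" for k m
  proof (induction m arbitrary: k)
    case (Suc m)
    have "hi k - lo k \<le> (1 - \<kappa>) * (hi (Suc k) - lo (Suc k))" by (rule contr)
    also have "\<dots> \<le> (1 - \<kappa>) * ((1 - \<kappa>) ^ m * (n * C * Amax))"
      by (intro mult_left_mono Suc.IH \<kappa>1)
    finally show ?case by simp
  qed (use bdd in simp)
  have eq: "hi k = lo k" for k
  proof -
    have "(\<lambda>m. (1 - \<kappa>) ^ m * (n * C * Amax)) \<longlonglongrightarrow> 0 * (n * C * Amax)"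
      using \<kappa>0 \<kappa>1 by (intro tendsto_mult LIMSEQ_realpow_zero tendsto_const) auto
    then have "hi k - lo k \<le> 0"
      using iter by (intro LIMSEQ_le_const[of _ 0]) auto
    then show ?thesis using hi_lo[of k] by simp
  qed
  have R: "x k a = lo k * x (Suc k) a" for k a
    using lo[of k a] hi[of k a] eq[of k] by simp
  have Rc: "lo k = lo (Suc k)" for k
  proof -
    have "x k undefined = (\<Sum>a\<in>UNIV. lo (Suc k) * x (Suc (Suc k)) a * A a undefined)"
      using rec[of k] R[of "Suc k"] by simp
    also have "\<dots> = lo (Suc k) * x (Suc k) undefined"
      by (simp add: rec[of "Suc k"] sum_distrib_left mult.assoc)
    finally show ?thesis using R[of k undefined] x[of "Suc k" undefined] by simp
  qed
  have "lo k = lo 0" for k by (induction k) (use Rc in auto)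
  moreover have "0 < lo 0" using R[of 0 undefined] x[of 0 undefined] x[of "Suc 0" undefined]
    by (simp add: zero_less_mult_iff)
  ultimately show ?thesis using R by metis
qed

section \<open>Characteristic polynomial, spectral radius and contracting vectors\<close>

lemma homogeneous_linear_equations_det:
  fixes A :: "'b::field ^ 'n ^ 'n"
  shows "(\<exists>x. x \<noteq> 0 \<and> A *v x = 0) \<longleftrightarrow> det A = 0"
  using matrix_left_invertible_ker[of A] invertible_left_inverse[of A] invertible_det_nz[of A] by metis

lemma poly_charpoly: "poly (charpoly A) c = det (\<chi> i j. (if i = j then c else 0) - A $ i $ j)"
proof -
  have "poly (of_int k) c = of_int k" for k :: int by simp
  then show ?thesis
    unfolding charpoly_def det_def
    by (simp add: poly_sum poly_prod if_distrib[of "\<lambda>p. poly p c"] cong: if_cong)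
qed

lemma eigenvector_iff_root:
  fixes A :: "real ^ 'a ^ 'a"
  shows "(\<exists>v. v \<noteq> 0 \<and> A *v v = c *s v) \<longleftrightarrow> poly (charpoly A) c = 0"
proof -
  have "A *v v = c *s v \<longleftrightarrow> (\<chi> i j. (if i = j then c else 0) - A $ i $ j) *v v = 0" for v
    by (auto simp: vec_eq_iff matrix_vector_mult_def left_diff_distrib sum_subtractf if_distrib[of "\<lambda>x. x * _"] cong: if_cong)
  then show ?thesis by (simp add: poly_charpoly homogeneous_linear_equations_det)
qed

lemma poly_charpoly_transpose: "poly (charpoly (transpose A)) c = poly (charpoly A) c"
proof -
  have "(\<chi> i j. (if i = j then c else 0) - transpose A $ i $ j) = transpose (\<chi> i j. (if i = j then c else 0) - A $ i $ j)"
    by (auto simp: vec_eq_iff transpose_def)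
  then show ?thesis by (simp add: poly_charpoly det_transpose)
qed

lemma real_complex_eigenvalue:
  fixes A :: "real ^ 'a ^ 'a"
  assumes "A *v v = c *s v" "v \<noteq> 0"
  shows "complex_of_real c \<in> complex_eigenvalues A"
proof -
  let ?v = "\<chi> i. complex_of_real (v $ i)"
  have "(\<Sum>j\<in>UNIV. A $ i $ j * v $ j) = c * v $ i" for i
    using assms(1) by (simp add: vec_eq_iff matrix_vector_mult_def)
  then have "complex_of_real (\<Sum>j\<in>UNIV. A $ i $ j * v $ j) = complex_of_real (c * v $ i)" for i by simp
  then have "(\<chi> i j. complex_of_real (A $ i $ j)) *v ?v = complex_of_real c *s ?v"
    by (simp add: vec_eq_iff matrix_vector_mult_def)
  moreover have "?v \<noteq> 0" using assms(2) by (auto simp: vec_eq_iff)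
  ultimately show ?thesis by (auto simp: complex_eigenvalues_def)
qed

lemma complex_eigenvalue_of_real:
  fixes A :: "real ^ 'a ^ 'a"
  assumes "complex_of_real c \<in> complex_eigenvalues A"
  shows "\<exists>v. v \<noteq> 0 \<and> A *v v = c *s v"
proof -
  obtain v :: "complex ^ 'a" where v: "v \<noteq> 0" "(\<chi> i j. complex_of_real (A $ i $ j)) *v v = of_real c *s v"
    using assms by (auto simp: complex_eigenvalues_def)
  have e: "(\<Sum>j\<in>UNIV. complex_of_real (A $ i $ j) * v $ j) = of_real c * v $ i" for i
    using v(2) by (simp add: vec_eq_iff matrix_vector_mult_def)
  have re: "(\<Sum>j\<in>UNIV. A $ i $ j * Re (v $ j)) = c * Re (v $ i)" for i
    using arg_cong[OF e[of i], of Re] by simp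
  have im: "(\<Sum>j\<in>UNIV. A $ i $ j * Im (v $ j)) = c * Im (v $ i)" for i
    using arg_cong[OF e[of i], of Im] by simp
  have "(\<chi> i. Re (v $ i)) \<noteq> 0 \<or> (\<chi> i. Im (v $ i)) \<noteq> 0"
    using v(1) by (auto simp: vec_eq_iff complex_eq_iff)
  moreover have "A *v (\<chi> i. Re (v $ i)) = c *s (\<chi> i. Re (v $ i))"
    "A *v (\<chi> i. Im (v $ i)) = c *s (\<chi> i. Im (v $ i))"
    using re im by (auto simp: vec_eq_iff matrix_vector_mult_def)
  ultimately show ?thesis by blast
qed

text \<open>Pairing the moduli of an eigenvector with the positive left eigenvector \<open>l\<close>
  bounds every eigenvalue by \<open>r\<close>. And \<open>r\<close> is itself an eigenvalue, since
  the characteristic polynomials of \<open>A\<close> and its transpose have the same values.\<close>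

lemma pf_eigenvalue_eqI:
  fixes A :: "real ^ 'a ^ 'a"
  assumes nn: "\<And>i j. 0 \<le> A $ i $ j" and l: "\<And>i. 0 < l i"
    and e: "\<And>j. (\<Sum>i\<in>UNIV. l i * A $ i $ j) = r * l j"
    and real: "complex_eigenvalues A \<subseteq> \<real>"
  shows "pf_eigenvalue A = r"
proof -
  have lA: "(\<Sum>i\<in>UNIV. l i * (\<Sum>j\<in>UNIV. A $ i $ j * w j)) = r * (\<Sum>j\<in>UNIV. l j * w j)" for w
  proof -
    have "(\<Sum>i\<in>UNIV. l i * (\<Sum>j\<in>UNIV. A $ i $ j * w j)) = (\<Sum>i\<in>UNIV. \<Sum>j\<in>UNIV. l i * A $ i $ j * w j)"
      by (simp add: sum_distrib_left mult.assoc)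
    also have "\<dots> = (\<Sum>j\<in>UNIV. \<Sum>i\<in>UNIV. l i * A $ i $ j * w j)" by (rule sum.swap)
    also have "\<dots> = (\<Sum>j\<in>UNIV. r * l j * w j)" by (simp add: sum_distrib_right[symmetric] e)
    finally show ?thesis by (simp add: sum_distrib_left mult.assoc)
  qed
  have r0: "0 \<le> r"
  proof -
    have "0 \<le> (\<Sum>i\<in>UNIV. l i * A $ i $ undefined)" by (intro sum_nonneg mult_nonneg_nonneg nn less_imp_le l)
    then show ?thesis using e[of undefined] l[of undefined] by (simp add: zero_le_mult_iff)
  qed
  have le: "cmod c \<le> r" if c: "c \<in> complex_eigenvalues A" for c
  proof -
    obtain v :: "complex ^ 'a" where v: "v \<noteq> 0" "(\<chi> i j. complex_of_real (A $ i $ j)) *v v = c *s v"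
      using c by (auto simp: complex_eigenvalues_def)
    have i: "cmod c * cmod (v $ i) \<le> (\<Sum>j\<in>UNIV. A $ i $ j * cmod (v $ j))" for i
    proof -
      have "c * v $ i = (\<Sum>j\<in>UNIV. complex_of_real (A $ i $ j) * v $ j)"
        using v(2) by (simp add: vec_eq_iff matrix_vector_mult_def)
      then have "cmod c * cmod (v $ i) = cmod (\<Sum>j\<in>UNIV. complex_of_real (A $ i $ j) * v $ j)"
        by (metis norm_mult)
      also have "\<dots> \<le> (\<Sum>j\<in>UNIV. cmod (complex_of_real (A $ i $ j) * v $ j))" by (rule norm_sum)
      also have "\<dots> = (\<Sum>j\<in>UNIV. A $ i $ j * cmod (v $ j))" by (simp add: norm_mult nn)
      finally show ?thesis .
    qed
    have "cmod c * (\<Sum>i\<in>UNIV. l i * cmod (v $ i)) = (\<Sum>i\<in>UNIV. l i * (cmod c * cmod (v $ i)))"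
      by (simp add: sum_distrib_left mult_ac)
    also have "\<dots> \<le> (\<Sum>i\<in>UNIV. l i * (\<Sum>j\<in>UNIV. A $ i $ j * cmod (v $ j)))"
      by (intro sum_mono mult_left_mono i less_imp_le l)
    also have "\<dots> = r * (\<Sum>j\<in>UNIV. l j * cmod (v $ j))" by (rule lA)
    finally have 1: "cmod c * (\<Sum>i\<in>UNIV. l i * cmod (v $ i)) \<le> r * (\<Sum>j\<in>UNIV. l j * cmod (v $ j))" .
    obtain k where "v $ k \<noteq> 0" using v(1) by (auto simp: vec_eq_iff)
    then have "0 < (\<Sum>j\<in>UNIV. l j * cmod (v $ j))"
      using l by (intro sum_pos2[of _ k]) (auto simp: less_imp_le)
    then show ?thesis using 1 by simp
  qed
  have fin: "finite (complex_eigenvalues A)"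
  proof -
    have "complex_eigenvalues A \<subseteq> complex_of_real ` {c. poly (charpoly A) c = 0}"
    proof
      fix c assume c: "c \<in> complex_eigenvalues A"
      then obtain x where x: "c = complex_of_real x" using real by (auto elim: Reals_cases)
      then show "c \<in> complex_of_real ` {c. poly (charpoly A) c = 0}"
        using complex_eigenvalue_of_real[of x A] c eigenvector_iff_root[of A x] by auto
    qed
    \<comment> \<open>\<open>r + 1\<close> exceeds the bound \<open>le\<close>, so it is not a root.
      Hence the polynomial is nonzero and the set under \<open>Max\<close> is finite.\<close>
    moreover have "charpoly A \<noteq> 0"
    proof
      assume "charpoly A = 0"
      then obtain v where "v \<noteq> 0" "A *v v = (r + 1) *s v" using eigenvector_iff_root[of A "r + 1"] by auto
      then have "cmod (complex_of_real (r + 1)) \<le> r" by (intro le real_complex_eigenvalue)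
      then show False using r0 by (simp add: norm_of_real del: of_real_add)
    qed
    then have "finite {c. poly (charpoly A) c = 0}" by (rule poly_roots_finite)
    ultimately show ?thesis using finite_subset by blast
  qed
  have mem: "complex_of_real r \<in> complex_eigenvalues A"
  proof -
    have "transpose A *v (\<chi> i. l i) = r *s (\<chi> i. l i)"
      using e by (simp add: vec_eq_iff matrix_vector_mult_def transpose_def mult.commute)
    moreover have "(\<chi> i. l i) \<noteq> 0" using l[of undefined] by (metis vec_lambda_beta zero_index less_irrefl)
    ultimately have "poly (charpoly A) r = 0"
      using eigenvector_iff_root[of "transpose A" r] by (auto simp: poly_charpoly_transpose)
    then show ?thesis using eigenvector_iff_root[of A r] real_complex_eigenvalue by blast
  qed
  show ?thesis unfolding pf_eigenvalue_def
  proof (rule Max_eqI)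
    show "r \<in> cmod ` complex_eigenvalues A" using mem r0 by (intro image_eqI[of _ _ "complex_of_real r"]) auto
  qed (use fin le in auto)
qed

text \<open>Vectors with summable orbit form a subspace, so eigenvectors suffice, and for these the
  series is geometric.\<close>

lemma summable_contracting:
  assumes "v \<in> contracting_space A"
  shows "summable (\<lambda>k. norm ((((*v) A) ^^ k) v))"
proof -
  let ?it = "\<lambda>k v. (((*v) A) ^^ k) v"
  have lin: "?it k (x + y) = ?it k x + ?it k y" "?it k (c *\<^sub>R x) = c *\<^sub>R ?it k x" for k x y c
    by (induction k) (auto simp: matrix_vector_right_distrib matrix_vector_mult_scaleR)
  have "subspace {v. summable (\<lambda>k. norm (?it k v))}"
  proof (rule subspaceI)
    have "?it k 0 = 0" for k by (induction k) auto
    then show "0 \<in> {v. summable (\<lambda>k. norm (?it k v))}" by simp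
    fix x y assume "x \<in> {v. summable (\<lambda>k. norm (?it k v))}" "y \<in> {v. summable (\<lambda>k. norm (?it k v))}"
    then have "summable (\<lambda>k. norm (?it k x) + norm (?it k y))" by (simp add: summable_add)
    then show "x + y \<in> {v. summable (\<lambda>k. norm (?it k v))}"
      by (auto simp: lin intro!: summable_comparison_test'[where g = "\<lambda>k. norm (?it k x) + norm (?it k y)"] norm_triangle_ineq)
  next
    fix x and c :: real assume "x \<in> {v. summable (\<lambda>k. norm (?it k v))}"
    then show "c *\<^sub>R x \<in> {v. summable (\<lambda>k. norm (?it k v))}" by (simp add: lin summable_mult)
  qed
  moreover have "{v. \<exists>c. \<bar>c\<bar> < 1 \<and> A *v v = c *\<^sub>R v} \<subseteq> {v. summable (\<lambda>k. norm (?it k v))}"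
  proof clarsimp
    fix v and c :: real assume c: "\<bar>c\<bar> < 1" "A *v v = c *\<^sub>R v"
    have "?it k v = c ^ k *\<^sub>R v" for k
      by (induction k) (auto simp: matrix_vector_mult_scaleR c(2))
    then show "summable (\<lambda>k. norm (?it k v))"
      using c(1) by (simp add: power_abs summable_geometric summable_mult2)
  qed
  ultimately have "contracting_space A \<subseteq> {v. summable (\<lambda>k. norm (?it k v))}"
    unfolding contracting_space_def by (rule span_minimal[rotated])
  then show ?thesis using assms by auto
qed

text \<open>Two candidates differ by a vector that is both fixed and in the contracting space; a
  constant summable sequence is zero.\<close>

lemma central_part_eqI:
  assumes c: "ss_matrix T N *v c = c" and s: "\<omega> - c \<in> contracting_space (ss_matrix T N)"
  shows "central_part T N \<omega> = c"
  unfolding central_part_def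
proof (rule the_equality)
  fix c' assume c': "ss_matrix T N *v c' = c' \<and> \<omega> - c' \<in> contracting_space (ss_matrix T N)"
  let ?A = "ss_matrix T N"
  have "(\<omega> - c') - (\<omega> - c) \<in> contracting_space ?A"
    using c' s unfolding contracting_space_def by (intro span_diff[of "\<omega> - c'" _ "\<omega> - c"]) auto
  then have "summable (\<lambda>k. norm ((((*v) ?A) ^^ k) (c - c')))"
    using summable_contracting by (simp add: algebra_simps)
  moreover have "(((*v) ?A) ^^ k) (c - c') = c - c'" for k
    using c c' by (induction k) (auto simp: matrix_vector_mult_diff_distrib)
  ultimately have "summable (\<lambda>k::nat. norm (c - c'))" by simp
  then show "c' = c" by (simp add: summable_const_iff)
qed (use assms in auto)

section \<open>Renormalization as rescaling\<close>

locale selfsim =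
  fixes T :: "'a::finite aiet" and N :: nat
  assumes d: "2 \<le> CARD('a)" and ss: "self_similar T" and pp: "positive_period T N"

sublocale selfsim \<subseteq> renorm T
  using d ss by unfold_locales (auto simp: self_similar_def is_iet_def)

context selfsim
begin

abbreviation "M \<equiv> ss_matrix T N"
abbreviation "W \<equiv> word T N"

lemma slope_T: "slope T = 0" and dom_T: "dom_ivl T = {0..<1}"
  using ss by (auto simp: self_similar_def is_iet_def)

lemma tot_T: "tot T = 1"
proof -
  have "{0..<tot T} = {0..<1}" using dom_T by (simp add: dom_ivl_def)
  then show ?thesis by (simp add: Ico_eq_Ico)
qed

lemma M_pos: "0 < M $ a $ b" and M_eq: "M $ a $ b = real (count_list (W a) b)"
  using pp by (auto simp: positive_period_def ss_matrix_eq)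

lemma letter_in_W: "b \<in> set (W a)"
  using M_pos[of a b] count_list_0_iff[of "W a" b] by (auto simp: M_eq)

lemma rot_period: "rotation_number T (k * N + n) = rotation_number T n"
proof (induction k)
  case (Suc k)
  have "rotation_number T (Suc k * N + n) = rotation_number T ((k * N + n) + N)"
    by (simp add: algebra_simps)
  also have "\<dots> = rotation_number T (k * N + n)"
    using pp unfolding positive_period_def is_period_def by blast
  finally show ?case using Suc by simp
qed simp

lemma word_period: "word (rv T (k * N)) N = W"
  by (rule word_cong) (simp add: rotation_number_rv rot_period)

lemma len_recursion:
  "len (rv T (k * N)) $ b = (\<Sum>a\<in>UNIV. len (rv T (Suc k * N)) $ a * M $ a $ b)"
proof -
  interpret R: renorm "rv T (k * N)" by (rule renorm_rv)
  have "slope (rv T (k * N)) = 0" by (rule slope_rv_0[OF slope_T])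
  then show ?thesis using R.len_rv[of b N] by (simp add: word_period M_eq rv_add add.commute)
qed

definition r :: real where
  "r = (SOME R. R > 0 \<and> (\<forall>k a. len (rv T (k * N)) $ a = R * len (rv T (Suc k * N)) $ a))"

text \<open>The lengths at the times \<open>k * N\<close> form a backward orbit of \<open>M\<close>,
  hence a geometric sequence. Its ratio is identified in \<open>pf_M\<close> as the Perron-Frobenius
  eigenvalue.\<close>

lemma r_pos: "0 < r" and len_r: "len (rv T (k * N)) $ a = r * len (rv T (Suc k * N)) $ a"
proof -
  have "\<exists>R>0. \<forall>k a. len (rv T (k * N)) $ a = R * len (rv T (Suc k * N)) $ a"
    using backward_orbit_eigenvector[of "\<lambda>a b. M $ a $ b" "\<lambda>k a. len (rv T (k * N)) $ a",
        OF M_pos len_pos[OF aiet_rv] len_recursion] .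
  then have "r > 0 \<and> (\<forall>k a. len (rv T (k * N)) $ a = r * len (rv T (Suc k * N)) $ a)"
    unfolding r_def by (rule someI_ex)
  then show "0 < r" "len (rv T (k * N)) $ a = r * len (rv T (Suc k * N)) $ a" by blast+
qed

lemma len_rvN: "len (rv T N) $ a = len T $ a / r"
  using len_r[of 0 a] r_pos by (simp add: rv_0 field_simps)

lemma left_eigenvector: "(\<Sum>a\<in>UNIV. len T $ a * M $ a $ b) = r * len T $ b"
proof -
  have "len T $ b = (\<Sum>a\<in>UNIV. len T $ a / r * M $ a $ b)"
    using len_recursion[of 0 b] by (simp add: rv_0 len_rvN)
  then have "r * len T $ b = (\<Sum>a\<in>UNIV. r * (len T $ a / r * M $ a $ b))"
    by (simp add: sum_distrib_left)
  then show ?thesis using r_pos by simp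
qed

lemma pf_M: "pf_eigenvalue M = r"
  by (rule pf_eigenvalue_eqI[of _ "\<lambda>a. len T $ a"])
    (use M_pos less_imp_le len_pos[OF f] left_eigenvector pp in \<open>auto simp: positive_period_def\<close>)

lemma M_ge_1: "1 \<le> M $ a $ b"
  using M_pos[of a b] by (simp add: M_eq)

lemma ex_other: "\<exists>c::'a. c \<noteq> a"
proof (rule ccontr)
  assume "\<nexists>c. c \<noteq> a"
  then have "UNIV = {a}" by auto
  then have "CARD('a) = card {a}" by metis
  then show False using d by simp
qed

text \<open>The entries of \<open>M\<close> are at least 1, so by the eigenvector equation
  \<open>r\<close> times one length is at least the total length, and there is more than one
  letter.\<close>

lemma r_gt_1: "1 < r"
proof -
  obtain c :: 'a where c: "c \<noteq> undefined" using ex_other by blast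
  have "len T $ undefined < len T $ undefined + len T $ c" using len_pos[OF f] by simp
  also have "\<dots> = sum (\<lambda>a. len T $ a) {undefined, c}" using c by simp
  also have "\<dots> \<le> (\<Sum>a\<in>UNIV. len T $ a)"
    by (intro sum_mono2) (auto simp: less_imp_le len_pos[OF f])
  also have "\<dots> \<le> (\<Sum>a\<in>UNIV. len T $ a * M $ a $ undefined)"
    using M_ge_1 len_pos[OF f] by (intro sum_mono) (simp add: less_imp_le)
  also have "\<dots> = r * len T $ undefined" by (rule left_eigenvector)
  finally show ?thesis using len_pos[OF f, of undefined] by simp
qed

lemma rho_eq: "rho T N = ln r"
  by (simp add: rho_def pf_M)

lemma rho_pos: "0 < rho T N"
  using r_gt_1 by (simp add: rho_eq)

lemma perm_rvN: "ptop (rv T N) = ptop T" "pbot (rv T N) = pbot T"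
  using rot_period[of 1 0] by (auto simp: rotation_number_def rv_0)

lemma top_left_rvN: "top_left (rv T N) a = top_left T a / r"
  by (simp add: top_left_def perm_rvN len_rvN sum_divide_distrib)

lemma bot_left_rvN: "bot_left (rv T N) a = bot_left T a / r"
  by (simp add: bot_left_def image_len_def perm_rvN len_rvN sum_divide_distrib slope_T slope_rv_0)

text \<open>After a period the permutations have returned and all lengths are divided by
  \<open>r\<close>: \<open>rv T N\<close> is \<open>T\<close> on the scale
  \<open>1 / r\<close>.\<close>

lemma ivl_rvN: "x / r \<in> ivl (rv T N) a \<longleftrightarrow> x \<in> ivl T a"
  using r_pos by (simp add: ivl_def top_left_rvN len_rvN add_divide_distrib[symmetric] divide_le_cancel divide_less_cancel)

lemma ivl_rvN': "x \<in> ivl (rv T N) a \<longleftrightarrow> r * x \<in> ivl T a"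
  using ivl_rvN[of "r * x" a] r_pos by simp

lemma amap_T: "x \<in> ivl T a \<Longrightarrow> amap T x = bot_left T a + (x - top_left T a)"
  using amap_ivl[OF f] by (simp add: slope_T)

lemma amap_rvN:
  assumes "x \<in> ivl T a"
  shows "amap (rv T N) (x / r) = amap T x / r"
  using amap_ivl[OF aiet_rv, of "x / r" N a] assms
  by (simp add: ivl_rvN slope_rv_0 slope_T bot_left_rvN top_left_rvN amap_T diff_divide_distrib add_divide_distrib)

text \<open>The branches of a graph-directed iterated function system whose level \<open>n\<close> cylinders are the
  floors of the level \<open>n\<close> Rauzy--Veech towers.\<close>

definition branch :: "'a \<times> nat \<Rightarrow> real \<Rightarrow> real" where
  "branch s x = (amap T ^^ snd s) (x / r)"

abbreviation "idx \<equiv> tower_index T N"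
abbreviation "bl \<equiv> floor_letter T N"

lemma idx_iff: "s \<in> idx \<longleftrightarrow> snd s < length (W (fst s))"
  by (cases s) (simp add: tower_index_eq)

lemma bl_eq: "s \<in> idx \<Longrightarrow> bl s = W (fst s) ! snd s"
  by (cases s) (simp add: idx_iff floor_letter_eq)

lemma finite_idx: "finite idx"
proof -
  have "idx = Sigma UNIV (\<lambda>a. {..<length (W a)})" by (auto simp: idx_iff)
  then show ?thesis by simp
qed

lemma branch_in: "s \<in> idx \<Longrightarrow> x \<in> ivl T (fst s) \<Longrightarrow> branch s x \<in> ivl T (bl s)"
  unfolding branch_def using tower(1)[of "x / r" N "fst s" "snd s"]
  by (simp add: ivl_rvN bl_eq idx_iff)

lemma pow_diff:
  assumes "x \<in> ivl (rv T n) a" "y \<in> ivl (rv T n) a" "i \<le> length (word T n a)"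
  shows "(amap T ^^ i) y - (amap T ^^ i) x = y - x"
  using assms(3)
proof (induction i)
  case (Suc i)
  then have "(amap T ^^ i) x \<in> ivl T (word T n a ! i)" "(amap T ^^ i) y \<in> ivl T (word T n a ! i)"
    using tower(1) assms by auto
  then show ?case using Suc amap_ivl_diff[OF f] by (simp add: slope_T)
qed simp

lemma branch_diff:
  assumes "s \<in> idx" "x \<in> ivl T (fst s)" "y \<in> ivl T (fst s)"
  shows "branch s y - branch s x = (y - x) / r"
  using pow_diff[of "x / r" N "fst s" "y / r" "snd s"] assms
  by (simp add: branch_def ivl_rvN idx_iff diff_divide_distrib)

lemma branch_cover:
  assumes "y \<in> {0..<1}"
  shows "\<exists>s\<in>idx. \<exists>x\<in>ivl T (fst s). y = branch s x"
proof -
  obtain a x i where x: "x \<in> ivl (rv T N) a" "i < length (W a)" "y = (amap T ^^ i) x"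
    using tower_cover[of y N] assms dom_T by blast
  then have "r * x \<in> ivl T a" "(a, i) \<in> idx" by (auto simp: ivl_rvN' idx_iff)
  moreover have "y = branch (a, i) (r * x)" using x r_pos by (simp add: branch_def)
  ultimately show ?thesis by force
qed

lemma branch_unique:
  assumes "s \<in> idx" "x \<in> ivl T (fst s)" "s' \<in> idx" "y \<in> ivl T (fst s')" "branch s x = branch s' y"
  shows "s = s' \<and> x = y"
proof -
  have "x / r = y / r \<and> snd s = snd s' \<and> fst s = fst s'"
    by (rule tower_unique) (use assms in \<open>auto simp: ivl_rvN idx_iff branch_def\<close>)
  then show ?thesis using r_pos by (auto simp: prod_eq_iff)
qed

lemma return_T: "x \<in> ivl T a \<Longrightarrow> (amap T ^^ length (W a)) (x / r) = amap T x / r"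
  using tower(3)[of "x / r" N a] by (simp add: ivl_rvN amap_rvN)

lemma ex_idx: "\<exists>s\<in>idx. fst s = a \<and> bl s = b"
proof -
  obtain i where "i < length (W a)" "W a ! i = b" using letter_in_W[of b a] by (auto simp: in_set_conv_nth)
  then show ?thesis by (intro bexI[of _ "(a, i)"]) (auto simp: idx_iff floor_letter_eq)
qed

lemma ivl_Un: "\<Union>(range (ivl T)) = {0..<1}"
proof (intro equalityI subsetI)
  fix x assume "x \<in> \<Union>(range (ivl T))"
  then obtain a where "x \<in> ivl T a" by auto
  then show "x \<in> {0..<1}" using ivl_subset_dom[OF f, of a] dom_T by auto
next
  fix x :: real assume "x \<in> {0..<1}"
  then show "x \<in> \<Union>(range (ivl T))" using ivl_cover[OF f, of x] unfolding dom_T by auto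
qed

lemma floor_eq: "tower_floor T N s = branch s ` ivl T (fst s)"
proof -
  have "ivl (rv T N) a = (\<lambda>x. x / r) ` ivl T a" for a
    using r_pos by (auto simp: ivl_rvN' intro!: image_eqI[of _ _ "r * _"])
  then show ?thesis by (cases s) (auto simp: tower_floor_def branch_def image_image)
qed

text \<open>A positive break common to both partitions is never cut off, so it is a common break of
  \<open>rv T N\<close>; multiplied by \<open>r\<close> it is again a common break of
  \<open>T\<close>. Repetition would push breaks beyond 1.\<close>

lemma no_common_break:
  assumes "top_left T a = bot_left T c"
  shows "top_left T a = 0"
proof (rule ccontr)
  assume "top_left T a \<noteq> 0"
  then have pos: "0 < top_left T a" using top_left_nonneg[OF f, of a] by simp
  have *: "\<exists>a c. r ^ k * top_left T a0 = top_left T a \<and> top_left T a = bot_left T c"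
    if "top_left T a0 = bot_left T c_nonzero" "0 < top_left T a0" for k a0 c_nonzero
  proof (induction k)
    case 0
    show ?case using that(1) by (intro exI[of _ a0] exI[of _ c_nonzero]) simp
  next
    case (Suc k)
    then obtain a c where ac: "r ^ k * top_left T a0 = top_left T a" "top_left T a = bot_left T c" by blast
    moreover from this have "0 < top_left T a" using that(2) r_pos by (metis zero_less_mult_iff zero_less_power)
    ultimately obtain a' c' where "top_left (rv T N) a' = top_left T a" "bot_left (rv T N) c' = top_left T a"
      using common_break_rv[of a c N] by blast
    then have "top_left T a' = r * top_left T a" "bot_left T c' = r * top_left T a"
      using r_pos by (auto simp: top_left_rvN bot_left_rvN field_simps)
    then show ?case using ac by (intro exI[of _ a'] exI[of _ c']) (simp add: mult.assoc)
  qed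
  have le: "r ^ k * top_left T a \<le> 1" for k
  proof -
    obtain a' where "r ^ k * top_left T a = top_left T a'" using *[OF assms pos, of k] by blast
    then show ?thesis using top_right_le[OF f, of a'] len_pos[OF f, of a'] tot_T by simp
  qed
  obtain k where "1 / top_left T a < r ^ k" using real_arch_pow[OF r_gt_1] by blast
  then show False using le[of k] pos by (simp add: field_simps)
qed

end

section \<open>Conformal measures of cylinders\<close>

text \<open>The part of conformality that is used: how masses of sets inside one interval transform.
  The total mass is left free so that \<open>scl m\<close> inherits the property, and the image of
  Lebesgue measure can be checked directly.\<close>

definition conf :: "'a::finite aiet \<Rightarrow> real ^ 'a \<Rightarrow> real measure \<Rightarrow> bool" where
  "conf T v m \<longleftrightarrow> finite_measure m \<and> sets m = sets borel \<and>
     (\<forall>a. \<forall>A\<in>sets borel. A \<subseteq> ivl T a \<longrightarrow> measure m (amap T ` A) = exp (v $ a) * measure m A)"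

lemma ivl_borel [simp]: "ivl f a \<in> sets borel"
  by (simp add: ivl_def)

lemma affine_vimage_borel:
  assumes "A \<in> sets borel"
  shows "(\<lambda>y::real. (y - b) * e + t) -` A \<in> sets borel"
proof -
  have "(\<lambda>y::real. (y - b) * e + t) \<in> borel_measurable borel" by measurable
  from measurable_sets[OF this assms] show ?thesis by simp
qed

lemma amap_image_borel:
  assumes f: "is_aiet f" and A: "A \<in> sets borel" "A \<subseteq> ivl f a"
  shows "amap f ` A \<in> sets borel"
proof -
  let ?g = "\<lambda>y. (y - bot_left f a) * exp (- slope f $ a) + top_left f a"
  have 1: "?g (amap f x) = x" if "x \<in> ivl f a" for x
    using amap_ivl[OF f that] by (simp add: exp_minus field_simps)
  have "amap f ` A = ?g -` A"
  proof (intro equalityI subsetI)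
    fix y assume y: "y \<in> ?g -` A"
    then have "?g y \<in> ivl f a" using A(2) by auto
    from amap_ivl[OF f this] have "amap f (?g y) = y" by (simp add: exp_minus field_simps)
    then show "y \<in> amap f ` A" using y by (metis imageI vimageD)
  next
    fix y assume "y \<in> amap f ` A"
    then obtain x where "x \<in> A" "y = amap f x" by auto
    then show "y \<in> ?g -` A" using 1[of x] A(2) by auto
  qed
  then show ?thesis using affine_vimage_borel[OF A(1)] by simp
qed

text \<open>The push-forward under the inverse gives a set the mass of its image, and inside one
  interval the density is constant.\<close>

lemma conf_conformal:
  assumes f: "is_aiet T" and c: "conformal_measure T v \<nu>"
  shows "conf T v \<nu>" "measure \<nu> {0..<1} = 1"
proof -
  have sets: "sets \<nu> = sets borel" and U: "emeasure \<nu> UNIV = 1" and I: "emeasure \<nu> {0..<1} = 1"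
    and eq: "distr \<nu> borel (inv (amap T)) = density \<nu> (\<lambda>x. ennreal (exp (phi T v x)))"
    using c by (auto simp: conformal_measure_def)
  have space: "space \<nu> = UNIV" using sets_eq_imp_space_eq[OF sets] by simp
  interpret finite_measure \<nu> by (rule finite_measureI) (simp add: space U)
  show "measure \<nu> {0..<1} = 1" using I by (simp add: measure_def)
  have dom: "dom_ivl T \<in> sets borel" by (simp add: dom_ivl_def)
  \<comment> \<open>A Borel set is split along the intervals, on each of which the map is affine;
    outside the domain the map is the identity.\<close>
  have img: "amap T ` A \<in> sets borel" if A: "A \<in> sets borel" for A
  proof -
    have "A \<subseteq> (\<Union>a. A \<inter> ivl T a) \<union> (A - dom_ivl T)" using ivl_cover[OF f] by auto
    then have "A = (\<Union>a. A \<inter> ivl T a) \<union> (A - dom_ivl T)" by auto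
    then have "amap T ` A = amap T ` ((\<Union>a. A \<inter> ivl T a) \<union> (A - dom_ivl T))" by (rule arg_cong)
    also have "\<dots> = (\<Union>a. amap T ` (A \<inter> ivl T a)) \<union> amap T ` (A - dom_ivl T)"
      by (simp only: image_Un image_UN)
    also have "amap T ` (A - dom_ivl T) = A - dom_ivl T"
      by (rule trans[OF image_cong[OF refl, of _ _ "\<lambda>x. x"]]) (auto simp: amap_outside[OF f])
    finally have e: "amap T ` A = (\<Union>a. amap T ` (A \<inter> ivl T a)) \<union> (A - dom_ivl T)" .
    have "amap T ` (A \<inter> ivl T a) \<in> sets borel" for a
      by (rule amap_image_borel[OF f, of _ a]) (use A in auto)
    then show ?thesis unfolding e using A dom
      by (intro sets.Un sets.finite_UN sets.Diff) auto
  qed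
  have inv: "inv (amap T) -` A = amap T ` A" for A
    using bij_vimage_eq_inv_image[OF bij_imp_bij_inv[OF bij_amap[OF f]]] bij_amap[OF f]
    by (simp add: inv_inv_eq)
  have mi: "inv (amap T) \<in> measurable \<nu> borel"
    by (rule measurableI) (auto simp: space inv sets img)
  have phi: "phi T v x = (\<Sum>a\<in>UNIV. v $ a * indicator (ivl T a) x)" for x
  proof (cases "x \<in> dom_ivl T")
    case True
    then obtain a where a: "x \<in> ivl T a" using ivl_cover[OF f] by blast
    have "(\<Sum>c\<in>UNIV. v $ c * indicator (ivl T c) x) = (\<Sum>c\<in>UNIV. if c = a then v $ a else 0)"
      using a ivl_unique[OF f] by (intro sum.cong) (auto simp: indicator_def)
    then show ?thesis using True letter_at_ivl[OF f a] by (simp add: phi_def)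
  next
    case False
    then have "indicator (ivl T c) x = (0::real)" for c using ivl_subset_dom[OF f] by (auto simp: indicator_def)
    then show ?thesis using False by (simp add: phi_def)
  qed
  have mphi: "phi T v \<in> borel_measurable \<nu>"
    unfolding phi using sets by (intro borel_measurable_sum borel_measurable_times borel_measurable_const borel_measurable_indicator) auto
  show "conf T v \<nu>"
    unfolding conf_def
  proof (intro conjI allI ballI impI)
    show "finite_measure \<nu>" by unfold_locales
    show "sets \<nu> = sets borel" by (rule sets)
    fix a and A :: "real set" assume A: "A \<in> sets borel" "A \<subseteq> ivl T a"
    have "emeasure \<nu> (amap T ` A) = emeasure (distr \<nu> borel (inv (amap T))) A"
      using A by (simp add: emeasure_distr[OF mi] inv space)
    also have "\<dots> = (\<integral>\<^sup>+x. ennreal (exp (phi T v x)) * indicator A x \<partial>\<nu>)"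
      unfolding eq using A sets mphi by (intro emeasure_density) auto
    also have "\<dots> = (\<integral>\<^sup>+x. ennreal (exp (v $ a)) * indicator A x \<partial>\<nu>)"
    proof (intro nn_integral_cong)
      fix x
      show "ennreal (exp (phi T v x)) * indicator A x = ennreal (exp (v $ a)) * indicator A x"
      proof (cases "x \<in> A")
        case True
        then have "x \<in> ivl T a" using A by auto
        then have "phi T v x = v $ a" using ivl_subset_dom[OF f] by (auto simp: phi_def letter_at_ivl[OF f])
        then show ?thesis by simp
      qed simp
    qed
    also have "\<dots> = ennreal (exp (v $ a)) * emeasure \<nu> A"
      using A sets by (intro nn_integral_cmult_indicator) auto
    finally show "measure \<nu> (amap T ` A) = exp (v $ a) * measure \<nu> A"
      by (simp add: measure_def enn2real_mult)
  qed
qed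

lemma sum_count_list:
  fixes v :: "'a::finite \<Rightarrow> real"
  shows "(\<Sum>b\<in>UNIV. real (count_list xs b) * v b) = (\<Sum>j<length xs. v (xs ! j))"
proof (induction xs rule: rev_induct)
  case (snoc x xs)
  have "(\<Sum>b\<in>UNIV. real (count_list (xs @ [x]) b) * v b) =
      (\<Sum>b\<in>UNIV. real (count_list xs b) * v b + (if b = x then v x else 0))"
    by (intro sum.cong) (auto simp: algebra_simps)
  also have "\<dots> = (\<Sum>j<length xs. v (xs ! j)) + v x"
    by (simp add: sum.distrib snoc)
  also have "(\<Sum>j<length xs. v (xs ! j)) = (\<Sum>j<length xs. v ((xs @ [x]) ! j))"
    by (intro sum.cong) (auto simp: nth_append)
  finally show ?case by simp
qed simp

section \<open>Rescaling of conformal measures\<close>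

context selfsim
begin

abbreviation into :: "'a \<Rightarrow> ('a \<times> nat) set" where
  "into b \<equiv> {s \<in> idx. bl s = b}"

text \<open>The Birkhoff sum of \<open>v\<close> from the base of the tower over
  \<open>fst s\<close> up to floor \<open>s\<close>, that floor excluded.\<close>

definition \<sigma> :: "real ^ 'a \<Rightarrow> 'a \<times> nat \<Rightarrow> real" where
  "\<sigma> v s = (\<Sum>j<snd s. v $ (W (fst s) ! j))"

definition scl :: "real measure \<Rightarrow> real measure" where
  "scl m = distr m borel (\<lambda>x. r * x)"

lemma M_mult: "(M *v v) $ a = (\<Sum>j<length (W a). v $ (W a ! j))"
  using sum_count_list[of "W a" "\<lambda>b. v $ b"] by (simp add: matrix_vector_mult_def M_eq)

lemma div_image: "(\<lambda>x. x / r) ` A = (\<lambda>x. r * x) -` A"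
  using r_pos by (force simp: image_iff)

lemma div_image_borel: "A \<in> sets borel \<Longrightarrow> (\<lambda>x. x / r) ` A \<in> sets borel"
  using affine_vimage_borel[of A 0 r 0] by (simp add: div_image mult.commute)

lemma pow_borel_measure:
  assumes m: "conf T v m" and A: "A \<in> sets borel" "A \<subseteq> ivl (rv T N) a" and "i \<le> length (W a)"
  shows "(amap T ^^ i) ` A \<in> sets borel \<and>
    measure m ((amap T ^^ i) ` A) = exp (\<Sum>j<i. v $ (W a ! j)) * measure m A"
  using assms(4)
proof (induction i)
  case (Suc i)
  then have IH: "(amap T ^^ i) ` A \<in> sets borel"
    "measure m ((amap T ^^ i) ` A) = exp (\<Sum>j<i. v $ (W a ! j)) * measure m A" by auto
  have sub: "(amap T ^^ i) ` A \<subseteq> ivl T (W a ! i)" using tower(1)[of _ N a i] Suc.prems A by auto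
  have e: "(amap T ^^ Suc i) ` A = amap T ` ((amap T ^^ i) ` A)" by (simp add: image_comp)
  have "measure m (amap T ` ((amap T ^^ i) ` A)) = exp (v $ (W a ! i)) * measure m ((amap T ^^ i) ` A)"
    using m sub IH(1) by (auto simp: conf_def)
  then show ?case unfolding e using amap_image_borel[OF f IH(1) sub] IH(2) by (simp add: exp_add)
qed (use A in simp)

lemma scl_measure:
  assumes "sets m = sets borel" "A \<in> sets borel"
  shows "measure (scl m) A = measure m ((\<lambda>x. x / r) ` A)"
  unfolding scl_def div_image using assms sets_eq_imp_space_eq[OF assms(1)]
  by (subst measure_distr) auto

lemma branch_image: "branch s ` A = (amap T ^^ snd s) ` ((\<lambda>x. x / r) ` A)"
  by (simp add: branch_def image_image)

lemma div_image_sub: "A \<subseteq> ivl T a \<Longrightarrow> (\<lambda>x. x / r) ` A \<subseteq> ivl (rv T N) a"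
  by (auto simp: ivl_rvN)

lemma branch_measure:
  assumes m: "conf T v m" and s: "s \<in> idx" and A: "A \<in> sets borel" "A \<subseteq> ivl T (fst s)"
  shows "branch s ` A \<in> sets borel" "measure m (branch s ` A) = exp (\<sigma> v s) * measure (scl m) A"
proof -
  have "snd s \<le> length (W (fst s))" using s by (simp add: idx_iff)
  from pow_borel_measure[OF m div_image_borel[OF A(1)] div_image_sub[OF A(2)] this]
  show "branch s ` A \<in> sets borel" "measure m (branch s ` A) = exp (\<sigma> v s) * measure (scl m) A"
    using scl_measure[of m A] m A by (auto simp: branch_image \<sigma>_def conf_def)
qed

text \<open>The return to the inducing interval multiplies masses by the exponential of the Birkhoff
  sum over a whole tower, which is an entry of \<open>M *v v\<close>. Renormalization thus acts on
  log-slopes by \<open>M\<close>.\<close>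

lemma conf_scl:
  assumes m: "conf T v m"
  shows "conf T (M *v v) (scl m)"
  unfolding conf_def
proof (intro conjI allI ballI impI)
  have sm: "sets m = sets borel" and fm: "finite_measure m" using m by (auto simp: conf_def)
  show "finite_measure (scl m)"
    unfolding scl_def using fm sm by (intro finite_measure.finite_measure_distr) auto
  show "sets (scl m) = sets borel" by (simp add: scl_def)
  fix a and A :: "real set" assume A: "A \<in> sets borel" "A \<subseteq> ivl T a"
  have "(\<lambda>x. x / r) ` amap T ` A = (amap T ^^ length (W a)) ` (\<lambda>x. x / r) ` A"
    using return_T[of _ a] A(2) by (auto simp: image_image intro!: image_cong)
  then have "measure (scl m) (amap T ` A) = measure m ((amap T ^^ length (W a)) ` (\<lambda>x. x / r) ` A)"
    using scl_measure[OF sm amap_image_borel[OF f A]] by simp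
  also have "\<dots> = exp ((M *v v) $ a) * measure m ((\<lambda>x. x / r) ` A)"
    using pow_borel_measure[OF m div_image_borel[OF A(1)] div_image_sub[OF A(2)] order_refl]
    by (simp add: M_mult)
  finally show "measure (scl m) (amap T ` A) = exp ((M *v v) $ a) * measure (scl m) A"
    using scl_measure[OF sm A(1)] by simp
qed

section \<open>Paths and their cylinders\<close>

primrec adm :: "'a \<Rightarrow> ('a \<times> nat) list \<Rightarrow> bool" where
  "adm b [] \<longleftrightarrow> True"
| "adm b (s # p) \<longleftrightarrow> s \<in> idx \<and> bl s = b \<and> adm (fst s) p"

text \<open>A path descends from \<open>b\<close>: an edge \<open>s\<close> leads from the letter
  \<open>bl s\<close> whose interval contains the floor to the letter \<open>fst s\<close> of the
  tower. Branches go the opposite way, so a longer path gives a smaller set inside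
  \<open>ivl T b\<close>.\<close>

primrec cyl :: "'a \<Rightarrow> ('a \<times> nat) list \<Rightarrow> real set" where
  "cyl b [] = ivl T b"
| "cyl b (s # p) = branch s ` cyl (fst s) p"

primrec endl :: "'a \<Rightarrow> ('a \<times> nat) list \<Rightarrow> 'a" where
  "endl b [] = b"
| "endl b (s # p) = endl (fst s) p"

definition adms :: "'a \<Rightarrow> nat \<Rightarrow> ('a \<times> nat) list set" where
  "adms b n = {p. adm b p \<and> length p = n}"

lemma adms_0: "adms b 0 = {[]}"
  by (auto simp: adms_def)

lemma adms_Suc: "adms b (Suc n) = (\<Union>s\<in>into b. (#) s ` adms (fst s) n)"
  by (auto simp: adms_def length_Suc_conv image_iff)

lemma finite_adms: "finite (adms b n)"
  by (induction n arbitrary: b) (simp_all add: adms_0 adms_Suc finite_idx)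

lemma sum_adms_Suc:
  fixes g :: "('a \<times> nat) list \<Rightarrow> real"
  shows "(\<Sum>p\<in>adms b (Suc n). g p) = (\<Sum>s\<in>into b. \<Sum>p\<in>adms (fst s) n. g (s # p))"
proof -
  have "(\<Sum>p\<in>adms b (Suc n). g p) = (\<Sum>s\<in>into b. sum g ((#) s ` adms (fst s) n))"
    unfolding adms_Suc by (rule sum.UNION_disjoint) (auto simp: finite_idx finite_adms)
  then show ?thesis by (simp add: sum.reindex)
qed

lemma cyl_interval:
  "adm b p \<Longrightarrow> cyl b p \<subseteq> ivl T b \<and> (\<exists>c. cyl b p = {c..<c + len T $ endl b p / r ^ length p})"
proof (induction p arbitrary: b)
  case Nil
  then show ?case by (auto simp: ivl_def)
next
  case (Cons s p)
  then have s: "s \<in> idx" "bl s = b" and IH: "cyl (fst s) p \<subseteq> ivl T (fst s)" by auto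
  obtain c where c: "cyl (fst s) p = {c..<c + len T $ endl (fst s) p / r ^ length p}"
    using Cons.IH[of "fst s"] Cons.prems by auto
  let ?l = "len T $ endl (fst s) p / r ^ length p"
  have "0 < ?l" using len_pos[OF f] r_pos by simp
  then have cin: "c \<in> ivl T (fst s)" using IH c by auto
  have "branch s ` cyl (fst s) p = {branch s c..<branch s c + ?l / r}"
  proof (intro equalityI subsetI)
    fix y assume "y \<in> branch s ` cyl (fst s) p"
    then obtain x where x: "x \<in> cyl (fst s) p" "y = branch s x" by auto
    then have "y = branch s c + (x - c) / r" using branch_diff[OF s(1) cin, of x] IH by auto
    then show "y \<in> {branch s c..<branch s c + ?l / r}" using x(1) r_pos by (auto simp: c divide_less_cancel simp del: divide_divide_eq_left)
  next
    fix y assume y: "y \<in> {branch s c..<branch s c + ?l / r}"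
    let ?x = "c + r * (y - branch s c)"
    have "r * (y - branch s c) < r * (?l / r)" using y r_pos by (intro mult_strict_left_mono) auto
    then have x: "?x \<in> cyl (fst s) p" using y r_pos by (simp add: c)
    then have "branch s ?x = y" using branch_diff[OF s(1) cin, of ?x] IH r_pos by auto
    then show "y \<in> branch s ` cyl (fst s) p" using x by (metis imageI)
  qed
  moreover have "branch s ` cyl (fst s) p \<subseteq> ivl T b" using branch_in[OF s(1)] s(2) IH by auto
  ultimately show ?case by (auto simp: mult.commute)
qed

lemma cyl_sub: "adm b p \<Longrightarrow> cyl b p \<subseteq> ivl T b"
  using cyl_interval by blast

lemma cyl_borel: "adm b p \<Longrightarrow> cyl b p \<in> sets borel"
  using cyl_interval[of b p] by auto

lemma cyl_cover: "x \<in> ivl T b \<Longrightarrow> \<exists>p\<in>adms b n. x \<in> cyl b p"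
proof (induction n arbitrary: b x)
  case 0
  then show ?case by (simp add: adms_0)
next
  case (Suc n)
  then have "x \<in> {0..<1}" using ivl_Un by auto
  then obtain s y where s: "s \<in> idx" "y \<in> ivl T (fst s)" "x = branch s y" using branch_cover by blast
  then have "bl s = b" using branch_in Suc.prems ivl_unique[OF f] by blast
  moreover obtain p where "p \<in> adms (fst s) n" "y \<in> cyl (fst s) p" using Suc.IH[OF s(2)] by blast
  ultimately have "s # p \<in> adms b (Suc n)" "x \<in> cyl b (s # p)" using s by (auto simp: adms_def)
  then show ?case by blast
qed

lemma cyl_disjoint:
  "p \<in> adms b n \<Longrightarrow> p' \<in> adms b' n \<Longrightarrow> x \<in> cyl b p \<Longrightarrow> x \<in> cyl b' p' \<Longrightarrow> b = b' \<and> p = p'"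
proof (induction n arbitrary: b b' x p p')
  case 0
  then show ?case using ivl_unique[OF f] by (simp add: adms_0)
next
  case (Suc n)
  obtain s q where p: "p = s # q" "s \<in> idx" "bl s = b" "q \<in> adms (fst s) n"
    using Suc.prems(1) unfolding adms_Suc by auto
  obtain s' q' where p': "p' = s' # q'" "s' \<in> idx" "bl s' = b'" "q' \<in> adms (fst s') n"
    using Suc.prems(2) unfolding adms_Suc by auto
  obtain y where y: "y \<in> cyl (fst s) q" "x = branch s y" using Suc.prems(3) p by auto
  obtain y' where y': "y' \<in> cyl (fst s') q'" "x = branch s' y'" using Suc.prems(4) p' by auto
  have "y \<in> ivl T (fst s)" "y' \<in> ivl T (fst s')" using y y' cyl_sub p p' by (auto simp: adms_def)
  then have "s = s'" "y = y'" using branch_unique[of s y s' y'] y y' p p' by auto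
  then show ?case using Suc.IH[OF p(4), of q' "fst s" y] p p' y y' by auto
qed

lemma measure_ivl_adms:
  assumes m: "finite_measure m" "sets m = sets borel"
  shows "measure m (ivl T b) = (\<Sum>p\<in>adms b n. measure m (cyl b p))"
proof -
  have "ivl T b = (\<Union>p\<in>adms b n. cyl b p)"
    using cyl_cover[of _ b n] cyl_sub by (fastforce simp: adms_def)
  moreover have "measure m (\<Union>p\<in>adms b n. cyl b p) = (\<Sum>p\<in>adms b n. measure m (cyl b p))"
  proof (rule finite_measure.finite_measure_finite_Union[OF m(1) finite_adms])
    show "cyl b ` adms b n \<subseteq> sets m" using cyl_borel m(2) by (auto simp: adms_def)
    show "disjoint_family_on (cyl b) (adms b n)"
      unfolding disjoint_family_on_def using cyl_disjoint by blast
  qed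
  ultimately show ?thesis by simp
qed

lemma measure_unit_ivl:
  assumes m: "finite_measure m" "sets m = sets borel"
  shows "measure m {0..<1} = (\<Sum>b\<in>UNIV. measure m (ivl T b))"
  unfolding ivl_Un[symmetric]
proof (rule finite_measure.finite_measure_finite_Union[OF m(1)])
  show "disjoint_family_on (ivl T) UNIV"
    unfolding disjoint_family_on_def
  proof (intro ballI impI)
    fix a b :: 'a assume "a \<noteq> b"
    then show "ivl T a \<inter> ivl T b = {}" using ivl_unique[OF f, of _ a b] by auto
  qed
  show "range (ivl T) \<subseteq> sets m" unfolding m(2) by (rule image_subsetI) simp
qed simp

definition sqsum :: "real measure \<Rightarrow> nat \<Rightarrow> real" where
  "sqsum m n = (\<Sum>b\<in>UNIV. \<Sum>p\<in>adms b n. (measure m (cyl b p))\<^sup>2)"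

text \<open>Logarithm of the factor by which masses change along the cylinder. Each edge passes to
  the rescaled measure, hence from \<open>v\<close> to \<open>M *v v\<close>.\<close>

primrec wt :: "real ^ 'a \<Rightarrow> ('a \<times> nat) list \<Rightarrow> real" where
  "wt v [] = 0"
| "wt v (s # p) = \<sigma> v s + wt (M *v v) p"

lemma measure_cyl:
  assumes "conf T v m" "adm b p"
  shows "measure m (cyl b p) = exp (wt v p) * measure ((scl ^^ length p) m) (ivl T (endl b p))"
  using assms
proof (induction p arbitrary: b m v)
  case (Cons s p)
  then have p: "adm (fst s) p" and s: "s \<in> idx" by auto
  have "measure m (cyl b (s # p)) = exp (\<sigma> v s) * measure (scl m) (cyl (fst s) p)"
    using branch_measure(2)[OF Cons.prems(1) s cyl_borel[OF p] cyl_sub[OF p]] by simp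
  also have "measure (scl m) (cyl (fst s) p) = exp (wt (M *v v) p) * measure ((scl ^^ length p) (scl m)) (ivl T (endl (fst s) p))"
    using Cons.IH[OF conf_scl[OF Cons.prems(1)] p] .
  finally show ?case by (simp add: exp_add funpow_swap1)
qed simp

lemma conf_scl_pow: "conf T v m \<Longrightarrow> conf T (((*v) M ^^ k) v) ((scl ^^ k) m)"
  by (induction k) (auto intro: conf_scl)

lemma measure_ivl_step:
  assumes "conf T v m"
  shows "measure m (ivl T b) = (\<Sum>s\<in>into b. exp (\<sigma> v s) * measure (scl m) (ivl T (fst s)))"
proof -
  have "measure m (ivl T b) = (\<Sum>p\<in>adms b (Suc 0). measure m (cyl b p))"
    using measure_ivl_adms assms by (auto simp: conf_def)
  also have "\<dots> = (\<Sum>s\<in>into b. measure m (branch s ` ivl T (fst s)))"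
    unfolding sum_adms_Suc by (simp add: adms_0)
  also have "\<dots> = (\<Sum>s\<in>into b. exp (\<sigma> v s) * measure (scl m) (ivl T (fst s)))"
    by (intro sum.cong) (use branch_measure(2)[OF assms] in auto)
  finally show ?thesis .
qed

lemma \<sigma>_add: "\<sigma> (v + w) s = \<sigma> v s + \<sigma> w s"
  by (simp add: \<sigma>_def sum.distrib)

lemma wt_add: "wt (v + w) p = wt v p + wt w p"
  by (induction p arbitrary: v w) (auto simp: \<sigma>_add matrix_vector_right_distrib)

lemma \<sigma>_bound: "\<exists>Q\<ge>0. \<forall>v. \<forall>s\<in>idx. \<bar>\<sigma> v s\<bar> \<le> Q * norm v"
proof -
  define Q where "Q = real (Max (snd ` idx))"
  have "\<bar>\<sigma> v s\<bar> \<le> Q * norm v" if s: "s \<in> idx" for v s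
  proof -
    have "\<bar>\<sigma> v s\<bar> \<le> (\<Sum>j<snd s. \<bar>v $ (W (fst s) ! j)\<bar>)" unfolding \<sigma>_def by (rule sum_abs)
    also have "\<dots> \<le> (\<Sum>j<snd s. norm v)"
      by (intro sum_mono) (metis component_le_norm_cart real_norm_def)
    also have "\<dots> = real (snd s) * norm v" by simp
    also have "\<dots> \<le> Q * norm v"
      unfolding Q_def using s finite_idx by (intro mult_right_mono) auto
    finally show ?thesis .
  qed
  then show ?thesis by (intro exI[of _ Q]) (auto simp: Q_def)
qed

text \<open>The edge at depth \<open>k\<close> contributes at most a constant times the norm of the
  \<open>k\<close>-th iterate of \<open>v\<close> under \<open>M\<close>, and these norms are
  summable.\<close>

lemma wt_bound:
  assumes "v \<in> contracting_space M"
  shows "\<exists>K. \<forall>b p. adm b p \<longrightarrow> \<bar>wt v p\<bar> \<le> K"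
proof -
  obtain Q where Q: "0 \<le> Q" "\<And>v s. s \<in> idx \<Longrightarrow> \<bar>\<sigma> v s\<bar> \<le> Q * norm v" using \<sigma>_bound by blast
  have "\<bar>wt v p\<bar> \<le> Q * (\<Sum>k<length p. norm (((*v) M ^^ k) v))" if "adm b p" for b p v
    using that
  proof (induction p arbitrary: b v)
    case (Cons s p)
    have "\<bar>wt v (s # p)\<bar> \<le> \<bar>\<sigma> v s\<bar> + \<bar>wt (M *v v) p\<bar>" by simp
    also have "\<dots> \<le> Q * norm v + Q * (\<Sum>k<length p. norm (((*v) M ^^ k) (M *v v)))"
      using Cons by (intro add_mono Q(2)) auto
    also have "\<dots> = Q * (\<Sum>k<length (s # p). norm (((*v) M ^^ k) v))"
      by (simp add: sum.lessThan_Suc_shift distrib_left funpow_swap1 del: sum.lessThan_Suc)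
    finally show ?case .
  qed simp
  moreover have "Q * (\<Sum>k<n. norm (((*v) M ^^ k) v)) \<le> Q * (\<Sum>k. norm (((*v) M ^^ k) v))" for n
    by (intro mult_left_mono sum_le_suminf summable_contracting[OF assms] Q(1)) auto
  ultimately show ?thesis by (meson order_trans)
qed

text \<open>At every level some interval is charged, since otherwise the total mass would vanish. As
  \<open>M\<close> is positive, every interval contains a floor over the letter charged at the next
  level.\<close>

lemma measure_ivl_pos:
  assumes c: "conf T v m" and m: "measure m {0..<1} > 0"
  shows "0 < measure ((scl ^^ k) m) (ivl T a)"
proof -
  have step: "measure ((scl ^^ k) m) (ivl T b) =
     (\<Sum>s\<in>into b. exp (\<sigma> (((*v) M ^^ k) v) s) * measure ((scl ^^ Suc k) m) (ivl T (fst s)))" for k b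
    using measure_ivl_step[OF conf_scl_pow[OF c]] by simp
  have ex: "\<exists>a. 0 < measure ((scl ^^ k) m) (ivl T a)" for k
  proof (induction k)
    case 0
    show ?case
    proof (rule ccontr)
      assume "\<nexists>a. 0 < measure ((scl ^^ 0) m) (ivl T a)"
      then have "measure m (ivl T a) = 0" for a by (simp add: zero_less_measure_iff)
      then show False using m measure_unit_ivl[of m] c by (auto simp: conf_def)
    qed
  next
    case (Suc k)
    show ?case
    proof (rule ccontr)
      assume "\<nexists>a. 0 < measure ((scl ^^ Suc k) m) (ivl T a)"
      then have "measure ((scl ^^ Suc k) m) (ivl T a) = 0" for a by (simp add: zero_less_measure_iff)
      then have "measure ((scl ^^ k) m) (ivl T b) = 0" for b using step[of k b] by simp
      then show False using Suc by auto
    qed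
  qed
  obtain c where c: "0 < measure ((scl ^^ Suc k) m) (ivl T c)" using ex by blast
  obtain s where s: "s \<in> idx" "fst s = c" "bl s = a" using ex_idx by blast
  show ?thesis unfolding step[of k a]
    by (rule sum_pos2[of _ s]) (use c s finite_idx in auto)
qed

end

section \<open>The conformal measure of the central part\<close>

text \<open>Comparing \<open>A (k * n)\<close> with \<open>k\<close> times \<open>A n\<close> and
  with \<open>n\<close> times \<open>A k\<close> shows that the means are Cauchy. The same
  comparison yields the uniform error \<open>C\<close>, from which the bounds with constants below
  are drawn.\<close>

lemma quasi_additive_limit:
  fixes A :: "nat \<Rightarrow> real"
  assumes lo: "\<And>n m. A n + A m \<le> A (n + m)" and up: "\<And>n m. A (n + m) \<le> A n + A m + C"
  shows "\<exists>\<xi>. (\<lambda>n. A n / real n) \<longlonglongrightarrow> \<xi> \<and> (\<forall>n. \<bar>A n - real n * \<xi>\<bar> \<le> C)"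
proof -
  have C: "0 \<le> C" using lo[of 0 0] up[of 0 0] by simp
  have mult: "\<bar>A (k * n) - real k * A n\<bar> \<le> real k * C" if "0 < k" for k n
    using that
  proof (induction k rule: nat_induct_non_zero)
    case (Suc k)
    then show ?case using lo[of n "k * n"] up[of n "k * n"] C by (simp add: algebra_simps abs_le_iff)
  qed (use C in simp)
  have diff: "\<bar>A n / real n - A k / real k\<bar> \<le> C / real n + C / real k" if "0 < n" "0 < k" for n k
  proof -
    have "\<bar>real k * A n - real n * A k\<bar> \<le> real k * C + real n * C"
      using mult[OF that(2), of n] mult[OF that(1), of k] by (simp add: mult.commute abs_le_iff)
    then have "\<bar>real k * A n - real n * A k\<bar> / (real n * real k) \<le> (real k * C + real n * C) / (real n * real k)"
      by (intro divide_right_mono) auto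
    moreover have "\<bar>real k * A n - real n * A k\<bar> / (real n * real k) = \<bar>A n / real n - A k / real k\<bar>"
    proof -
      have "A n / real n - A k / real k = (real k * A n - real n * A k) / (real n * real k)"
        using that by (simp add: field_simps)
      then show ?thesis by (simp add: abs_divide)
    qed
    ultimately show ?thesis using that by (simp add: add_divide_distrib)
  qed
  have lim0: "(\<lambda>n. C / real n) \<longlonglongrightarrow> 0"
    by (rule lim_const_over_n)
  have "Cauchy (\<lambda>n. A n / real n)"
  proof (rule CauchyI)
    fix e :: real assume e: "0 < e"
    then have "eventually (\<lambda>n. C / real n < e / 2) sequentially"
      using order_tendstoD(2)[OF lim0, of "e/2"] by simp
    then obtain n0 where n0: "\<And>n. n0 \<le> n \<Longrightarrow> C / real n < e / 2" by (auto simp: eventually_sequentially)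
    show "\<exists>M. \<forall>m\<ge>M. \<forall>n\<ge>M. norm (A m / real m - A n / real n) < e"
    proof (intro exI[of _ "Suc n0"] allI impI)
      fix m n assume "Suc n0 \<le> m" "Suc n0 \<le> n"
      then show "norm (A m / real m - A n / real n) < e"
        using diff[of m n] n0[of m] n0[of n] by (simp only: real_norm_def) linarith
    qed
  qed
  then obtain \<xi> where \<xi>: "(\<lambda>n. A n / real n) \<longlonglongrightarrow> \<xi>"
    by (auto simp: Cauchy_convergent_iff convergent_def)
  have "\<bar>A n - real n * \<xi>\<bar> \<le> C" for n
  proof (cases "n = 0")
    case True
    then show ?thesis using lo[of 0 0] up[of 0 0] by simp
  next
    case False
    have "(\<lambda>k. \<bar>A n / real n - A k / real k\<bar>) \<longlonglongrightarrow> \<bar>A n / real n - \<xi>\<bar>"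
      by (intro tendsto_intros \<xi>)
    moreover have "(\<lambda>k. C / real n + C / real k) \<longlonglongrightarrow> C / real n + 0"
      by (intro tendsto_add tendsto_const lim0)
    ultimately have "\<bar>A n / real n - \<xi>\<bar> \<le> C / real n + 0"
      by (rule LIMSEQ_le) (use diff False in \<open>auto intro!: exI[of _ 1]\<close>)
    then have "real n * \<bar>A n / real n - \<xi>\<bar> \<le> real n * (C / real n)" using False by (intro mult_left_mono) auto
    moreover have "real n * \<bar>A n / real n - \<xi>\<bar> = \<bar>real n * (A n / real n - \<xi>)\<bar>" by (simp add: abs_mult)
    ultimately show ?thesis using False by (simp add: right_diff_distrib)
  qed
  then show ?thesis using \<xi> by blast
qed

locale central = selfsim T N for T :: "'a::finite aiet" and N +
  fixes c :: "real ^ 'a" and m :: "real measure"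
  assumes Mc: "ss_matrix T N *v c = c" and c_nonzero: "c \<noteq> 0"
    and conf_m: "conf T c m" and m1: "measure m {0..<1} = 1"
begin

lemma m_sets: "sets m = sets borel" and m_fin: "finite_measure m"
  using conf_m by (auto simp: conf_def)

lemma Mc_pow: "((*v) M ^^ k) c = c"
  by (induction k) (auto simp: Mc)

definition mass :: "'a \<Rightarrow> real" where "mass a = measure m (ivl T a)"

definition R :: real where
  "R = (SOME R. 0 < R \<and> (\<forall>k a. measure ((scl ^^ k) m) (ivl T a) = R * measure ((scl ^^ Suc k) m) (ivl T a)))"

text \<open>Since \<open>M *v c = c\<close>, all rescaled measures obey the recursion with the same
  positive matrix, so their interval masses form a geometric sequence as the lengths do.\<close>

lemma R_pos: "0 < R"
  and R_step: "measure ((scl ^^ k) m) (ivl T a) = R * measure ((scl ^^ Suc k) m) (ivl T a)"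
proof -
  let ?Y = "\<lambda>k a. measure ((scl ^^ k) m) (ivl T a)"
  define A where "A a b = (\<Sum>s\<in>{s\<in>idx. bl s = b \<and> fst s = a}. exp (\<sigma> c s))" for a b
  have pos: "0 < A a b" for a b
  proof -
    obtain s where s: "s \<in> idx" "fst s = a" "bl s = b" using ex_idx by blast
    show ?thesis unfolding A_def by (rule sum_pos2[of _ s]) (use s in \<open>simp_all add: finite_idx\<close>)
  qed
  have Y: "0 < ?Y k a" for k a using measure_ivl_pos[OF conf_m] m1 by simp
  have rec: "?Y k b = (\<Sum>a\<in>UNIV. ?Y (Suc k) a * A a b)" for k b
  proof -
    have "?Y k b = (\<Sum>s\<in>into b. exp (\<sigma> c s) * ?Y (Suc k) (fst s))"
      using measure_ivl_step[OF conf_scl_pow[OF conf_m, of k], of b] by (simp add: Mc_pow)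
    also have "\<dots> = (\<Sum>a\<in>UNIV. \<Sum>s\<in>{s\<in>into b. fst s = a}. exp (\<sigma> c s) * ?Y (Suc k) (fst s))"
      by (rule sum.group[symmetric]) (auto simp: finite_idx)
    also have "\<dots> = (\<Sum>a\<in>UNIV. ?Y (Suc k) a * A a b)"
      by (intro sum.cong refl) (auto simp: A_def sum_distrib_left mult.commute intro!: sum.cong)
    finally show ?thesis .
  qed
  have "\<exists>R>0. \<forall>k a. ?Y k a = R * ?Y (Suc k) a"
    by (rule backward_orbit_eigenvector[of A ?Y, OF pos Y rec])
  then have "0 < R \<and> (\<forall>k a. ?Y k a = R * ?Y (Suc k) a)" unfolding R_def by (rule someI_ex)
  then show "0 < R" "?Y k a = R * ?Y (Suc k) a" by blast+
qed

lemma mass_pos: "0 < mass a"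
  using measure_ivl_pos[OF conf_m, of 0 a] m1 by (simp add: mass_def)

lemma sum_mass: "(\<Sum>a\<in>UNIV. mass a) = 1"
  using measure_unit_ivl[OF m_fin m_sets] m1 by (simp add: mass_def)

lemma scl_m: "measure ((scl ^^ k) m) (ivl T a) = mass a / R ^ k"
proof (induction k)
  case (Suc k)
  then show ?case using R_step[of k a] R_pos by (simp add: field_simps)
qed (simp add: mass_def)

text \<open>Transition probability of the Markov coding: the share of the floor \<open>s\<close> in
  the mass of the interval containing it, see \<open>floor_measure\<close>. Its negative logarithm
  is the summand in the definition of \<xi>.\<close>

definition prob :: "'a \<times> nat \<Rightarrow> real" where
  "prob s = exp (\<sigma> c s) * mass (fst s) / (R * mass (bl s))"

definition weight :: "'a \<times> nat \<Rightarrow> real" where "weight s = - ln (prob s)"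

definition pw :: "('a \<times> nat) list \<Rightarrow> real" where "pw p = sum_list (map weight p)"

lemma prob_pos: "0 < prob s"
  using mass_pos R_pos by (simp add: prob_def)

lemma exp_weight: "exp (- weight s) = prob s"
  using prob_pos by (simp add: weight_def)

lemma floor_measure: "s \<in> idx \<Longrightarrow> measure m (tower_floor T N s) = mass (bl s) * prob s"
  using branch_measure(2)[OF conf_m, of s "ivl T (fst s)"] scl_m[of 1 "fst s"] R_pos mass_pos[of "bl s"]
  by (simp add: floor_eq prob_def)

lemma sum_prob: "(\<Sum>s\<in>into b. prob s) = 1"
proof -
  have "mass b = (\<Sum>s\<in>into b. exp (\<sigma> c s) * measure (scl m) (ivl T (fst s)))"
    using measure_ivl_step[OF conf_m] by (simp add: mass_def)
  also have "\<dots> = (\<Sum>s\<in>into b. mass b * prob s)"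
    using scl_m[of 1] mass_pos[of b] by (intro sum.cong) (auto simp: prob_def)
  finally show ?thesis using mass_pos[of b] by (simp add: sum_distrib_left[symmetric])
qed

text \<open>Each interval contains floors over two different letters, and both have positive
  mass.\<close>

lemma prob_less_1:
  assumes s: "s \<in> idx"
  shows "prob s < 1"
proof -
  obtain a where a: "a \<noteq> fst s" using ex_other by blast
  obtain s' where s': "s' \<in> idx" "fst s' = a" "bl s' = bl s" using ex_idx by blast
  have "s \<noteq> s'" using a s' by auto
  then have "prob s + prob s' = sum prob {s, s'}" by simp
  also have "\<dots> \<le> (\<Sum>t\<in>into (bl s). prob t)"
    by (rule sum_mono2) (use s s' finite_idx prob_pos in \<open>auto simp: less_imp_le\<close>)
  finally show ?thesis using prob_pos[of s'] sum_prob by simp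
qed

lemma weight_pos: "s \<in> idx \<Longrightarrow> 0 < weight s"
  using prob_less_1 prob_pos by (simp add: weight_def)

text \<open>In the product of \<open>prob\<close> along the path the masses of intermediate letters
  cancel, and the powers of \<open>R\<close> are those of \<open>scl_m\<close>.\<close>

lemma measure_cyl_m: "adm b p \<Longrightarrow> measure m (cyl b p) = mass b * exp (- pw p)"
proof -
  assume p: "adm b p"
  have "exp (wt c p) * (mass (endl b p) / R ^ length p) = mass b * exp (- pw p)"
    using p
  proof (induction p arbitrary: b)
    case (Cons s p)
    have "exp (wt c (s # p)) * (mass (endl b (s # p)) / R ^ length (s # p)) =
       exp (\<sigma> c s) / R * (exp (wt c p) * (mass (endl (fst s) p) / R ^ length p))"
      by (simp add: exp_add Mc)
    also have "\<dots> = exp (\<sigma> c s) / R * (mass (fst s) * exp (- pw p))" using Cons by simp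
    also have "\<dots> = mass (bl s) * prob s * exp (- pw p)" using mass_pos[of "bl s"] by (simp add: prob_def)
    also have "\<dots> = mass b * exp (- pw (s # p))"
      using Cons.prems by (simp add: pw_def exp_weight[symmetric] mult_exp_exp)
    finally show ?case .
  qed (simp add: pw_def)
  then show ?thesis using measure_cyl[OF conf_m p] by (simp add: scl_m)
qed

lemma total_cyl:
  assumes "finite_measure m'" "sets m' = sets borel"
  shows "measure m' {0..<1} = (\<Sum>b\<in>UNIV. \<Sum>p\<in>adms b n. measure m' (cyl b p))"
  using measure_unit_ivl[OF assms] measure_ivl_adms[OF assms] by simp

text \<open>The contracting part changes the Birkhoff sums along a cylinder by a bounded amount, uniformly in its level.
  The masses of the base intervals are then pinned down by the total mass \<open>1\<close> of both measures.\<close>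

lemma comparison:
  assumes conf: "conf T v m'" and m': "measure m' {0..<1} = 1" and v: "v - c \<in> contracting_space M"
  shows "\<exists>C>0. \<forall>b p. adm b p \<longrightarrow> measure m' (cyl b p) \<le> C * measure m (cyl b p) \<and>
      measure m (cyl b p) \<le> C * measure m' (cyl b p)"
proof -
  obtain K where K: "\<And>b p. adm b p \<Longrightarrow> \<bar>wt (v - c) p\<bar> \<le> K" using wt_bound[OF v] by blast
  obtain Q where Q: "0 \<le> Q" "\<And>v s. s \<in> idx \<Longrightarrow> \<bar>\<sigma> v s\<bar> \<le> Q * norm v" using \<sigma>_bound by blast
  have "(\<lambda>k. norm (((*v) M ^^ k) (v - c))) \<longlonglongrightarrow> 0"
    using summable_contracting[OF v] by (rule summable_LIMSEQ_zero)
  then have "Bseq (\<lambda>k. norm (((*v) M ^^ k) (v - c)))" by (rule convergent_imp_Bseq[OF convergentI])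
  then obtain B where B: "\<And>k. norm (((*v) M ^^ k) (v - c)) \<le> B" by (auto simp: Bseq_def)
  define L where "L = Q * B"
  have L0: "0 \<le> L" unfolding L_def using Q(1) order_trans[OF norm_ge_zero B] by (intro mult_nonneg_nonneg)
  have it: "((*v) M ^^ k) v = ((*v) M ^^ k) (v - c) + c" for k
    by (induction k) (auto simp: matrix_vector_right_distrib Mc)
  have L: "\<bar>\<sigma> (((*v) M ^^ k) v) s - \<sigma> c s\<bar> \<le> L" if "s \<in> idx" for k s
  proof -
    have "Q * norm (((*v) M ^^ k) (v - c)) \<le> L" unfolding L_def using Q(1) B by (intro mult_left_mono) auto
    then show ?thesis unfolding it[of k] \<sigma>_add using Q(2)[OF that, of "((*v) M ^^ k) (v - c)"] by simp
  qed
  \<comment> \<open>Masses of the base intervals relative to those of \<open>m\<close> at the same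
    level, which are \<open>mass a / R ^ n\<close>. They satisfy the Markov recursion
    \<open>trec\<close>, perturbed by factors between \<open>exp (- L)\<close> and
    \<open>exp L\<close>.\<close>
  define t where "t n a = measure ((scl ^^ n) m') (ivl T a) * R ^ n / mass a" for n a
  have t0: "0 < t n a" for n a
    unfolding t_def using measure_ivl_pos[OF conf] m' mass_pos R_pos by simp
  have trec: "t n b = (\<Sum>s\<in>into b. exp (\<sigma> (((*v) M ^^ n) v) s - \<sigma> c s) * prob s * t (Suc n) (fst s))" for n b
  proof -
    have "t n b = (\<Sum>s\<in>into b. exp (\<sigma> (((*v) M ^^ n) v) s) * measure ((scl ^^ Suc n) m') (ivl T (fst s)) * R ^ n / mass b)"
      using measure_ivl_step[OF conf_scl_pow[OF conf, of n], of b]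
      by (simp add: t_def sum_distrib_right sum_divide_distrib)
    also have "\<dots> = (\<Sum>s\<in>into b. exp (\<sigma> (((*v) M ^^ n) v) s - \<sigma> c s) * prob s * t (Suc n) (fst s))"
    proof (intro sum.cong refl)
      fix s assume "s \<in> into b"
      then show "exp (\<sigma> (((*v) M ^^ n) v) s) * measure ((scl ^^ Suc n) m') (ivl T (fst s)) * R ^ n / mass b =
          exp (\<sigma> (((*v) M ^^ n) v) s - \<sigma> c s) * prob s * t (Suc n) (fst s)"
        using mass_pos[of "fst s"] mass_pos[of b] R_pos by (simp add: t_def prob_def exp_diff)
    qed
    finally show ?thesis .
  qed
  define \<kappa> where "\<kappa> = exp (- L) * Min (prob ` idx)"
  have "idx \<noteq> {}" using ex_idx by blast
  then have pm: "0 < Min (prob ` idx)" using finite_idx prob_pos by (subst Min_gr_iff) auto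
  then have \<kappa>0: "0 < \<kappa>" by (simp add: \<kappa>_def)
  \<comment> \<open>Every letter reaches every other one by a single edge, so each relative mass at
    level \<open>Suc n\<close> bounds all those at level \<open>n\<close> from below.\<close>
  have lower: "\<kappa> * t (Suc n) a \<le> t n b" for n a b
  proof -
    obtain s where s: "s \<in> idx" "fst s = a" "bl s = b" using ex_idx by blast
    have "\<kappa> * t (Suc n) a \<le> exp (\<sigma> (((*v) M ^^ n) v) s - \<sigma> c s) * prob s * t (Suc n) (fst s)"
      unfolding \<kappa>_def s(2) using L[OF s(1), of n] t0[of "Suc n" a] finite_idx s(1) pm
      by (intro mult_right_mono mult_mono) (auto simp: less_imp_le)
    also have "\<dots> \<le> t n b" unfolding trec[of n b]
      by (rule member_le_sum) (use s finite_idx t0 prob_pos in \<open>auto simp: less_imp_le\<close>)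
    finally show ?thesis .
  qed
  have ratio: "measure m' (cyl b p) = exp (wt (v - c) p) * t (length p) (endl b p) * measure m (cyl b p)"
    if "adm b p" for b p
  proof -
    have "wt v p = wt (v - c) p + wt c p" using wt_add[of "v - c" c p] by simp
    then show ?thesis
      using measure_cyl[OF conf that] measure_cyl[OF conf_m that] R_pos mass_pos[of "endl b p"]
      by (simp add: scl_m t_def exp_add)
  qed
  have expK: "exp (- K) \<le> exp (wt (v - c) p)" "exp (wt (v - c) p) \<le> exp K" if "adm b p" for b p
    using K[OF that] by auto
  have tot: "(\<Sum>b\<in>UNIV. \<Sum>p\<in>adms b n. measure m' (cyl b p)) = 1" "(\<Sum>b\<in>UNIV. \<Sum>p\<in>adms b n. measure m (cyl b p)) = 1" for n
    using total_cyl[OF m_fin m_sets, of n] total_cyl[of m' n] m1 m' conf by (auto simp: conf_def)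
  \<comment> \<open>Both measures give the cylinders of one level total mass 1, so the relative
    masses can neither all be large nor, by \<open>le\<close>, all be small.\<close>
  have ge: "exp (- K) * \<theta> \<le> 1" if \<theta>: "0 \<le> \<theta>" "\<And>a. \<theta> \<le> t n a" for n \<theta>
  proof -
    have "(\<Sum>b\<in>UNIV. \<Sum>p\<in>adms b n. exp (- K) * \<theta> * measure m (cyl b p)) \<le> (\<Sum>b\<in>UNIV. \<Sum>p\<in>adms b n. measure m' (cyl b p))"
    proof (intro sum_mono)
      fix b p assume "p \<in> adms b n"
      then have p: "adm b p" "length p = n" by (auto simp: adms_def)
      then show "exp (- K) * \<theta> * measure m (cyl b p) \<le> measure m' (cyl b p)"
        unfolding ratio[OF p(1)] using expK[OF p(1)] \<theta> by (intro mult_right_mono mult_mono) auto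
    qed
    then show ?thesis by (simp only: sum_distrib_left[symmetric] tot mult_1_right)
  qed
  have le: "1 \<le> exp K * \<theta>" if \<theta>: "\<And>a. t n a \<le> \<theta>" for n \<theta>
  proof -
    have "(\<Sum>b\<in>UNIV. \<Sum>p\<in>adms b n. measure m' (cyl b p)) \<le> (\<Sum>b\<in>UNIV. \<Sum>p\<in>adms b n. exp K * \<theta> * measure m (cyl b p))"
    proof (intro sum_mono)
      fix b p assume "p \<in> adms b n"
      then have p: "adm b p" "length p = n" by (auto simp: adms_def)
      then show "measure m' (cyl b p) \<le> exp K * \<theta> * measure m (cyl b p)"
        unfolding ratio[OF p(1)] using expK[OF p(1)] \<theta> t0[of n "endl b p"]
        by (intro mult_right_mono mult_mono) (auto simp: less_imp_le)
    qed
    then show ?thesis by (simp only: sum_distrib_left[symmetric] tot mult_1_right)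
  qed
  have up: "t (Suc n) a \<le> exp K / \<kappa>" for n a
    using ge[of "\<kappa> * t (Suc n) a" n] lower[of n a] \<kappa>0 t0[of "Suc n" a] by (simp add: exp_minus field_simps)
  have dn: "\<kappa> * exp (- K) \<le> t n a" for n a
    using le[of "Suc n" "t n a / \<kappa>"] lower[of n _ a] \<kappa>0 by (simp add: exp_minus field_simps)
  \<comment> \<open>Level 0 is missing from \<open>up\<close>; one step of the recursion supplies it
    at the price of \<open>exp L\<close>.\<close>
  have up': "t n b \<le> exp L * (exp K / \<kappa>)" for n b
  proof -
    have "t n b \<le> (\<Sum>s\<in>into b. exp L * prob s * (exp K / \<kappa>))"
      unfolding trec[of n b]
    proof (rule sum_mono)
      fix s assume "s \<in> into b"
      then show "exp (\<sigma> (((*v) M ^^ n) v) s - \<sigma> c s) * prob s * t (Suc n) (fst s) \<le> exp L * prob s * (exp K / \<kappa>)"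
        using L[of s n] up[of n "fst s"] t0[of "Suc n" "fst s"] prob_pos[of s]
        by (intro mult_mono mult_right_mono) (auto simp: less_imp_le)
    qed
    also have "\<dots> = exp L * (exp K / \<kappa>) * (\<Sum>s\<in>into b. prob s)" by (simp add: sum_distrib_left mult_ac)
    also have "\<dots> = exp L * (exp K / \<kappa>)" by (simp add: sum_prob)
    finally show ?thesis .
  qed
  define C where "C = exp K * exp L * exp K / \<kappa>"
  have "measure m' (cyl b p) \<le> C * measure m (cyl b p) \<and> measure m (cyl b p) \<le> C * measure m' (cyl b p)"
    if p: "adm b p" for b p
  proof
    have "exp (wt (v - c) p) * t (length p) (endl b p) \<le> exp K * (exp L * (exp K / \<kappa>))"
      using expK[OF p] up' t0 by (intro mult_mono) (auto simp: less_imp_le)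
    then show "measure m' (cyl b p) \<le> C * measure m (cyl b p)"
      unfolding ratio[OF p] C_def by (intro mult_right_mono) (auto simp: mult_ac)
    have "exp (- K) * (\<kappa> * exp (- K)) \<le> exp (wt (v - c) p) * t (length p) (endl b p)"
      using expK[OF p] dn \<kappa>0 by (intro mult_mono) auto
    then have "1 \<le> exp K * exp K / \<kappa> * (exp (wt (v - c) p) * t (length p) (endl b p))"
      using \<kappa>0 by (simp add: exp_minus field_simps)
    also have "\<dots> \<le> C * (exp (wt (v - c) p) * t (length p) (endl b p))"
      using \<kappa>0 L0 t0[of "length p" "endl b p"] unfolding C_def
      by (intro mult_right_mono divide_right_mono) (auto simp: less_imp_le)
    finally have "1 * measure m (cyl b p) \<le> C * (exp (wt (v - c) p) * t (length p) (endl b p)) * measure m (cyl b p)"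
      by (intro mult_right_mono) auto
    then show "measure m (cyl b p) \<le> C * measure m' (cyl b p)"
      unfolding ratio[OF p] by (simp add: mult_ac)
  qed
  moreover have "0 < C" using \<kappa>0 by (simp add: C_def)
  ultimately show ?thesis by blast
qed

section \<open>Minimal path weights and the number \<xi>\<close>

lemma adm_append: "adm b (p @ q) \<longleftrightarrow> adm b p \<and> adm (endl b p) q"
  by (induction p arbitrary: b) auto

lemma endl_append: "endl b (p @ q) = endl (endl b p) q"
  by (induction p arbitrary: b) auto

lemma pw_append: "pw (p @ q) = pw p + pw q"
  by (simp add: pw_def)

lemma pw_nonneg: "adm b p \<Longrightarrow> 0 \<le> pw p"
  by (induction p arbitrary: b) (auto simp: pw_def intro!: add_nonneg_nonneg less_imp_le[OF weight_pos])

lemma adms_nonempty: "adms b n \<noteq> {}"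
proof (induction n arbitrary: b)
  case (Suc n)
  obtain s where s: "s \<in> idx" "bl s = b" using ex_idx by blast
  moreover obtain p where "p \<in> adms (fst s) n" using Suc[of "fst s"] by auto
  ultimately have "s # p \<in> adms b (Suc n)" by (simp add: adms_def)
  then show ?case by blast
qed (simp add: adms_0)

definition PS :: "nat \<Rightarrow> ('a \<times> nat) list set" where "PS n = (\<Union>b. adms b n)"

definition min_pw :: "nat \<Rightarrow> real" where "min_pw n = Min (pw ` PS n)"

lemma PS: "finite (PS n)" "PS n \<noteq> {}"
  using adms_nonempty by (auto simp: PS_def finite_adms)

lemma min_pw_le: "adm b p \<Longrightarrow> min_pw (length p) \<le> pw p"
  unfolding min_pw_def using PS by (intro Min_le) (auto simp: PS_def adms_def)

lemma min_pw_attained: "\<exists>b. \<exists>p\<in>adms b n. pw p = min_pw n"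
proof -
  have "min_pw n \<in> pw ` PS n" unfolding min_pw_def using PS by (intro Min_in) auto
  then obtain b p where "p \<in> adms b n" "min_pw n = pw p" by (auto simp: PS_def)
  then show ?thesis by (intro exI[of _ b] bexI[of _ p]) auto
qed

lemma min_pw_superadditive: "min_pw n + min_pw k \<le> min_pw (n + k)"
proof -
  obtain b p where p: "p \<in> adms b (n + k)" "pw p = min_pw (n + k)" using min_pw_attained by blast
  then have a: "adm b (take n p)" "adm (endl b (take n p)) (drop n p)"
    using adm_append[of b "take n p" "drop n p"] by (auto simp: adms_def)
  have "length (take n p) = n" "length (drop n p) = k" using p by (auto simp: adms_def)
  then have "min_pw n + min_pw k \<le> pw (take n p) + pw (drop n p)" using min_pw_le[OF a(1)] min_pw_le[OF a(2)] by simp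
  then show ?thesis using p(2) pw_append[of "take n p" "drop n p"] by simp
qed

definition wmax :: real where "wmax = Max (weight ` idx)"

lemma weight_le: "s \<in> idx \<Longrightarrow> weight s \<le> wmax"
  unfolding wmax_def using finite_idx by (intro Max_ge) auto

text \<open>Two optimal paths are joined by one edge. Cutting the result back to length
  \<open>n + k\<close> does not increase its weight, as weights of edges are positive.\<close>

lemma min_pw_quasi_subadditive: "min_pw (n + k) \<le> min_pw n + min_pw k + wmax"
proof -
  obtain b p where p: "p \<in> adms b n" "pw p = min_pw n" using min_pw_attained by blast
  obtain b' q where q: "q \<in> adms b' k" "pw q = min_pw k" using min_pw_attained by blast
  obtain e where e: "e \<in> idx" "fst e = b'" "bl e = endl b p" using ex_idx by blast
  let ?l = "p @ e # q"
  have l: "adm b ?l" using p q e by (auto simp: adm_append adms_def)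
  then have t: "adm b (take (n + k) ?l)" and u: "adm (endl b (take (n + k) ?l)) (drop (n + k) ?l)"
    using adm_append[of b "take (n + k) ?l" "drop (n + k) ?l"] unfolding append_take_drop_id by blast+
  have "length (take (n + k) ?l) = n + k" using p q by (auto simp: adms_def)
  then have "min_pw (n + k) \<le> pw (take (n + k) ?l)" using min_pw_le[OF t] by (simp only:)
  also have "\<dots> \<le> pw ?l" using pw_append[of "take (n + k) ?l" "drop (n + k) ?l"] pw_nonneg[OF u]
    unfolding append_take_drop_id by linarith
  also have "\<dots> = min_pw n + min_pw k + weight e" using p q by (simp add: pw_append) (simp add: pw_def)
  finally show ?thesis using weight_le[OF e(1)] by simp
qed

lemma adm_nth: "adm (fst y) p \<longleftrightarrow> (\<forall>i<length p. p ! i \<in> idx \<and> bl (p ! i) = fst ((y # p) ! i))"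
proof (induction p arbitrary: y)
  case (Cons s p)
  then show ?case by (auto simp: All_less_Suc2)
qed simp

text \<open>The sequences in the definition of \<xi> are paths: \<open>s 0\<close> matters only
  through its letter, the start of the path, and the later terms are the edges.\<close>

lemma xi_seq_eq:
  assumes n: "1 \<le> n"
  shows "xi_seq T N m n = min_pw n / real n"
proof -
  have ratio: "ln (measure m (tower_floor T N e) / measure m (ivl T (fst e'))) = - weight e"
    if "e \<in> idx" "bl e = fst e'" for e e'
    using floor_measure[OF that(1)] that(2) mass_pos[of "fst e'"] by (simp add: weight_def mass_def)
  have "{- (\<Sum>j=1..n. ln (measure m (tower_floor T N (s j)) / measure m (ivl T (fst (s (j - 1)))))) | s.
          (\<forall>j\<le>n. s j \<in> idx) \<and> (\<forall>j\<in>{1..n}. bl (s j) = fst (s (j - 1)))} = pw ` PS n"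
    (is "?L = _")
  proof (intro equalityI subsetI)
    fix y assume "y \<in> ?L"
    then obtain s where s: "\<forall>j\<le>n. s j \<in> idx" "\<forall>j\<in>{1..n}. bl (s j) = fst (s (j - 1))"
      and y: "y = - (\<Sum>j=1..n. ln (measure m (tower_floor T N (s j)) / measure m (ivl T (fst (s (j - 1))))))"
      by auto
    define p where "p = map s [1..<Suc n]"
    have "adm (fst (s 0)) p"
      unfolding adm_nth
    proof (intro allI impI)
      fix i assume i: "i < length p"
      have "(s 0 # p) ! i = s i" using i by (cases i) (auto simp: p_def nth_append simp del: upt_Suc)
      then show "p ! i \<in> idx \<and> bl (p ! i) = fst ((s 0 # p) ! i)"
        using i s by (auto simp: p_def simp del: upt_Suc)
    qed
    moreover have "length p = n" by (simp add: p_def)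
    ultimately have "p \<in> PS n" by (auto simp: PS_def adms_def)
    moreover have "y = pw p"
    proof -
      have "y = (\<Sum>j=1..n. weight (s j))"
        unfolding y sum_negf[symmetric] using s by (intro sum.cong refl) (simp add: ratio)
      also have "\<dots> = sum_list (map (\<lambda>j. weight (s j)) [1..<Suc n])"
        by (simp add: sum_set_upt_conv_sum_list_nat[symmetric] atLeastLessThanSuc_atLeastAtMost del: upt_Suc)
      finally show ?thesis by (simp add: pw_def p_def comp_def del: upt_Suc)
    qed
    ultimately show "y \<in> pw ` PS n" by blast
  next
    fix y assume "y \<in> pw ` PS n"
    then obtain b p where p: "adm b p" "length p = n" "y = pw p" by (auto simp: PS_def adms_def)
    \<comment> \<open>Any floor over \<open>b\<close> may serve as initial term; floor 0 always
      exists.\<close>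
    define s where "s j = ((b, 0) # p) ! j" for j
    have nth: "\<forall>i<n. p ! i \<in> idx \<and> bl (p ! i) = fst (s i)"
      using adm_nth[of "(b, 0)" p] p by (simp add: s_def)
    have s0: "s 0 \<in> idx" using word_nonempty[of T N b] by (simp add: s_def idx_iff)
    have sS: "s (Suc i) = p ! i" for i by (simp add: s_def)
    have s1: "\<forall>j\<le>n. s j \<in> idx"
    proof (intro allI impI)
      fix j assume "j \<le> n" then show "s j \<in> idx" using s0 nth sS by (cases j) auto
    qed
    have s2: "\<forall>j\<in>{1..n}. bl (s j) = fst (s (j - 1))"
    proof
      fix j assume "j \<in> {1..n}" then show "bl (s j) = fst (s (j - 1))" using nth sS by (cases j) auto
    qed
    have "y = (\<Sum>i<n. weight (p ! i))" using p by (simp add: pw_def sum_list_sum_nth atLeast0LessThan)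
    also have "\<dots> = (\<Sum>j=1..n. weight (s j))"
      by (simp add: sS[symmetric] sum.atLeast1_atMost_eq)
    also have "\<dots> = - (\<Sum>j=1..n. ln (measure m (tower_floor T N (s j)) / measure m (ivl T (fst (s (j - 1))))))"
      unfolding sum_negf[symmetric] using s1 s2 by (intro sum.cong refl) (simp add: ratio)
    finally show "y \<in> ?L" using s1 s2 by blast
  qed
  then show ?thesis unfolding xi_seq_def min_pw_def by simp
qed

definition \<xi> :: real where "\<xi> = xi T N m"

lemma min_pw_bound: "\<bar>min_pw n - real n * \<xi>\<bar> \<le> wmax"
  and xi_limit: "(\<lambda>n. min_pw n / real n) \<longlonglongrightarrow> \<xi>"
proof -
  obtain y where y: "(\<lambda>n. min_pw n / real n) \<longlonglongrightarrow> y" "\<And>n. \<bar>min_pw n - real n * y\<bar> \<le> wmax"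
    using quasi_additive_limit[of min_pw wmax, OF min_pw_superadditive min_pw_quasi_subadditive] by blast
  have "xi_seq T N m \<longlonglongrightarrow> y"
    by (rule Lim_transform_eventually[OF y(1)])
      (auto simp: eventually_sequentially xi_seq_eq intro!: exI[of _ 1])
  then have "\<xi> = y" unfolding \<xi>_def xi_def by (rule limI)
  then show "\<bar>min_pw n - real n * \<xi>\<bar> \<le> wmax" "(\<lambda>n. min_pw n / real n) \<longlonglongrightarrow> \<xi>" using y by auto
qed

lemma xi_pos: "0 < \<xi>"
proof -
  define wmin where "wmin = Min (weight ` idx)"
  have "idx \<noteq> {}" using ex_idx by blast
  then have "0 < wmin" unfolding wmin_def using finite_idx weight_pos by (subst Min_gr_iff) auto
  have le: "wmin \<le> weight s" if "s \<in> idx" for s unfolding wmin_def using finite_idx that by (intro Min_le) auto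
  have "real (length p) * wmin \<le> pw p" if "adm b p" for b p
    using that
  proof (induction p arbitrary: b)
    case (Cons s p)
    then show ?case using le[of s] Cons.IH[of "fst s"] by (simp add: pw_def algebra_simps)
  qed (simp add: pw_def)
  then have "real n * wmin \<le> min_pw n" for n using min_pw_attained[of n] unfolding adms_def by force
  then have "wmin \<le> \<xi>"
    by (intro LIMSEQ_le_const[OF xi_limit]) (auto intro!: exI[of _ 1] simp: field_simps)
  then show ?thesis using \<open>0 < wmin\<close> by simp
qed

lemma pw_lower: "adm b p \<Longrightarrow> real (length p) * \<xi> - wmax \<le> pw p"
  using min_pw_le[of b p] min_pw_bound[of "length p"] by linarith

lemma pw_upper: "\<exists>b. \<exists>p\<in>adms b n. pw p \<le> real n * \<xi> + wmax"
  using min_pw_attained[of n] min_pw_bound[of n] by (metis abs_le_D1 add.commute diff_le_eq)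

end

section \<open>Strictness\<close>

context selfsim
begin

text \<open>By self-similarity the hypothesis extends from the towers to all points with \<open>T x \<noteq> 0\<close>: the step function
  with value \<open>c\<close> is the coboundary of the step function with values \<open>G\<close>. The latter is then constant on every
  \<open>T (I\<^sub>b)\<close> as well as on every \<open>I\<^sub>a\<close>, and these two partitions have no common break.\<close>

lemma coboundary_trivial:
  fixes G :: "'a \<Rightarrow> real"
  assumes Mc: "M *v c = c" and \<sigma>: "\<And>s. s \<in> idx \<Longrightarrow> \<sigma> c s = k0 + G (fst s) - G (bl s)"
  shows "c = 0"
proof -
  have first: "G (W a ! 0) = k0 + G a" for a
    using \<sigma>[of "(a, 0)"] word_nonempty[of T N a] by (simp add: idx_iff \<sigma>_def bl_eq)
  have inner: "c $ (W a ! i) = G (W a ! i) - G (W a ! Suc i)" if "Suc i < length (W a)" for a i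
    using \<sigma>[of "(a, i)"] \<sigma>[of "(a, Suc i)"] that by (simp add: idx_iff \<sigma>_def bl_eq)
  \<comment> \<open>With the top floor included the sum runs over the whole tower; it equals
    \<open>c $ a\<close> because \<open>c\<close> is fixed by \<open>M\<close>.\<close>
  have last: "c $ (W a ! i) = c $ a - k0 - G a + G (W a ! i)" if "Suc i = length (W a)" for a i
  proof -
    have "c $ a = (\<Sum>j<Suc i. c $ (W a ! j))" using M_mult[of c a] Mc that by simp
    also have "\<dots> = \<sigma> c (a, i) + c $ (W a ! i)" by (simp add: \<sigma>_def)
    finally show ?thesis using \<sigma>[of "(a, i)"] that by (simp add: idx_iff bl_eq)
  qed
  \<comment> \<open>Induction over scales. If \<open>x\<close> lies on the top floor of a tower over
    \<open>y\<close>, the relation for \<open>x\<close> follows from that for \<open>y\<close>,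
    whose image is \<open>r\<close> times as far from 0. The condition on \<open>k\<close> bounds
    how often this can happen; for \<open>k = 0\<close> it is impossible, as images lie below
    1.\<close>
  have cob: "c $ b = G b - G e" if "x \<in> ivl T b" "amap T x \<in> ivl T e" "1 \<le> r ^ k * amap T x" for x b e k
    using that
  proof (induction k arbitrary: x b e)
    case 0
    then have "amap T x \<in> {0..<1}" unfolding ivl_Un[symmetric] by blast
    then show ?case using 0 by simp
  next
    case (Suc k)
    have "x \<in> {0..<1}" using Suc.prems(1) ivl_Un by auto
    then obtain s y where s: "s \<in> idx" "y \<in> ivl T (fst s)" "x = branch s y" using branch_cover by blast
    obtain a i where ai: "s = (a, i)" by (cases s)
    have i: "i < length (W a)" and y: "y \<in> ivl T a" using s ai by (auto simp: idx_iff)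
    have b: "b = W a ! i"
      using branch_in[OF s(1,2)] s(1,3) Suc.prems(1) ivl_unique[OF f] by (auto simp: bl_eq ai)
    have Tx: "amap T x = (amap T ^^ Suc i) (y / r)" using s(3) by (simp add: branch_def ai)
    show ?case
    proof (cases "Suc i < length (W a)")
      case True
      then have "(a, Suc i) \<in> idx" by (simp add: idx_iff)
      from branch_in[OF this, of y] have "amap T x \<in> ivl T (W a ! Suc i)"
        using y Tx \<open>(a, Suc i) \<in> idx\<close> by (simp add: bl_eq branch_def)
      then have "e = W a ! Suc i" using Suc.prems(2) ivl_unique[OF f] by blast
      then show ?thesis using inner[OF True] b by simp
    next
      case False
      then have l: "Suc i = length (W a)" using i by simp
      then have Tx': "amap T x = amap T y / r" using Tx return_T[OF y] by simp
      have "amap T y \<in> {0..<1}" using amap_dom[OF f] subsetD[OF ivl_subset_dom[OF f] y] unfolding dom_T by blast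
      then obtain e' where e': "amap T y \<in> ivl T e'" using ivl_Un by blast
      have "1 \<le> r ^ k * amap T y" using Suc.prems(3) Tx' r_pos by (simp add: mult.commute)
      then have 1: "c $ a = G a - G e'" using Suc.IH[OF y e'] by simp
      have id: "(e', 0) \<in> idx" using word_nonempty[of T N e'] by (simp add: idx_iff)
      from branch_in[OF id, of "amap T y"] have "amap T x \<in> ivl T (W e' ! 0)"
        using e' id Tx' by (simp add: bl_eq branch_def)
      then have "e = W e' ! 0" using Suc.prems(2) ivl_unique[OF f] by blast
      then show ?thesis using last[OF l] b 1 first[of e'] by simp
    qed
  qed
  have cob': "c $ b = G b - G e" if "x \<in> ivl T b" "amap T x \<in> ivl T e" "0 < amap T x" for x b e
  proof -
    obtain k where "1 / amap T x < r ^ k" using real_arch_pow[OF r_gt_1] by blast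
    then have "1 \<le> r ^ k * amap T x" using that(3) by (simp add: field_simps)
    then show ?thesis using cob that by blast
  qed
  have img_cob: "c $ b = G b - G e" if "y \<in> img T b" "y \<in> ivl T e" "0 < y" for y b e
    using img_amap[OF f that(1)] cob' that by blast
  \<comment> \<open>The break between the neighbours \<open>a\<close> and \<open>a'\<close> is
    interior to some image interval. Points of this image on both sides of the break give the same
    equation with the two values of \<open>G\<close>.\<close>
  have adj: "G a = G a'" if a: "ptop T a' = Suc (ptop T a)" for a a'
  proof -
    let ?y = "top_left T a'"
    have y: "?y = top_left T a + len T $ a"
      using lft_Suc[OF inj_ptop[OF f] a] by (simp add: top_left_lft)
    then have y0: "0 < ?y" using top_left_nonneg[OF f, of a] len_pos[OF f, of a] by simp
    have ya: "?y \<in> ivl T a'" using len_pos[OF f] by (simp add: ivl_def)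
    then obtain e where e: "?y \<in> img T e" using img_cover[OF f] ivl_subset_dom[OF f] by blast
    have "bot_left T e \<noteq> ?y" using no_common_break[of a' e] y0 by auto
    then have "bot_left T e < ?y" using e by (simp add: img_def)
    then obtain z where z: "max (bot_left T e) (top_left T a) < z" "z < ?y"
      using dense[of "max (bot_left T e) (top_left T a)" ?y] y len_pos[OF f, of a] by auto
    have "z \<in> img T e" using z e by (simp add: img_def)
    moreover have "z \<in> ivl T a" using z y by (simp add: ivl_def)
    moreover have "0 < z" using z top_left_nonneg[OF f, of a] by simp
    ultimately show ?thesis using img_cob[OF e ya y0] img_cob[of z e a] by simp
  qed
  obtain a1 where a1: "ptop T a1 = 1"
    using bij_ptop[OF f] by (metis One_nat_def Suc_leI atLeastAtMost_iff bij_betw_def card_gt_0_iff finite imageE le_refl UNIV_not_empty)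
  have "G a = G a1" if "ptop T a = Suc n" for a n
    using that
  proof (induction n arbitrary: a)
    case 0
    then have "a = a1" using a1 inj_ptop[OF f] by (simp add: inj_def)
    then show ?case by simp
  next
    case (Suc n)
    have "ptop T a \<in> {1..CARD('a)}" using bij_ptop[OF f] by (auto simp: bij_betw_def)
    then have "Suc n \<in> range (ptop T)" using Suc.prems bij_ptop[OF f] by (simp add: bij_betw_def)
    then obtain a' where a': "ptop T a' = Suc n" by (metis imageE)
    then show ?case using Suc.IH[OF a'] adj[of a a'] Suc.prems by simp
  qed
  moreover have "\<exists>n. ptop T a = Suc n" for a
  proof -
    have "ptop T a \<in> {1..CARD('a)}" using bij_ptop[OF f] by (auto simp: bij_betw_def)
    then show ?thesis by (cases "ptop T a") auto
  qed
  ultimately have G: "G a = G a1" for a by blast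
  have "c $ b = 0" for b
  proof -
    \<comment> \<open>The midpoint of the image, because its left end may be 0, which the relation
      excludes.\<close>
    let ?y = "bot_left T b + image_len T b / 2"
    have y: "?y \<in> img T b" "0 < ?y" using image_len_pos[OF f, of b] bot_left_nonneg[OF f, of b] by (auto simp: img_def)
    then obtain e where "?y \<in> ivl T e" using img_subset_dom[OF f] ivl_cover[OF f] by blast
    then show ?thesis using img_cob[OF y(1) _ y(2)] G by (metis diff_self)
  qed
  then show ?thesis by (simp add: vec_eq_iff)
qed

end

section \<open>Exponential decay of the squared masses\<close>

context central
begin

text \<open>A potential for the graph of tower floors: by its definition as an infimum over paths, no edge weight is
  below \<open>\<xi> + g (fst s) - g (bl s)\<close>.\<close>

definition g :: "'a \<Rightarrow> real" where
  "g a = Inf {pw p - real (length p) * \<xi> | b p. adm b p \<and> endl b p = a}"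

lemma g_bdd: "bdd_below {pw p - real (length p) * \<xi> | b p. adm b p \<and> endl b p = a}"
  using pw_lower by (intro bdd_belowI[of _ "- wmax"]) force

lemma g_le: "adm b p \<Longrightarrow> endl b p = a \<Longrightarrow> g a \<le> pw p - real (length p) * \<xi>"
  unfolding g_def using g_bdd by (intro cInf_lower) auto

lemma g_le_0: "g a \<le> 0"
  using g_le[of a "[]"] by (simp add: pw_def)

lemma g_nonempty: "{pw p - real (length p) * \<xi> | b p. adm b p \<and> endl b p = a} \<noteq> {}"
proof -
  have "adm a [] \<and> endl a [] = a" by simp
  then show ?thesis by blast
qed

lemma g_ge: "- wmax \<le> g a"
  unfolding g_def using pw_lower by (intro cInf_greatest g_nonempty) force

lemma g_step:
  assumes s: "s \<in> idx"
  shows "g (fst s) \<le> g (bl s) + weight s - \<xi>"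
proof -
  have "g (fst s) - weight s + \<xi> \<le> g (bl s)"
    unfolding g_def[of "bl s"]
  proof (intro cInf_greatest g_nonempty)
    fix y assume "y \<in> {pw p - real (length p) * \<xi> | b p. adm b p \<and> endl b p = bl s}"
    then obtain b p where p: "adm b p" "endl b p = bl s" "y = pw p - real (length p) * \<xi>" by auto
    have "g (fst s) \<le> pw (p @ [s]) - real (length (p @ [s])) * \<xi>"
      by (rule g_le[of b]) (use p s in \<open>auto simp: adm_append endl_append\<close>)
    then show "g (fst s) - weight s + \<xi> \<le> y" using p by (simp add: pw_def algebra_simps)
  qed
  then show ?thesis by simp
qed

text \<open>The reduced cost of an edge in multiplicative form: \<open>u s\<close> is the
  exponential of minus the slack in \<open>g_step\<close>.\<close>

definition u :: "'a \<times> nat \<Rightarrow> real" where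
  "u s = prob s * exp (\<xi> + g (fst s) - g (bl s))"

lemma u_exp: "u s = exp (\<xi> + g (fst s) - g (bl s) - weight s)"
  by (simp add: u_def exp_weight[symmetric] mult_exp_exp)

lemma u_le_1: "s \<in> idx \<Longrightarrow> u s \<le> 1"
  using g_step[of s] by (simp add: u_exp)

text \<open>If no edge had slack, all weights would equal \<xi> up to a coboundary. Adding the
  coboundary of \<open>ln (mass a)\<close> and the constant \<open>ln R\<close> hidden in
  \<open>prob\<close> gives the hypothesis of \<open>coboundary_trivial\<close>, against
  \<open>c_nonzero\<close>.\<close>

lemma u_strict: "\<exists>s\<in>idx. u s < 1"
proof (rule ccontr)
  assume "\<not> (\<exists>s\<in>idx. u s < 1)"
  then have eq: "weight s = \<xi> + g (fst s) - g (bl s)" if "s \<in> idx" for s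
    using that g_step[of s] by (force simp: u_exp)
  have "c = 0"
  proof (rule coboundary_trivial[OF Mc, of "ln R - \<xi>" "\<lambda>a. - g a - ln (mass a)"])
    fix s assume s: "s \<in> idx"
    have "weight s = - (\<sigma> c s + ln (mass (fst s)) - (ln R + ln (mass (bl s))))"
      using mass_pos[of "fst s"] mass_pos[of "bl s"] R_pos by (simp add: weight_def prob_def ln_mult ln_div)
    then show "\<sigma> c s = ln R - \<xi> + (- g (fst s) - ln (mass (fst s))) - (- g (bl s) - ln (mass (bl s)))"
      using eq[OF s] by simp
  qed
  then show False using c_nonzero by simp
qed

text \<open>Normalized sum of squared masses with \<open>mass b\<close> left out. Of the two factors
  \<open>prob s\<close> of an edge, one remains as a probability and the other is turned by \<xi>
  and the potential into \<open>u s\<close>, so the recursion \<open>V_Suc\<close> has substochastic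
  coefficients.\<close>

definition V :: "nat \<Rightarrow> 'a \<Rightarrow> real" where
  "V n b = (\<Sum>p\<in>adms b n. exp (real n * \<xi> + g (endl b p) - g b - 2 * pw p))"

lemma V_0: "V 0 b = 1"
  by (simp add: V_def adms_0 pw_def)

lemma V_Suc: "V (Suc n) b = (\<Sum>s\<in>into b. prob s * u s * V n (fst s))"
  unfolding V_def sum_adms_Suc sum_distrib_left
  by (intro sum.cong refl) (auto simp: u_exp exp_weight[symmetric] mult_exp_exp pw_def algebra_simps)

lemma V_nonneg: "0 \<le> V n b"
  by (simp add: V_def sum_nonneg)

text \<open>The edge \<open>s0\<close> with \<open>u s0 < 1\<close> loses a fixed proportion at its
  start letter \<open>bl s0\<close>. From every letter one edge leads there, so two steps lose a
  fixed proportion everywhere; hence the square root in the rate.\<close>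

lemma V_decay: "\<exists>\<theta> C. 0 < \<theta> \<and> \<theta> < 1 \<and> 0 < C \<and> (\<forall>n b. V n b \<le> C * \<theta> ^ n)"
proof -
  obtain s0 where s0: "s0 \<in> idx" "u s0 < 1" using u_strict by blast
  define \<epsilon> where "\<epsilon> = prob s0 * (1 - u s0)"
  have \<epsilon>0: "0 < \<epsilon>" using s0 prob_pos by (simp add: \<epsilon>_def)
  have "0 < u s0" by (simp add: u_exp)
  then have \<epsilon>1: "\<epsilon> < 1" unfolding \<epsilon>_def using prob_less_1[OF s0(1)] prob_pos[of s0] s0(2)
    by (metis less_iff_diff_less_0 mult_strict_mono' mult_1 diff_gt_0_iff_gt less_add_same_cancel1 less_diff_eq less_imp_le diff_less_eq zero_less_one)
  define pm where "pm = Min (prob ` idx)"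
  have "idx \<noteq> {}" using s0 by auto
  then have pm0: "0 < pm" unfolding pm_def using finite_idx prob_pos by (subst Min_gr_iff) auto
  have pm: "pm \<le> prob s" if "s \<in> idx" for s unfolding pm_def using finite_idx that by (intro Min_le) auto
  have pm1: "pm < 1" using pm[OF s0(1)] prob_less_1[OF s0(1)] by simp
  define q where "q = 1 - pm * \<epsilon>"
  have "pm * \<epsilon> < 1 * 1" using pm0 pm1 \<epsilon>0 \<epsilon>1 by (intro mult_strict_mono) auto
  then have q0: "0 < q" and q1: "q < 1" using pm0 \<epsilon>0 by (auto simp: q_def)
  have le: "V (Suc n) b \<le> K" if "\<And>a. V n a \<le> K" for n b K
  proof -
    have "V (Suc n) b \<le> (\<Sum>s\<in>into b. prob s * 1 * K)"
      unfolding V_Suc using that u_le_1 prob_pos V_nonneg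
      by (intro sum_mono mult_mono) (auto simp: less_imp_le u_exp)
    then show ?thesis using sum_prob[of b] by (simp add: sum_distrib_right[symmetric])
  qed
  have K0: "0 \<le> K" if "\<And>a. V n a \<le> K" for n K using that[of undefined] V_nonneg[of n undefined] by simp
  have b0: "V (Suc n) (bl s0) \<le> (1 - \<epsilon>) * K" if V: "\<And>a. V n a \<le> K" for n K
  proof -
    have "V (Suc n) (bl s0) \<le> (\<Sum>s\<in>into (bl s0). prob s * u s * K)"
      unfolding V_Suc using V prob_pos by (intro sum_mono mult_left_mono) (auto simp: less_imp_le u_exp)
    also have "\<dots> \<le> (\<Sum>s\<in>into (bl s0). prob s * K - (if s = s0 then \<epsilon> * K else 0))"
    proof (rule sum_mono)
      fix s assume s: "s \<in> into (bl s0)"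
      have "prob s * u s * K \<le> prob s * 1 * K"
        using u_le_1[of s] s prob_pos[of s] K0[OF V] by (intro mult_right_mono mult_left_mono) auto
      then show "prob s * u s * K \<le> prob s * K - (if s = s0 then \<epsilon> * K else 0)"
        by (auto simp: \<epsilon>_def algebra_simps)
    qed
    also have "\<dots> = K - \<epsilon> * K"
      using s0 finite_idx sum_prob[of "bl s0"] by (simp add: sum_subtractf sum_distrib_right[symmetric])
    finally show ?thesis by (simp add: algebra_simps)
  qed
  have two: "V (Suc (Suc n)) b \<le> q * K" if V: "\<And>a. V n a \<le> K" for n K b
  proof -
    obtain s1 where s1: "s1 \<in> idx" "fst s1 = bl s0" "bl s1 = b" using ex_idx by blast
    have "V (Suc (Suc n)) b \<le> (\<Sum>s\<in>into b. prob s * 1 * V (Suc n) (fst s))"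
      unfolding V_Suc[of "Suc n"] using u_le_1 prob_pos V_nonneg
      by (intro sum_mono mult_right_mono mult_left_mono) (auto simp: less_imp_le)
    also have "\<dots> \<le> (\<Sum>s\<in>into b. prob s * K - (if s = s1 then pm * \<epsilon> * K else 0))"
    proof (rule sum_mono)
      fix s assume s: "s \<in> into b"
      show "prob s * 1 * V (Suc n) (fst s) \<le> prob s * K - (if s = s1 then pm * \<epsilon> * K else 0)"
      proof (cases "s = s1")
        case False
        then show ?thesis using le[OF V, where b = "fst s"] prob_pos[of s] by simp
      next
        case True
        have "prob s * V (Suc n) (fst s) \<le> prob s * ((1 - \<epsilon>) * K)"
          using b0[OF V] True s1 prob_pos[of s] by simp
        also have "\<dots> = prob s * K - prob s * (\<epsilon> * K)" by (simp add: algebra_simps)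
        also have "\<dots> \<le> prob s * K - pm * (\<epsilon> * K)"
          using pm[of s] s \<epsilon>0 K0[OF V] by (intro diff_left_mono mult_right_mono) auto
        finally show ?thesis using True by (simp add: mult.assoc)
      qed
    qed
    also have "\<dots> = K - pm * \<epsilon> * K"
      using s1 finite_idx sum_prob[of b] by (simp add: sum_subtractf sum_distrib_right[symmetric])
    finally show ?thesis by (simp add: q_def algebra_simps)
  qed
  define \<theta> where "\<theta> = sqrt q"
  have \<theta>: "0 < \<theta>" "\<theta> < 1" "\<theta> * \<theta> = q" using q0 q1 by (auto simp: \<theta>_def)
  have "V n b \<le> 1 / \<theta> * \<theta> ^ n \<and> V (Suc n) b \<le> 1 / \<theta> * \<theta> ^ Suc n" for n b
  proof (induction n arbitrary: b)
    case 0
    have "V (Suc 0) b \<le> 1" by (rule le) (simp add: V_0)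
    then show ?case using \<theta> by (simp add: V_0)
  next
    case (Suc n)
    have "V (Suc (Suc n)) b \<le> q * (1 / \<theta> * \<theta> ^ n)" by (rule two) (use Suc in blast)
    then show ?case using Suc[of b] \<theta>(1) \<theta>(3)[symmetric] by (simp add: mult_ac)
  qed
  then show ?thesis using \<theta> by (intro exI[of _ \<theta>] exI[of _ "1 / \<theta>"]) auto
qed

text \<open>The potential lies between \<open>- wmax\<close> and 0, so removing it from
  \<open>V\<close> costs at most the factor \<open>exp wmax\<close>.\<close>

lemma sum_squares:
  "\<exists>\<theta> C. 0 < \<theta> \<and> \<theta> < 1 \<and> 0 < C \<and>
     (\<forall>n. sqsum m n \<le> C * \<theta> ^ n * exp (- real n * \<xi>))"
proof -
  obtain \<theta> C where \<theta>: "0 < \<theta>" "\<theta> < 1" "0 < C" and V: "\<And>n b. V n b \<le> C * \<theta> ^ n" using V_decay by blast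
  have mass_le_1: "mass b \<le> 1" for b
    unfolding sum_mass[symmetric] by (rule member_le_sum) (auto simp: less_imp_le mass_pos)
  have "sqsum m n \<le> real CARD('a) * exp wmax * C * \<theta> ^ n * exp (- real n * \<xi>)" for n
  proof -
    have "sqsum m n \<le>
        (\<Sum>b\<in>UNIV. \<Sum>p\<in>adms b n. exp wmax * exp (- real n * \<xi>) * exp (real n * \<xi> + g (endl b p) - g b - 2 * pw p))"
      unfolding sqsum_def
    proof (intro sum_mono)
      fix b p assume "p \<in> adms b n"
      then have p: "adm b p" by (simp add: adms_def)
      have "(measure m (cyl b p))\<^sup>2 = (mass b)\<^sup>2 * exp (- 2 * pw p)"
        using measure_cyl_m[OF p] by (simp add: power_mult_distrib exp_double[symmetric])
      also have "\<dots> \<le> 1 * exp (- 2 * pw p)"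
        using mass_le_1[of b] mass_pos[of b] by (intro mult_right_mono power_le_one) (auto simp: less_imp_le)
      also have "\<dots> \<le> exp wmax * exp (- real n * \<xi>) * exp (real n * \<xi> + g (endl b p) - g b - 2 * pw p)"
        using g_ge[of "endl b p"] g_le_0[of b] by (simp add: mult_exp_exp)
      finally show "(measure m (cyl b p))\<^sup>2 \<le> exp wmax * exp (- real n * \<xi>) * exp (real n * \<xi> + g (endl b p) - g b - 2 * pw p)" .
    qed
    also have "\<dots> = exp wmax * exp (- real n * \<xi>) * (\<Sum>b\<in>UNIV. V n b)"
      by (simp add: V_def sum_distrib_left)
    also have "\<dots> \<le> exp wmax * exp (- real n * \<xi>) * (\<Sum>b\<in>(UNIV::'a set). C * \<theta> ^ n)"
      by (intro mult_left_mono sum_mono V) auto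
    finally show ?thesis by (simp add: mult_ac)
  qed
  moreover have "0 < real CARD('a) * exp wmax * C" using \<theta> by simp
  ultimately show ?thesis using \<theta> by blast
qed

end

section \<open>Dimension and Hoelder exponent\<close>

context selfsim
begin

section \<open>Lengths of cylinders and lower bounds for the dimension\<close>

definition lmin :: real where "lmin = Min (range (\<lambda>a. len T $ a))"

lemma lmin_pos: "0 < lmin"
  unfolding lmin_def using len_pos[OF f] by (subst Min_gr_iff) auto

lemma lmin_le: "lmin \<le> len T $ a"
  unfolding lmin_def by (intro Min_le) auto

lemma len_le_1: "len T $ a \<le> 1"
  unfolding tot_T[symmetric] using len_pos[OF f] by (intro member_le_sum) (auto simp: less_imp_le)

lemma cyl_unit: "adm b p \<Longrightarrow> cyl b p \<subseteq> {0..<1}"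
  using cyl_sub ivl_Un by blast

lemma cyl_at:
  assumes "x \<in> {0..<1}"
  obtains b p c l where "p \<in> adms b n" "cyl b p = {c..<c + l}" "x \<in> cyl b p" "lmin / r ^ n \<le> l" "l \<le> 1 / r ^ n"
proof -
  obtain b where "x \<in> ivl T b" using assms ivl_Un by blast
  then obtain p where p: "p \<in> adms b n" "x \<in> cyl b p" using cyl_cover by blast
  then have a: "adm b p" "length p = n" by (auto simp: adms_def)
  obtain c where "cyl b p = {c..<c + len T $ endl b p / r ^ n}" using cyl_interval[OF a(1)] a(2) by auto
  then show thesis using that p lmin_le len_le_1 r_pos by (simp add: divide_right_mono)
qed

text \<open>The cylinders of level \<open>n\<close> tile the unit interval and each has length at
  least \<open>lmin / r ^ n\<close>; the second one starts where the first ends.\<close>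

lemma two_cyl:
  assumes x: "x \<in> {0..<1}" and e: "\<epsilon> \<le> lmin / r ^ n"
  shows "\<exists>b1 p1 b2 p2. p1 \<in> adms b1 n \<and> p2 \<in> adms b2 n \<and> {x..<x + \<epsilon>} \<inter> {0..<1} \<subseteq> cyl b1 p1 \<union> cyl b2 p2"
proof -
  obtain b p a l where 1: "p \<in> adms b n" "cyl b p = {a..<a + l}" "x \<in> cyl b p" "lmin / r ^ n \<le> l"
    using cyl_at[OF x] by metis
  show ?thesis
  proof (cases "1 \<le> a + l")
    case True
    then have "{x..<x + \<epsilon>} \<inter> {0..<1} \<subseteq> cyl b p" using 1 by auto
    then show ?thesis using 1 by blast
  next
    case False
    then have "a + l \<in> {0..<1}" using x 1 by auto
    then obtain b' p' a' l' where 2: "p' \<in> adms b' n" "cyl b' p' = {a'..<a' + l'}" "a + l \<in> cyl b' p'" "lmin / r ^ n \<le> l'"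
      using cyl_at by metis
    have "a' = a + l"
    proof (rule ccontr)
      assume "a' \<noteq> a + l"
      then have "max a a' \<in> cyl b p" "max a a' \<in> cyl b' p'" using 1 2 by auto
      then have "b = b' \<and> p = p'" using cyl_disjoint[OF 1(1) 2(1)] by blast
      then show False using 1 2 by auto
    qed
    then have "{x..<x + \<epsilon>} \<inter> {0..<1} \<subseteq> cyl b p \<union> cyl b' p'" using 1 2 e by auto
    then show ?thesis using 1(1) 2(1) by blast
  qed
qed

lemma scale_ex:
  assumes "0 < \<delta>" "\<delta> < lmin"
  shows "\<exists>n. lmin / r ^ Suc n \<le> \<delta> \<and> \<delta> < lmin / r ^ n"
proof -
  obtain k where k: "lmin / \<delta> < r ^ k" using real_arch_pow[OF r_gt_1] by blast
  define P where "P n \<longleftrightarrow> lmin / r ^ n \<le> \<delta>" for n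
  have "P k" using k assms r_pos by (simp add: P_def field_simps)
  then have L: "P (Least P)" and nL: "\<And>n. n < Least P \<Longrightarrow> \<not> P n" by (auto intro: LeastI dest: not_less_Least)
  have "Least P \<noteq> 0"
  proof
    assume "Least P = 0"
    then have "P 0" using L by simp
    then show False using assms by (simp add: P_def)
  qed
  then obtain n where n: "Least P = Suc n" by (cases "Least P") auto
  show ?thesis using L nL[of n] unfolding n P_def by (intro exI[of _ n]) auto
qed

lemma scale_powr:
  assumes "lmin / r ^ Suc n \<le> \<delta>" "0 \<le> s"
  shows "r powr (- s * real n) \<le> (r / lmin) powr s * \<delta> powr s"
proof -
  have \<delta>: "0 \<le> \<delta>" using assms(1) lmin_pos r_pos by (meson divide_nonneg_pos less_imp_le order_trans zero_less_power)
  have "1 / r ^ n \<le> (r / lmin) * \<delta>" using assms(1) lmin_pos r_pos by (simp add: field_simps)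
  then have "(1 / r ^ n) powr s \<le> ((r / lmin) * \<delta>) powr s" using assms(2) r_pos by (intro powr_mono2) auto
  moreover have "(1 / r ^ n) powr s = r powr (- s * real n)"
    using r_pos by (simp add: powr_realpow[symmetric] powr_minus_divide[symmetric] powr_powr mult.commute)
  moreover have "((r / lmin) * \<delta>) powr s = (r / lmin) powr s * \<delta> powr s"
    by (rule powr_mult)
  ultimately show ?thesis by simp
qed

text \<open>The bound on the squares makes the mass of the cylinders of level \<open>n\<close> heavier than \<open>r powr (- s n)\<close>
  summable (Chebyshev), and the mass distribution principle applies to what remains.\<close>

lemma hausdorff_measure_pos:
  assumes fin: "finite_measure \<nu>" and sets: "sets \<nu> = sets borel" and one: "measure \<nu> {0..<1} = 1"
    and U1: "measure \<nu> UNIV = 1"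
    and sq: "\<And>n. sqsum \<nu> n \<le> D * \<eta> ^ n"
    and \<eta>: "0 < \<eta>" and s: "0 < s" and \<eta>s: "\<eta> * r powr s < 1"
    and E: "E \<in> sets borel" "measure \<nu> E = 1"
  shows "hausdorff_measure s E \<noteq> 0"
proof -
  interpret finite_measure \<nu> by (rule fin)
  have space: "space \<nu> = UNIV" using sets_eq_imp_space_eq[OF sets] by simp
  \<comment> \<open>Ratio of the geometric series that bounds the masses of the heavy
    cylinders.\<close>
  define \<beta> where "\<beta> = \<eta> * r powr s"
  have \<beta>: "0 < \<beta>" "\<beta> < 1" using \<eta> \<eta>s r_pos by (auto simp: \<beta>_def)
  define thr where "thr n = r powr (- s * real n)" for n
  have thr0: "0 < thr n" for n using r_pos by (simp add: thr_def)
  define BP where "BP n = {(b, p). p \<in> adms b n \<and> thr n < measure \<nu> (cyl b p)}" for n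
  have BPs: "BP n = Sigma UNIV (\<lambda>b. {p\<in>adms b n. thr n < measure \<nu> (cyl b p)})" for n
    by (auto simp: BP_def)
  have finBP: "finite (BP n)" for n unfolding BPs by (auto simp: finite_adms)
  define bad where "bad n = (\<Union>(b, p)\<in>BP n. cyl b p)" for n
  have cylb: "cyl b p \<in> sets \<nu>" if "p \<in> adms b n" for b p n using cyl_borel that sets by (auto simp: adms_def)
  have bad_sets: "bad n \<in> sets \<nu>" for n
    unfolding bad_def using finBP by (intro sets.finite_UN) (auto simp: BP_def cylb)
  have bad_le: "measure \<nu> (bad n) \<le> D * \<beta> ^ n" for n
  proof -
    have "measure \<nu> (bad n) \<le> (\<Sum>i\<in>BP n. measure \<nu> (case i of (b, p) \<Rightarrow> cyl b p))"
      unfolding bad_def using finBP by (intro finite_measure_subadditive_finite) (auto simp: BP_def cylb)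
    also have "\<dots> \<le> (\<Sum>i\<in>BP n. (measure \<nu> (case i of (b, p) \<Rightarrow> cyl b p))\<^sup>2 / thr n)"
    proof (rule sum_mono)
      fix i assume "i \<in> BP n"
      then obtain b p where i: "i = (b, p)" "thr n < measure \<nu> (cyl b p)" by (auto simp: BP_def)
      have "measure \<nu> (cyl b p) * thr n \<le> (measure \<nu> (cyl b p))\<^sup>2"
        using i(2) unfolding power2_eq_square by (intro mult_left_mono) auto
      then show "measure \<nu> (case i of (b, p) \<Rightarrow> cyl b p) \<le> (measure \<nu> (case i of (b, p) \<Rightarrow> cyl b p))\<^sup>2 / thr n"
        using i thr0[of n] by (simp add: field_simps)
    qed
    also have "\<dots> = (\<Sum>b\<in>UNIV. \<Sum>p\<in>{p\<in>adms b n. thr n < measure \<nu> (cyl b p)}. (measure \<nu> (cyl b p))\<^sup>2 / thr n)"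
      unfolding BPs by (subst sum.Sigma) (auto simp: finite_adms intro!: sum.cong)
    also have "\<dots> \<le> (\<Sum>b\<in>UNIV. \<Sum>p\<in>adms b n. (measure \<nu> (cyl b p))\<^sup>2 / thr n)"
      using thr0[of n] by (intro sum_mono sum_mono2) (auto simp: finite_adms less_imp_le)
    also have "\<dots> = sqsum \<nu> n / thr n"
      by (simp add: sqsum_def sum_divide_distrib)
    also have "\<dots> \<le> D * \<eta> ^ n / thr n" using sq[of n] thr0[of n] by (intro divide_right_mono) (auto simp: less_imp_le)
    also have "\<dots> = D * \<beta> ^ n"
      using r_pos by (simp add: thr_def \<beta>_def power_mult_distrib powr_minus field_simps powr_powr[symmetric] powr_realpow)
    finally show ?thesis .
  qed
  have "(\<lambda>n. D / (1 - \<beta>) * \<beta> ^ n) \<longlonglongrightarrow> D / (1 - \<beta>) * 0"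
    using \<beta> by (intro tendsto_mult tendsto_const LIMSEQ_realpow_zero) auto
  then have "\<forall>\<^sub>F n in sequentially. D / (1 - \<beta>) * \<beta> ^ n < 1/2"
    by (intro order_tendstoD) auto
  then obtain n0 where n0: "D / (1 - \<beta>) * \<beta> ^ n0 < 1/2" by (auto simp: eventually_sequentially)
  define B where "B = (\<Union>i. bad (n0 + i))"
  have B_sets: "B \<in> sets \<nu>" unfolding B_def using bad_sets by auto
  have sumD: "(\<lambda>i. D * \<beta> ^ (n0 + i)) sums (D / (1 - \<beta>) * \<beta> ^ n0)"
    using sums_mult[OF geometric_sums[of \<beta>], of "D * \<beta> ^ n0"] \<beta> by (simp add: power_add mult_ac)
  have summ: "summable (\<lambda>i. measure \<nu> (bad (n0 + i)))"
    by (rule summable_comparison_test'[OF sums_summable[OF sumD]]) (use bad_le in auto)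
  have "measure \<nu> B \<le> (\<Sum>i. measure \<nu> (bad (n0 + i)))"
    unfolding B_def using bad_sets by (intro finite_measure_subadditive_countably summ) auto
  also have "\<dots> \<le> (\<Sum>i. D * \<beta> ^ (n0 + i))"
    by (intro suminf_le bad_le summ sums_summable[OF sumD])
  also have "\<dots> < 1/2" using sums_unique[OF sumD] n0 by simp
  finally have Bhalf: "measure \<nu> B < 1/2" .
  define G where "G = E \<inter> {0..<1} - B"
  have E': "E \<in> sets \<nu>" "{0..<1} \<in> sets \<nu>" using E sets by auto
  have G_sets: "G \<in> sets \<nu>" unfolding G_def using E' B_sets by auto
  have Ghalf: "1/2 \<le> measure \<nu> G"
  proof -
    have "1 = measure \<nu> ((G \<union> B) \<union> (UNIV - E) \<union> (UNIV - {0..<1}))"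
    proof -
      have "(G \<union> B) \<union> (UNIV - E) \<union> (UNIV - {0..<1}) = UNIV" by (auto simp: G_def)
      then show ?thesis using U1 by simp
    qed
    also have "\<dots> \<le> measure \<nu> ((G \<union> B) \<union> (UNIV - E)) + measure \<nu> (UNIV - {0..<1})"
      using G_sets B_sets E' sets by (intro measure_Un_le) auto
    also have "\<dots> \<le> measure \<nu> G + measure \<nu> B + measure \<nu> (UNIV - E) + measure \<nu> (UNIV - {0..<1})"
      using measure_Un_le[of "G \<union> B" \<nu> "UNIV - E"] measure_Un_le[of G \<nu> B] G_sets B_sets E' sets by auto
    also have "measure \<nu> (UNIV - E) = 0" using finite_measure_compl[OF E'(1)] E(2) U1 by (simp add: space)
    also have "measure \<nu> (UNIV - {0..<1}) = 0" using finite_measure_compl[OF E'(2)] one U1 by (simp add: space)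
    finally show ?thesis using Bhalf by simp
  qed
  have good: "measure \<nu> (cyl b p) \<le> thr n" if "p \<in> adms b n" "n0 \<le> n" "y \<in> cyl b p" "y \<in> G" for b p n y
  proof (rule ccontr)
    assume "\<not> measure \<nu> (cyl b p) \<le> thr n"
    then have "(b, p) \<in> BP n" using that(1) by (simp add: BP_def)
    then have "y \<in> bad n" using that(3) unfolding bad_def by blast
    then have "y \<in> B" using that(2) by (auto simp: B_def intro!: exI[of _ "n - n0"])
    then show False using that(4) by (simp add: G_def)
  qed
  define K where "K = 2 * (r / lmin) powr s"
  have K0: "0 < K" using r_pos lmin_pos by (simp add: K_def)
  \<comment> \<open>The mass distribution estimate. Covering sets may be arbitrary, so the mass is
    that of a Borel set \<open>S\<close> containing the part in \<open>G\<close>.\<close>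
  have piece: "\<exists>S\<in>sets \<nu>. X \<inter> G \<subseteq> S \<and> measure \<nu> S \<le> K * diameter X powr s"
    if X: "bounded X" "diameter X \<le> lmin / r ^ Suc n0" for X
  proof (cases "X \<inter> G = {}")
    case True
    then show ?thesis using K0 by (intro bexI[of _ "{}"]) auto
  next
    case False
    then obtain y where y: "y \<in> X" "y \<in> G" by auto
    have y01: "y \<in> {0..<1}" using y by (simp add: G_def)
    have dist: "\<bar>z - y'\<bar> \<le> diameter X" if "z \<in> X" "y' \<in> X" for z y'
      using diameter_bounded_bound[OF X(1) that] by (simp add: dist_real_def)
    show ?thesis
    proof (cases "diameter X = 0")
      case True
      \<comment> \<open>The bound to be met is 0, as \<open>0 powr s = 0\<close>. The cylinders
        around a point of \<open>G\<close> have mass at most \<open>thr\<close> at all levels from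
        \<open>n0\<close> on, so the point is null.\<close>
      have "measure \<nu> {y} \<le> thr (n0 + n)" for n
      proof -
        obtain b p c l where "p \<in> adms b (n0 + n)" "cyl b p = {c..<c + l}" "y \<in> cyl b p"
          using cyl_at[OF y01, of "n0 + n"] by metis
        then show ?thesis using good[of p b "n0 + n" y] y finite_measure_mono[of "{y}" "cyl b p"] cylb by fastforce
      qed
      moreover have "(\<lambda>n. thr (n0 + n)) \<longlonglongrightarrow> 0"
      proof -
        have "thr = (\<lambda>n. (r powr (- s)) ^ n)"
          using r_pos by (intro ext) (simp add: thr_def powr_realpow[symmetric] powr_powr)
        moreover have "r powr (- s) < 1" using r_gt_1 s powr_less_mono[of "- s" 0 r] by simp
        ultimately have "thr \<longlonglongrightarrow> 0" using r_pos by (simp only:) (rule LIMSEQ_realpow_zero, auto)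
        then show ?thesis using LIMSEQ_ignore_initial_segment[of thr 0 n0] by (simp add: add.commute)
      qed
      ultimately have "measure \<nu> {y} \<le> 0" by (intro LIMSEQ_le_const[of _ 0]) auto
      moreover have "X \<inter> G \<subseteq> {y}" using dist[OF _ y(1)] True by auto
      ultimately show ?thesis using True sets by (intro bexI[of _ "{y}"]) auto
    next
      case F: False
      define \<delta> where "\<delta> = diameter X"
      have \<delta>0: "0 < \<delta>" using F diameter_ge_0[OF X(1)] by (simp add: \<delta>_def)
      have rn0: "1 < r ^ Suc n0" using r_gt_1 by (intro one_less_power) auto
      have "lmin / r ^ Suc n0 < lmin" using rn0 lmin_pos r_pos by (simp add: field_simps del: power_Suc)
      then obtain n where n: "lmin / r ^ Suc n \<le> \<delta>" "\<delta> < lmin / r ^ n"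
        using scale_ex[OF \<delta>0] X(2) by (auto simp: \<delta>_def)
      have "n0 \<le> n"
      proof (rule ccontr)
        assume "\<not> n0 \<le> n"
        then have "r ^ Suc n < r ^ Suc n0" using r_gt_1 by (intro power_strict_increasing) auto
        then have "lmin / r ^ Suc n0 < lmin / r ^ Suc n" using lmin_pos r_pos by (intro divide_strict_left_mono) auto
        then show False using n(1) X(2) by (simp add: \<delta>_def)
      qed
      define i where "i = Inf (X \<inter> G)"
      have bdd: "bdd_below (X \<inter> G)" using X(1) by (meson bounded_imp_bdd_below bdd_below_mono inf_le1)
      have il: "i \<le> z" if "z \<in> X \<inter> G" for z unfolding i_def using bdd that by (rule cInf_lower[rotated])
      have ig: "z - \<delta> \<le> i" if "z \<in> X \<inter> G" for z
        unfolding i_def using False dist[of z] that by (intro cInf_greatest) (fastforce simp: \<delta>_def abs_le_iff)+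
      have "0 \<le> i" unfolding i_def using False by (intro cInf_greatest) (auto simp: G_def)
      then have i01: "i \<in> {0..<1}" using il[of y] y y01 by auto
      obtain b1 p1 b2 p2 where p: "p1 \<in> adms b1 n" "p2 \<in> adms b2 n"
        and cov: "{i..<i + lmin / r ^ n} \<inter> {0..<1} \<subseteq> cyl b1 p1 \<union> cyl b2 p2"
        using two_cyl[OF i01 order_refl, of n] by blast
      have sub: "X \<inter> G \<subseteq> cyl b1 p1 \<union> cyl b2 p2"
      proof
        fix z assume z: "z \<in> X \<inter> G"
        then have "z \<in> {i..<i + lmin / r ^ n} \<inter> {0..<1}" using il[OF z] ig[OF z] n(2) by (auto simp: G_def)
        then show "z \<in> cyl b1 p1 \<union> cyl b2 p2" using cov by blast
      qed
      \<comment> \<open>The bound \<open>good\<close> holds for cylinders that meet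
        \<open>G\<close>; the others are dropped.\<close>
      define S where "S b p = (if cyl b p \<inter> G = {} then {} else cyl b p)" for b p
      have S: "S b p \<in> sets \<nu>" "measure \<nu> (S b p) \<le> thr n" if "p \<in> adms b n" for b p
        using good[OF that \<open>n0 \<le> n\<close>] cylb[OF that] thr0[of n] by (auto simp: S_def less_imp_le)
      have "measure \<nu> (S b1 p1 \<union> S b2 p2) \<le> measure \<nu> (S b1 p1) + measure \<nu> (S b2 p2)"
        using S p by (intro measure_Un_le) auto
      also have "\<dots> \<le> 2 * thr n" using S(2)[OF p(1)] S(2)[OF p(2)] by simp
      also have "\<dots> \<le> K * \<delta> powr s" using scale_powr[OF n(1), of s] s by (simp add: K_def thr_def)
      finally have "measure \<nu> (S b1 p1 \<union> S b2 p2) \<le> K * diameter X powr s" by (simp add: \<delta>_def)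
      moreover have "X \<inter> G \<subseteq> S b1 p1 \<union> S b2 p2" using sub by (auto simp: S_def)
      ultimately show ?thesis using S(1) p by (intro bexI[of _ "S b1 p1 \<union> S b2 p2"]) auto
    qed
  qed
  have pre: "ennreal (1 / (2 * K)) \<le> hausdorff_premeasure s (lmin / r ^ Suc n0) E"
    unfolding hausdorff_premeasure_def
  proof (rule Inf_greatest, clarify)
    fix U :: "nat \<Rightarrow> real set"
    assume U: "E \<subseteq> (\<Union>i. U i)" "\<forall>i. bounded (U i) \<and> diameter (U i) \<le> lmin / r ^ Suc n0"
    have "\<exists>S\<in>sets \<nu>. U i \<inter> G \<subseteq> S \<and> measure \<nu> S \<le> K * diameter (U i) powr s" for i
      using U(2) by (intro piece) auto
    then obtain S where S: "\<And>i. S i \<in> sets \<nu>" "\<And>i. U i \<inter> G \<subseteq> S i" "\<And>i. measure \<nu> (S i) \<le> K * diameter (U i) powr s"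
      by metis
    have "ennreal (1/2) \<le> emeasure \<nu> G" unfolding emeasure_eq_measure by (rule ennreal_leI[OF Ghalf])
    also have "\<dots> \<le> emeasure \<nu> (\<Union>i. S i)"
    proof (rule emeasure_mono)
      show "G \<subseteq> (\<Union>i. S i)" using U(1) S(2) by (force simp: G_def)
    qed (use S in auto)
    also have "\<dots> \<le> (\<Sum>i. emeasure \<nu> (S i))" using S by (intro emeasure_subadditive_countably) auto
    also have "\<dots> \<le> (\<Sum>i. ennreal K * ennreal (diameter (U i) powr s))"
    proof (rule suminf_le)
      show "emeasure \<nu> (S i) \<le> ennreal K * ennreal (diameter (U i) powr s)" for i
        using S(3)[of i] K0 by (simp add: emeasure_eq_measure ennreal_mult[symmetric] ennreal_leI)
    qed auto
    also have "\<dots> = ennreal K * (\<Sum>i. ennreal (diameter (U i) powr s))" by simp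
    finally have 1: "ennreal (1/2) \<le> ennreal K * (\<Sum>i. ennreal (diameter (U i) powr s))" .
    have "ennreal (1 / (2 * K)) = ennreal (1 / K * (1/2))" by (simp add: mult.commute)
    also have "\<dots> = ennreal (1 / K) * ennreal (1/2)" using K0 by (intro ennreal_mult) auto
    also have "\<dots> \<le> ennreal (1 / K) * (ennreal K * (\<Sum>i. ennreal (diameter (U i) powr s)))"
      by (rule mult_left_mono[OF 1]) simp
    also have "\<dots> = (\<Sum>i. ennreal (diameter (U i) powr s))"
      using K0 by (simp add: mult.assoc[symmetric] ennreal_mult[symmetric])
    finally show "ennreal (1 / (2 * K)) \<le> (\<Sum>i. ennreal (diameter (U i) powr s))" .
  qed
  have "0 < ennreal (1 / (2 * K))" using K0 by simp
  also have "\<dots> \<le> hausdorff_measure s E"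
    unfolding hausdorff_measure_def using pre lmin_pos r_pos
    by (intro SUP_upper2[of "lmin / r ^ Suc n0"]) auto
  finally show ?thesis by simp
qed

text \<open>If the \<open>s\<close>-dimensional measure of a set of full mass vanishes, then
  \<open>\<eta> * r powr s\<close> is at least 1, which bounds \<open>s\<close> from below.\<close>

lemma measure_hausdorff_dim_ge:
  assumes fin: "finite_measure \<nu>" and sets: "sets \<nu> = sets borel" and one: "measure \<nu> {0..<1} = 1"
    and U1: "measure \<nu> UNIV = 1"
    and sq: "\<And>n. sqsum \<nu> n \<le> D * \<eta> ^ n"
    and \<eta>: "0 < \<eta>"
  shows "ereal (- ln \<eta> / ln r) \<le> measure_hausdorff_dim \<nu>"
  unfolding measure_hausdorff_dim_def
proof (rule INF_greatest)
  fix E assume "E \<in> {E \<in> sets borel. emeasure \<nu> E = 1}"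
  then have E: "E \<in> sets borel" "measure \<nu> E = 1" by (auto simp: measure_def)
  show "ereal (- ln \<eta> / ln r) \<le> hausdorff_dim E"
    unfolding hausdorff_dim_def
  proof (rule INF_greatest)
    fix s assume "s \<in> {s. 0 < s \<and> hausdorff_measure s E = 0}"
    then have s: "0 < s" "hausdorff_measure s E = 0" by auto
    have "\<not> \<eta> * r powr s < 1"
      using hausdorff_measure_pos[OF fin sets one U1 sq \<eta> s(1) _ E] s(2) by blast
    then have "0 \<le> ln (\<eta> * r powr s)" by (intro ln_ge_zero) auto
    then have "0 \<le> ln \<eta> + s * ln r" using \<eta> r_pos by (simp add: ln_mult ln_powr)
    then show "ereal (- ln \<eta> / ln r) \<le> ereal s" using r_gt_1 by (simp add: field_simps)
  qed
qed

end

context central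
begin

text \<open>The rate in \<open>sum_squares\<close> has a factor \<theta> below 1 beside
  \<open>exp (- \<xi>)\<close>; this makes the inequality strict.\<close>

lemma dim_bound:
  assumes conf: "conf T v \<nu>" and one: "measure \<nu> {0..<1} = 1" and U1: "measure \<nu> UNIV = 1"
    and v: "v - c \<in> contracting_space M"
  shows "ereal (\<xi> / rho T N) < measure_hausdorff_dim \<nu>"
proof -
  obtain C where C: "0 < C" "\<And>b p. adm b p \<Longrightarrow> measure \<nu> (cyl b p) \<le> C * measure m (cyl b p)"
    using comparison[OF conf one v] by blast
  obtain \<theta> D where \<theta>: "0 < \<theta>" "\<theta> < 1"
    and D: "\<And>n. sqsum m n \<le> D * \<theta> ^ n * exp (- real n * \<xi>)"
    using sum_squares by blast
  define \<eta> where "\<eta> = \<theta> * exp (- \<xi>)"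
  have \<eta>0: "0 < \<eta>" using \<theta> by (simp add: \<eta>_def)
  have sq: "sqsum \<nu> n \<le> (C\<^sup>2 * D) * \<eta> ^ n" for n
  proof -
    have "sqsum \<nu> n \<le> (\<Sum>b\<in>UNIV. \<Sum>p\<in>adms b n. (C * measure m (cyl b p))\<^sup>2)"
      unfolding sqsum_def using C(2) by (intro sum_mono power_mono) (auto simp: adms_def)
    also have "\<dots> = C\<^sup>2 * sqsum m n"
      by (simp add: sqsum_def power_mult_distrib sum_distrib_left)
    also have "\<dots> \<le> C\<^sup>2 * (D * \<theta> ^ n * exp (- real n * \<xi>))" by (intro mult_left_mono D) auto
    also have "exp (- real n * \<xi>) = exp (- \<xi>) ^ n" by (simp add: exp_of_nat_mult[symmetric])
    finally show ?thesis by (simp add: \<eta>_def power_mult_distrib mult_ac)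
  qed
  have "ereal (- ln \<eta> / ln r) \<le> measure_hausdorff_dim \<nu>"
    using conf by (intro measure_hausdorff_dim_ge[OF _ _ one U1 sq \<eta>0]) (auto simp: conf_def)
  moreover have "\<xi> / rho T N < - ln \<eta> / ln r"
  proof -
    have "ln \<eta> = ln \<theta> - \<xi>" using \<theta> by (simp add: \<eta>_def ln_mult)
    moreover have "ln \<theta> < 0" using \<theta> by simp
    ultimately show ?thesis using rho_pos by (simp add: rho_eq divide_strict_right_mono)
  qed
  ultimately show ?thesis by (metis less_ereal.simps(1) less_le_trans)
qed

text \<open>Here \<open>h\<close> stands for the inverse of the conjugacy, the distribution function
  of \<mu>. Covering by two cylinders shows that the exponent is attained; cylinders of nearly
  minimal weight show that no larger one is possible.\<close>

lemma holder_eq: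
  assumes conf: "conf T v \<mu>" and one: "measure \<mu> {0..<1} = 1"
    and v: "v - c \<in> contracting_space M"
    and u: "\<And>y z. 0 \<le> y \<Longrightarrow> y \<le> z \<Longrightarrow> z \<le> 1 \<Longrightarrow> measure \<mu> {y..<z} = h z - h y"
  shows "holder_exponent h = ereal (\<xi> / rho T N)"
proof -
  obtain C where C: "0 < C" "\<And>b p. adm b p \<Longrightarrow> measure \<mu> (cyl b p) \<le> C * measure m (cyl b p)"
    "\<And>b p. adm b p \<Longrightarrow> measure m (cyl b p) \<le> C * measure \<mu> (cyl b p)"
    using comparison[OF conf one v] by blast
  interpret finite_measure \<mu> using conf by (simp add: conf_def)
  have sets: "sets \<mu> = sets borel" using conf by (simp add: conf_def)
  define a0 where "a0 = \<xi> / rho T N"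
  have a0: "0 < a0" using xi_pos rho_pos by (simp add: a0_def)
  have ra0: "r powr (- a0 * real n) = exp (- real n * \<xi>)" for n
    using r_gt_1 by (simp add: powr_def a0_def rho_eq)
  have mass_le_1: "mass b \<le> 1" for b
    unfolding sum_mass[symmetric] by (rule member_le_sum) (auto simp: less_imp_le mass_pos)
  have m_le: "measure m (cyl b p) \<le> exp wmax * exp (- real n * \<xi>)" if "p \<in> adms b n" for b p n
  proof -
    have p: "adm b p" "length p = n" using that by (auto simp: adms_def)
    have "mass b * exp (- pw p) \<le> 1 * exp (wmax - real n * \<xi>)"
      using mass_le_1[of b] mass_pos[of b] pw_lower[OF p(1)] p(2) by (intro mult_mono) auto
    then show ?thesis using measure_cyl_m[OF p(1)] by (simp add: mult_exp_exp)
  qed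
  \<comment> \<open>The first summand serves intervals of length at least \<open>lmin\<close>, the
    second those covered by two cylinders.\<close>
  define C1 where "C1 = lmin powr (- a0) + 2 * C * exp wmax * (r / lmin) powr a0"
  have C10: "0 < C1" using lmin_pos C(1) r_pos by (auto simp: C1_def intro!: add_pos_nonneg)
  have hold: "\<bar>h z - h y\<bar> \<le> C1 * \<bar>z - y\<bar> powr a0" if yz: "y < z" "0 \<le> y" "z \<le> 1" for y z
  proof -
    define \<delta> where "\<delta> = z - y"
    have \<delta>0: "0 < \<delta>" using yz by (simp add: \<delta>_def)
    have hm: "\<bar>h z - h y\<bar> = measure \<mu> {y..<z}" using u[of y z] yz measure_nonneg[of \<mu> "{y..<z}"] by simp
    have "measure \<mu> {y..<z} \<le> C1 * \<delta> powr a0"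
    proof (cases "\<delta> < lmin")
      case False
      have "measure \<mu> {y..<z} \<le> measure \<mu> {0..<1}"
        using yz sets by (intro finite_measure_mono) auto
      also have "\<dots> = lmin powr (- a0) * lmin powr a0" using one lmin_pos by (simp add: powr_add[symmetric])
      also have "\<dots> \<le> lmin powr (- a0) * \<delta> powr a0"
        using False lmin_pos a0 by (intro mult_left_mono powr_mono2) auto
      also have "\<dots> \<le> C1 * \<delta> powr a0"
        using C(1) by (intro mult_right_mono) (auto simp: C1_def)
      finally show ?thesis .
    next
      case True
      obtain n where n: "lmin / r ^ Suc n \<le> \<delta>" "\<delta> < lmin / r ^ n" using scale_ex[OF \<delta>0 True] by blast
      have "y \<in> {0..<1}" using yz by auto
      then obtain b1 p1 b2 p2 where p: "p1 \<in> adms b1 n" "p2 \<in> adms b2 n"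
        and cov: "{y..<y + \<delta>} \<inter> {0..<1} \<subseteq> cyl b1 p1 \<union> cyl b2 p2"
        using two_cyl[of y \<delta> n] n(2) by auto
      have "{y..<z} \<subseteq> {y..<y + \<delta>} \<inter> {0..<1}" using yz by (auto simp: \<delta>_def)
      then have "{y..<z} \<subseteq> cyl b1 p1 \<union> cyl b2 p2" using cov by blast
      moreover have cs: "cyl b1 p1 \<in> sets \<mu>" "cyl b2 p2 \<in> sets \<mu>" using p cyl_borel sets by (auto simp: adms_def)
      ultimately have "measure \<mu> {y..<z} \<le> measure \<mu> (cyl b1 p1 \<union> cyl b2 p2)"
        by (intro finite_measure_mono) auto
      also have "\<dots> \<le> measure \<mu> (cyl b1 p1) + measure \<mu> (cyl b2 p2)"
        using cs by (rule measure_Un_le)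
      also have "\<dots> \<le> C * measure m (cyl b1 p1) + C * measure m (cyl b2 p2)"
        using p C(2) by (intro add_mono) (auto simp: adms_def)
      also have "\<dots> \<le> C * (exp wmax * exp (- real n * \<xi>)) + C * (exp wmax * exp (- real n * \<xi>))"
        using C(1) by (intro add_mono mult_left_mono m_le p) auto
      also have "\<dots> = 2 * C * exp wmax * r powr (- a0 * real n)" unfolding ra0 by simp
      also have "\<dots> \<le> 2 * C * exp wmax * ((r / lmin) powr a0 * \<delta> powr a0)"
        using scale_powr[OF n(1), of a0] a0 C(1) by (intro mult_left_mono) auto
      also have "\<dots> \<le> C1 * \<delta> powr a0" by (simp add: C1_def algebra_simps)
      finally show ?thesis .
    qed
    then show ?thesis using hm \<delta>0 by (simp add: \<delta>_def)
  qed
  have hold': "\<bar>h z - h y\<bar> \<le> C1 * \<bar>z - y\<bar> powr a0" if "y \<in> {0..1}" "z \<in> {0..1}" for y z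
  proof -
    consider "y < z" | "z < y" | "y = z" by linarith
    then show ?thesis
    proof cases
      case 2
      then show ?thesis using hold[of z y] that by (simp add: abs_minus_commute)
    qed (use hold that in auto)
  qed
  \<comment> \<open>A path of minimal weight gives a cylinder of level \<open>n\<close> with mass at
    least a constant times \<open>exp (- real n * \<xi>)\<close> and length at most
    \<open>1 / r ^ n\<close>. An exponent above \<open>a0\<close> would keep
    \<open>exp (real n * t)\<close> bounded with \<open>t\<close> positive.\<close>
  have upper: "a \<le> a0" if a: "0 < a" and Cst: "0 < Cst" "\<forall>x\<in>{0..1}. \<forall>y\<in>{0..1}. \<bar>h y - h x\<bar> \<le> Cst * \<bar>y - x\<bar> powr a" for a Cst
  proof (rule ccontr)
    assume "\<not> a \<le> a0"
    define t where "t = a * rho T N - \<xi>"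
    have t0: "0 < t" using \<open>\<not> a \<le> a0\<close> rho_pos by (simp add: t_def a0_def field_simps)
    define xm where "xm = Min (range mass)"
    have xm: "0 < xm" "\<And>b. xm \<le> mass b" using mass_pos by (auto simp: xm_def)
    have "xm * exp (- wmax) * exp (real n * t) \<le> C * Cst" for n
    proof -
      obtain b p where p: "p \<in> adms b n" "pw p \<le> real n * \<xi> + wmax" using pw_upper by blast
      then have ad: "adm b p" "length p = n" by (auto simp: adms_def)
      obtain c0 where c0: "cyl b p = {c0..<c0 + len T $ endl b p / r ^ n}"
        using cyl_interval[OF ad(1)] ad(2) by auto
      define l where "l = len T $ endl b p / r ^ n"
      have l0: "0 < l" using len_pos[OF f] r_pos by (simp add: l_def)
      have l1: "l \<le> 1 / r ^ n" using len_le_1 r_pos by (simp add: l_def divide_right_mono)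
      have sub: "{c0..<c0 + l} \<subseteq> {0..<1}" using cyl_unit[OF ad(1)] c0 by (simp add: l_def)
      have c00: "0 \<le> c0" using sub l0 by (auto simp: subset_iff)
      have c01: "c0 + l \<le> 1" using atLeastLessThan_subset_iff[OF sub] l0 by auto
      have "xm * exp (- wmax - real n * \<xi>) \<le> mass b * exp (- pw p)"
        using xm p(2) mass_pos[of b] by (intro mult_mono) (auto simp: less_imp_le)
      also have "\<dots> = measure m (cyl b p)" using measure_cyl_m[OF ad(1)] by simp
      also have "\<dots> \<le> C * measure \<mu> (cyl b p)" by (rule C(3)[OF ad(1)])
      also have "\<dots> = C * (h (c0 + l) - h c0)"
        unfolding c0 l_def[symmetric] using u[of c0 "c0 + l"] c00 c01 l0 by simp
      also have "\<dots> \<le> C * (Cst * l powr a)"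
      proof -
        have "\<bar>h (c0 + l) - h c0\<bar> \<le> Cst * \<bar>c0 + l - c0\<bar> powr a"
          by (rule bspec[OF bspec[OF Cst(2), of c0], of "c0 + l"]) (use c00 c01 l0 in auto)
        then show ?thesis using C(1) l0 by (intro mult_left_mono) auto
      qed
      also have "\<dots> \<le> C * (Cst * (1 / r ^ n) powr a)"
        using C(1) Cst(1) l0 l1 a by (intro mult_left_mono powr_mono2) auto
      also have "(1 / r ^ n) powr a = exp (- real n * (a * rho T N))"
        using r_pos by (simp add: powr_def rho_eq ln_div ln_realpow)
      finally have "xm * exp (- wmax - real n * \<xi>) * exp (real n * (a * rho T N)) \<le> C * (Cst * exp (- real n * (a * rho T N))) * exp (real n * (a * rho T N))"
        by (intro mult_right_mono) auto
      then show ?thesis by (simp add: mult_exp_exp mult.assoc t_def algebra_simps)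
    qed
    then have bound: "exp (real n * t) \<le> C * Cst / (xm * exp (- wmax))" for n
      using xm(1) by (simp add: field_simps)
    obtain n where "C * Cst / (xm * exp (- wmax)) < real n * t" using reals_Archimedean3[OF t0] by blast
    then show False using bound[of n] exp_ge_add_one_self[of "real n * t"] by linarith
  qed
  show ?thesis
    unfolding holder_exponent_def a0_def[symmetric]
  proof (rule Sup_eqI)
    fix y assume "y \<in> ereal ` {a. 0 < a \<and> (\<exists>C>0. \<forall>x\<in>{0..1}. \<forall>y\<in>{0..1}. \<bar>h y - h x\<bar> \<le> C * \<bar>y - x\<bar> powr a)}"
    then show "y \<le> ereal a0" using upper by auto
  next
    fix y assume y: "\<And>z. z \<in> ereal ` {a. 0 < a \<and> (\<exists>C>0. \<forall>x\<in>{0..1}. \<forall>y\<in>{0..1}. \<bar>h y - h x\<bar> \<le> C * \<bar>y - x\<bar> powr a)} \<Longrightarrow> z \<le> y"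
    show "ereal a0 \<le> y"
      by (rule y, rule imageI) (use a0 C10 hold' in \<open>auto intro!: exI[of _ C1]\<close>)
  qed
qed

end

section \<open>The conjugacy\<close>

context renorm
begin

lemma word_length_Suc: "length (word f n a) \<le> length (word f (Suc n) a)"
  "a = loser (rv f n) \<Longrightarrow> length (word f n a) < length (word f (Suc n) a)"
  using word_nonempty[of f n] by (auto simp: loser_def split: rv_type.splits)

lemma word_length_mono: "m \<le> n \<Longrightarrow> length (word f m a) \<le> length (word f n a)"
  by (rule lift_Suc_mono_le[of "\<lambda>n. length (word f n a)"]) (rule word_length_Suc(1))

lemma word_no_loser:
  assumes "\<And>k. k < n \<Longrightarrow> a \<noteq> loser (rv f k)"
  shows "word f n a = [a]"
  using assms by (induction n) auto

end

context selfsim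
begin

lemma length_W: "2 \<le> length (W a)"
proof -
  obtain b where "b \<noteq> a" using ex_other by blast
  then have "card {a, b} = 2" by simp
  moreover have "card {a, b} \<le> card (set (W a))" using letter_in_W by (intro card_mono) auto
  ultimately show ?thesis using card_length[of "W a"] by linarith
qed

text \<open>The word of a period has at least two letters, so each letter loses at least once per
  period, and then its word grows. This makes the tower over 0 outlast any given time.\<close>

lemma word_length_ge: "k < length (word T (k * N) a)"
proof (induction k)
  case (Suc k)
  interpret R: renorm "rv T (k * N)" by (rule renorm_rv)
  have "\<exists>j<N. a = loser (rv (rv T (k * N)) j)"
  proof (rule ccontr)
    assume "\<not> ?thesis"
    then have "word (rv T (k * N)) N a = [a]" by (intro R.word_no_loser) auto
    then show False using length_W[of a] by (simp add: word_period)
  qed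
  then obtain j where j: "j < N" "a = loser (rv T (k * N + j))" by (auto simp: rv_add)
  have "length (word T (k * N) a) \<le> length (word T (k * N + j) a)" by (rule word_length_mono) simp
  also have "\<dots> < length (word T (Suc (k * N + j)) a)" by (rule word_length_Suc(2)[OF j(2)])
  also have "\<dots> \<le> length (word T (Suc k * N) a)" by (rule word_length_mono) (use j in simp)
  finally show ?case using Suc by simp
qed simp

section \<open>The orbit of 0\<close>

definition orb :: "real set" where "orb = range (\<lambda>i. (amap T ^^ i) 0)"

lemma zero_unit: "0 \<in> {0..<1::real}" by simp

lemma orb_unit: "orb \<subseteq> {0..<1}"
proof -
  have "(amap T ^^ i) 0 \<in> {0..<1}" for i
  proof (induction i)
    case (Suc i)
    then show ?case using amap_dom[OF f] unfolding dom_T by simp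
  qed simp
  then show ?thesis by (auto simp: orb_def)
qed

text \<open>Division by \<open>r\<close> conjugates \<open>T\<close> to its first return map and
  fixes 0, so it turns one step of the orbit into a return, that is, into several steps.\<close>

lemma orb_div: "o' \<in> orb \<Longrightarrow> o' / r \<in> orb"
proof -
  have "\<exists>j. (amap T ^^ i) 0 / r = (amap T ^^ j) 0" for i
  proof (induction i)
    case 0
    show ?case by (rule exI[of _ 0]) simp
  next
    case (Suc i)
    have "(amap T ^^ i) 0 \<in> {0..<1}" using orb_unit unfolding orb_def by blast
    then obtain a where a: "(amap T ^^ i) 0 \<in> ivl T a" using ivl_Un by blast
    obtain j where j: "(amap T ^^ i) 0 / r = (amap T ^^ j) 0" using Suc by blast
    have "amap T ((amap T ^^ i) 0) / r = (amap T ^^ length (W a)) ((amap T ^^ j) 0)"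
      using return_T[OF a] j by simp
    then show ?case by (intro exI[of _ "length (W a) + j"]) (simp add: funpow_add)
  qed
  then show "o' \<in> orb \<Longrightarrow> o' / r \<in> orb" by (auto simp: orb_def)
qed

lemma orb_branch: "o' \<in> orb \<Longrightarrow> branch s o' \<in> orb"
proof -
  assume "o' \<in> orb"
  then obtain j where "o' / r = (amap T ^^ j) 0" using orb_div by (auto simp: orb_def)
  then have "branch s o' = (amap T ^^ (snd s + j)) 0" by (simp add: branch_def funpow_add)
  then show ?thesis by (auto simp: orb_def)
qed

lemma orb_ivl: "\<exists>o'\<in>orb. o' \<in> ivl T b"
proof -
  obtain a where a: "0 \<in> ivl T a" using ivl_Un zero_unit by blast
  obtain s where s: "s \<in> idx" "fst s = a" "bl s = b" using ex_idx by blast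
  have "0 \<in> orb" by (auto simp: orb_def intro!: image_eqI[of _ _ 0])
  then show ?thesis using orb_branch[of 0 s] branch_in[OF s(1)] a s by blast
qed

lemma orb_cyl: "adm b p \<Longrightarrow> \<exists>o'\<in>orb. o' \<in> cyl b p"
proof (induction p arbitrary: b)
  case Nil
  then show ?case using orb_ivl by simp
next
  case (Cons s p)
  then obtain o' where "o' \<in> orb" "o' \<in> cyl (fst s) p" by auto
  then have "branch s o' \<in> orb" "branch s o' \<in> cyl b (s # p)" using orb_branch by auto
  then show ?case by blast
qed

text \<open>Branches map the orbit into itself, so every cylinder contains one of its points, and
  cylinders shrink.\<close>

lemma orb_dense:
  assumes "0 \<le> y" "y < z" "z \<le> 1"
  shows "\<exists>o'\<in>orb. y < o' \<and> o' < z"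
proof -
  obtain n where n: "2 / (z - y) < r ^ n" using real_arch_pow[OF r_gt_1] by blast
  then have l: "1 / r ^ n < (z - y) / 2" using assms r_pos by (simp add: field_simps)
  have "(y + z) / 2 \<in> {0..<1}" using assms by auto
  then obtain b p c k where p: "p \<in> adms b n" "cyl b p = {c..<c + k}" "(y + z) / 2 \<in> cyl b p" "k \<le> 1 / r ^ n"
    using cyl_at by metis
  have "adm b p" using p(1) by (simp add: adms_def)
  then obtain o' where o': "o' \<in> orb" "o' \<in> cyl b p" using orb_cyl by blast
  have "c \<le> o'" "o' < c + k" "c \<le> (y + z) / 2" "(y + z) / 2 < c + k" using p(2,3) o'(2) by auto
  then have "\<bar>o' - (y + z) / 2\<bar> < k" unfolding abs_less_iff by linarith
  then have "\<bar>o' - (y + z) / 2\<bar> < (z - y) / 2" using p(4) l by linarith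
  then have "y < o'" "o' < z" by (auto simp: abs_less_iff field_simps)
  then show ?thesis using o'(1) by blast
qed

end

locale conjugate = selfsim T N for T :: "'a::finite aiet" and N +
  fixes f' :: "'a aiet" and \<omega> :: "real ^ 'a" and h :: "real \<Rightarrow> real"
  assumes Aff: "f' \<in> Aff T \<omega>" and conj: "conjugacy f' T h"
begin

lemma f': "is_aiet f'" and dom_f': "dom_ivl f' = {0..<1}" and slope_f': "slope f' = \<omega>"
  and rot_f': "rotation_number f' = rotation_number T" and inf_f': "infinitely_renormalizable f'"
  using Aff by (auto simp: Aff_def)

sublocale F: renorm f'
  using f' d inf_f' by unfold_locales

lemma h_mono: "x \<in> {0..<1} \<Longrightarrow> y \<in> {0..<1} \<Longrightarrow> x < y \<Longrightarrow> h x < h y"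
  using conj by (auto simp: conjugacy_def strict_mono_on_def)

lemma h_1: "h 1 = 1" and h_conj: "x \<in> {0..<1} \<Longrightarrow> h (amap f' x) = amap T (h x)"
  using conj by (auto simp: conjugacy_def)

lemma h_image: "h ` {0..<1} = {0..<1}" and h_cont: "continuous_on {0..<1} h"
  using conj by (auto simp: conjugacy_def homeomorphism_def)

lemma h_in: "x \<in> {0..<1} \<Longrightarrow> h x \<in> {0..<1}"
  using h_image by blast

lemma h_less_iff: "x \<in> {0..<1} \<Longrightarrow> y \<in> {0..<1} \<Longrightarrow> h x < h y \<longleftrightarrow> x < y"
  using h_mono[of x y] h_mono[of y x] by (metis less_asym linorder_less_linear)

lemma h_inj: "x \<in> {0..<1} \<Longrightarrow> y \<in> {0..<1} \<Longrightarrow> h x = h y \<Longrightarrow> x = y"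
  using h_less_iff by (metis less_irrefl linorder_less_linear)

lemma h_0: "h 0 = 0"
proof -
  obtain x where x: "x \<in> {0..<1}" "h x = 0" using h_image by (metis imageE zero_unit)
  have "\<not> 0 < x" using h_mono[of 0 x] x h_in[of 0] by auto
  then show ?thesis using x by auto
qed

lemma f'_unit: "x \<in> {0..<1} \<Longrightarrow> amap f' x \<in> {0..<1}"
  using amap_dom[OF f'] unfolding dom_f' .

lemma h_orbit: "(amap f' ^^ i) 0 \<in> {0..<1} \<and> h ((amap f' ^^ i) 0) = (amap T ^^ i) 0"
  by (induction i) (use h_0 h_conj f'_unit in auto)

lemma word_f': "word f' n = word T n"
  by (rule word_cong) (simp add: rot_f')

text \<open>At every level 0 is the left end of the interval that is first on top, with the same
  letter and the same word for both maps. At level \<open>i * N\<close> this word is longer than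
  \<open>i\<close>.\<close>

lemma itinerary: "\<exists>a. (amap f' ^^ i) 0 \<in> ivl f' a \<and> (amap T ^^ i) 0 \<in> ivl T a"
proof -
  let ?n = "i * N"
  have 0: "0 \<in> ivl (rv g ?n) e" if g: "renorm g" and e: "ptop (rv g ?n) e = 1" for g :: "'a aiet" and e
  proof -
    interpret g: renorm g by (rule g)
    have "top_left (rv g ?n) e = 0"
      using lft_first[OF bij_ptop[OF g.aiet_rv] e] by (simp add: top_left_lft)
    then show ?thesis using len_pos[OF g.aiet_rv] by (simp add: ivl_def)
  qed
  have "1 \<in> range (ptop (rv T ?n))" using bij_ptop[OF aiet_rv] by (simp add: bij_betw_def Suc_le_eq)
  then obtain e where e: "ptop (rv T ?n) e = 1" by (metis imageE)
  have "ptop (rv f' ?n) = ptop (rv T ?n)"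
    using fun_cong[OF rot_f', of ?n] by (simp add: rotation_number_def)
  then have "0 \<in> ivl (rv f' ?n) e" using 0[OF F.renorm_axioms] e by simp
  moreover have "0 \<in> ivl (rv T ?n) e" using 0[OF renorm_axioms e] .
  moreover have "i < length (word T ?n e)" by (rule word_length_ge)
  ultimately show ?thesis using F.tower(1)[of 0 ?n e i] tower(1)[of 0 ?n e i] by (auto simp: word_f')
qed

text \<open>\<open>h\<close> maps the orbit of \<open>0\<close> under \<open>f'\<close> to its orbit under \<open>T\<close>, which is dense and has the same itinerary.\<close>

lemma h_ivl:
  assumes x: "x \<in> {0..<1}"
  shows "x \<in> ivl f' a \<longleftrightarrow> h x \<in> ivl T a"
proof -
  have *: "c = b" if c: "x \<in> ivl f' c" and b: "h x \<in> ivl T b" for c b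
  proof -
    \<comment> \<open>Intervals are left-closed, so points slightly to the right of \<open>x\<close>
      and of \<open>h x\<close> stay in them. \<open>y\<close> and \<open>z\<close> mark how far; an
      orbit point between \<open>h x\<close> and \<open>z\<close> settles the letters.\<close>
    define y where "y = (x + (top_left f' c + len f' $ c)) / 2"
    have y: "x < y" "y \<in> ivl f' c" using c by (auto simp: y_def ivl_def)
    have y01: "y \<in> {0..<1}" using y ivl_subset_dom[OF f'] dom_f' by blast
    define z where "z = min (h y) (top_left T b + len T $ b)"
    have "h x < z" using h_mono[OF x y01 y(1)] b by (auto simp: z_def ivl_def)
    moreover have "z \<le> 1" using h_in[OF y01] by (simp add: z_def min_le_iff_disj)
    ultimately obtain i where i: "h x < (amap T ^^ i) 0" "(amap T ^^ i) 0 < z"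
      using orb_dense[of "h x" z] h_in[OF x] by (auto simp: orb_def)
    let ?p = "(amap f' ^^ i) 0"
    have p: "?p \<in> {0..<1}" "h ?p = (amap T ^^ i) 0" using h_orbit by auto
    have "x < ?p" "?p < y" using i p h_less_iff[OF x p(1)] h_less_iff[OF p(1) y01] by (auto simp: z_def)
    then have pc: "?p \<in> ivl f' c" using c y(2) by (auto simp: ivl_def)
    obtain a where "?p \<in> ivl f' a" "(amap T ^^ i) 0 \<in> ivl T a" using itinerary by blast
    moreover have "(amap T ^^ i) 0 \<in> ivl T b" using i b by (auto simp: ivl_def z_def)
    ultimately show ?thesis using pc ivl_unique[OF f'] ivl_unique[OF f] by blast
  qed
  obtain c where c: "x \<in> ivl f' c" using ivl_cover[OF f'] x dom_f' by blast
  obtain b where b: "h x \<in> ivl T b" using h_in[OF x] ivl_Un by blast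
  show ?thesis using *[OF c b] *[of a b] *[of c a] b c by blast
qed

section \<open>The image of Lebesgue measure under the conjugacy\<close>

definition \<mu> :: "real measure" where
  "\<mu> = distr (restrict_space lborel {0..<1}) borel h"

lemma h_meas: "h \<in> borel_measurable (restrict_space lborel {0..<1})"
proof -
  have "h \<in> borel_measurable (restrict_space borel {0..<1})"
    by (rule borel_measurable_continuous_on_restrict[OF h_cont])
  moreover have "sets (restrict_space lborel {0..<1::real}) = sets (restrict_space borel {0..<1})"
    by (simp add: sets_restrict_space)
  ultimately show ?thesis using measurable_cong_sets by blast
qed

lemma vimage_borel: "A \<in> sets borel \<Longrightarrow> h -` A \<inter> {0..<1} \<in> sets borel"
  using measurable_sets[OF h_meas, of A] by (simp add: sets_restrict_space_iff space_restrict_space)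

lemma emeasure_\<mu>: "A \<in> sets borel \<Longrightarrow> emeasure \<mu> A = emeasure lborel (h -` A \<inter> {0..<1})"
  unfolding \<mu>_def using vimage_borel[of A]
  by (subst emeasure_distr[OF h_meas]) (auto simp: emeasure_restrict_space space_restrict_space)

lemma measure_\<mu>: "A \<in> sets borel \<Longrightarrow> measure \<mu> A = measure lborel (h -` A \<inter> {0..<1})"
  by (simp add: measure_def emeasure_\<mu>)

text \<open>Pulled back by \<open>h\<close>, the image under \<open>T\<close> of a subset of
  \<open>ivl T a\<close> is the image under \<open>f'\<close> of a subset of
  \<open>ivl f' a\<close>, where \<open>f'\<close> is affine with slope
  \<open>exp (\<omega> $ a)\<close>.\<close>

lemma conf_\<mu>: "conf T \<omega> \<mu>"
  unfolding conf_def
proof (intro conjI allI ballI impI)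
  have "h -` UNIV \<inter> {0..<1} = {0..<1}" by simp
  then show "finite_measure \<mu>"
    using emeasure_\<mu>[of UNIV] by (intro finite_measureI) (auto simp: \<mu>_def)
  show "sets \<mu> = sets borel" by (simp add: \<mu>_def)
  fix a and A :: "real set" assume A: "A \<in> sets borel" "A \<subseteq> ivl T a"
  define B where "B = h -` A \<inter> {0..<1}"
  have B: "B \<in> sets borel" using vimage_borel[OF A(1)] by (simp add: B_def)
  have Bi: "B \<subseteq> ivl f' a" using h_ivl A(2) by (auto simp: B_def)
  have eq: "h -` (amap T ` A) \<inter> {0..<1} = amap f' ` B"
  proof (intro equalityI subsetI)
    fix x assume x: "x \<in> h -` (amap T ` A) \<inter> {0..<1}"
    then obtain y where y: "y \<in> A" "h x = amap T y" by auto
    have "y \<in> {0..<1}" using y(1) A(2) ivl_Un by blast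
    then obtain x' where x': "x' \<in> {0..<1}" "y = h x'" using h_image by blast
    then have "h x = h (amap f' x')" using h_conj y by simp
    then have "x = amap f' x'" using h_inj[of x "amap f' x'"] x f'_unit[OF x'(1)] by blast
    then show "x \<in> amap f' ` B" using x' y by (auto simp: B_def)
  next
    fix x assume "x \<in> amap f' ` B"
    then obtain x' where x': "x' \<in> {0..<1}" "h x' \<in> A" "x = amap f' x'" by (auto simp: B_def)
    then show "x \<in> h -` (amap T ` A) \<inter> {0..<1}" using h_conj f'_unit by auto
  qed
  have fB: "amap f' ` B \<in> sets borel" by (rule amap_image_borel[OF f' B Bi])
  have "amap f' ` B = (\<lambda>x. exp (\<omega> $ a) *\<^sub>R x + (bot_left f' a - exp (\<omega> $ a) * top_left f' a)) ` B"
    using Bi amap_ivl[OF f'] by (intro image_cong) (auto simp: slope_f' algebra_simps)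
  then have "measure lebesgue (amap f' ` B) = exp (\<omega> $ a) * measure lebesgue B"
    using measure_lebesgue_affine[of "exp (\<omega> $ a)" _ B] by simp
  then have "measure lborel (amap f' ` B) = exp (\<omega> $ a) * measure lborel B"
    using B fB by (simp add: measure_completion)
  then show "measure \<mu> (amap T ` A) = exp (\<omega> $ a) * measure \<mu> A"
    using measure_\<mu>[OF A(1)] measure_\<mu>[OF amap_image_borel[OF f A]] by (simp add: eq B_def)
qed

lemma \<mu>_1: "measure \<mu> {0..<1} = 1"
proof -
  have "h -` {0..<1} \<inter> {0..<1} = {0..<1}" using h_in by auto
  then show ?thesis by (simp add: measure_\<mu>)
qed

lemma h_image1: "h ` {0..1} = {0..1}"
proof -
  have u: "{0..1} = insert 1 {0..<1::real}" by auto
  show ?thesis unfolding u by (simp add: h_image h_1)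
qed

text \<open>As \<open>h\<close> is increasing, the half-open interval pulls back to the one between
  the inverse images of its ends. The point 1 needs separate care, since monotonicity is given on
  the half-open unit interval.\<close>

lemma measure_\<mu>_ivl:
  assumes "0 \<le> y" "y \<le> z" "z \<le> 1"
  shows "measure \<mu> {y..<z} = inv_into {0..1} h z - inv_into {0..1} h y"
proof -
  let ?u = "inv_into {0..1} h"
  have u: "?u x \<in> {0..1}" "h (?u x) = x" if "x \<in> {0..1}" for x
    using that h_image1 inv_into_into[of x h "{0..1}"] f_inv_into_f[of x h "{0..1}"] by auto
  have le: "x \<le> h v \<longleftrightarrow> ?u x \<le> v" if "x \<in> {0..1}" "v \<in> {0..<1}" for x v
  proof (cases "?u x = 1")
    case True
    then have "x = 1" using u[OF that(1)] h_1 by simp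
    then show ?thesis using True h_in[OF that(2)] that(2) by auto
  next
    case False
    then have "?u x \<in> {0..<1}" using u[OF that(1)] by auto
    then show ?thesis using h_less_iff[of v "?u x"] that u(2)[OF that(1)] by (auto simp: not_less[symmetric])
  qed
  have y: "y \<in> {0..1}" and z: "z \<in> {0..1}" using assms by auto
  have "h -` {y..<z} \<inter> {0..<1} = {?u y..<?u z}"
    using le[OF y] le[OF z] u[OF y] u[OF z] by (auto simp: not_le[symmetric])
  moreover have "?u y \<le> ?u z"
  proof (cases "?u z = 1")
    case False
    then have "?u z \<in> {0..<1}" using u[OF z] by auto
    then show ?thesis using le[OF y, of "?u z"] u(2)[OF z] assms(2) by (simp only:)
  qed (use u[OF y] in auto)
  ultimately show ?thesis by (simp add: measure_\<mu>)
qed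

end

theorem proposition15p3:
  fixes T f :: "'a::finite aiet" and N :: nat and \<omega> :: "real ^ 'a"
    and h :: "real \<Rightarrow> real" and \<nu>\<^sub>\<omega> \<nu>\<^sub>c :: "real measure"
  assumes "CARD('a) \<ge> 2"
    and "hyperbolically_self_similar T"
    and "positive_period T N"
    and "central_stable_type T N \<omega>"
    and "f \<in> Aff T \<omega>"
    and "conjugacy f T h"
    and "conformal_measure T \<omega> \<nu>\<^sub>\<omega>"
    and "conformal_measure T (central_part T N \<omega>) \<nu>\<^sub>c"
  shows "holder_exponent (inv_into {0..1} h) = ereal (xi T N \<nu>\<^sub>c / rho T N) \<and>
         0 < xi T N \<nu>\<^sub>c / rho T N \<and>
         ereal (xi T N \<nu>\<^sub>c / rho T N) < measure_hausdorff_dim \<nu>\<^sub>\<omega>"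
proof -
  have T: "is_aiet T"
    using assms(2) by (simp add: hyperbolically_self_similar_def self_similar_def is_iet_def)
  obtain c s where c: "\<omega> = c + s" "ss_matrix T N *v c = c" "c \<noteq> 0" "s \<in> contracting_space (ss_matrix T N)"
    using assms(4) by (auto simp: central_stable_type_def)
  have s: "\<omega> - c \<in> contracting_space (ss_matrix T N)" using c by simp
  have cp: "central_part T N \<omega> = c" by (rule central_part_eqI[OF c(2) s])
  interpret central T N c \<nu>\<^sub>c
    using assms(1-3) c conf_conformal[OF T assms(8)[unfolded cp]]
    by unfold_locales (auto simp: hyperbolically_self_similar_def)
  interpret conjugate T N f \<omega> h
    using assms(5,6) by unfold_locales
  have "holder_exponent (inv_into {0..1} h) = ereal (\<xi> / rho T N)"
    by (rule holder_eq[OF conf_\<mu> \<mu>_1 s]) (rule measure_\<mu>_ivl)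
  moreover have "measure \<nu>\<^sub>\<omega> UNIV = 1"
    using assms(7) by (simp add: conformal_measure_def measure_def)
  then have "ereal (\<xi> / rho T N) < measure_hausdorff_dim \<nu>\<^sub>\<omega>"
    using dim_bound[OF conf_conformal[OF T assms(7)] _ s] by blast
  ultimately show ?thesis using xi_pos rho_pos by (simp add: \<xi>_def)
qed

end
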